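(* For every integer $k\ge 2$, every string graph with $n$ vertices admits a $\frac{3}{4}(5^k-1)$-hop spanner of size $O(n\,\alpha_k(n))$.
   Context: A string graph is the intersection graph of a finite collection of curves in the plane: the vertices are the curves, and two vertices are adjacent iff the curves intersect. For a graph $G$ and integer $t\ge1$, a $t$-hop spanner is a subgraph $\widehat{G}$ of $G$ on the same vertex set such that for every edge $uv\in E(G)$ there is a $u$–$v$ path in $\widehat{G}$ with at most $t$ edges; its size is its number of edges. The functions $\alpha_k$ form the inverse Ackermann hierarchy: $\alpha_0(n)=n/2$, and for $k\ge1$, $\alpha_k(n)$ is the number of times $\alpha_{k-1}$ must be iteratively applied starting from $n$ to reach a value at most $1$; thus $\alpha_1(n)=\Theta(\log n)$, $\alpha_2(n)=\Theta(\log^* n)$, etc. *)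

theory Defs
  imports "HOL-Analysis.Analysis"
begin

fun inv_ack :: "nat \<Rightarrow> real \<Rightarrow> real" where
  "inv_ack 0 x = x / 2"
| "inv_ack (Suc k) x = real (LEAST i. (inv_ack k ^^ i) x \<le> 1)"

text \<open>A curve in the plane: a continuous map from [0,1] (HOL-Analysis notion path).
The string graph of a family of curves c indexed by the vertex set V: the edges are
the unordered pairs {u,v} of distinct vertices whose curves intersect.\<close>
definition string_graph_edges :: "nat set \<Rightarrow> (nat \<Rightarrow> real \<Rightarrow> complex) \<Rightarrow> nat set set" where
  "string_graph_edges V c =
     {{u, v} | u v. u \<in> V \<and> v \<in> V \<and> u \<noteq> v \<and> path_image (c u) \<inter> path_image (c v) \<noteq> {}}"

definition hop_connected :: "'a set set \<Rightarrow> nat \<Rightarrow> 'a \<Rightarrow> 'a \<Rightarrow> bool" where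
  "hop_connected H t u v \<longleftrightarrow>
     (\<exists>xs. xs \<noteq> [] \<and> hd xs = u \<and> last xs = v \<and> length xs \<le> t + 1 \<and>
           (\<forall>i. Suc i < length xs \<longrightarrow> {xs ! i, xs ! Suc i} \<in> H))"

definition is_hop_spanner :: "'a set set \<Rightarrow> 'a set set \<Rightarrow> nat \<Rightarrow> bool" where
  "is_hop_spanner E H t \<longleftrightarrow> H \<subseteq> E \<and> (\<forall>u v. {u, v} \<in> E \<longrightarrow> hop_connected H t u v)"

end

(* Only one topological fact is needed: of nine paths joining three points of the plane with three
   others, two without a common end point meet.  It passes to induced subgraphs and to contractions
   of connected sets, so that everything else is done in the combinatorial class k33_graph.

   Counting touching pairs of paths bounds from below the energy of any routing of all pairs of
   vertices.  An energy minimal routing yields vertex weights of large average distance, and a sweep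
   cut or region growing (Leighton-Rao) turns these into sublinear balanced separators for graphs
   of small maximum degree.  Repeated separation cuts off pieces of size polynomial in the degree
   bound d at the price of a fraction 1/d of the vertices.

   Removing stars of large degree and separating the rest gives a 3-hop spanner of size
   n * polylog n.  Given a t-hop spanner of size n * g(n), take d about g(n), contract the stars of
   degree at least d and the separating vertices (at most n/d clusters), use the t-hop spanner for
   the contracted graph, attach the neighbouring vertices, and recurse into the pieces: this gives
   5t+3 hops and 2n edges per level of recursion, while the piece size drops from n to poly(g(n)). *)

theory Submission
  imports Defs
begin

section \<open>Independent paths of a planar drawing of \<open>K\<^sub>3\<^sub>,\<^sub>3\<close>\<close>

text \<open>String graphs can be dense and their curves may cross arbitrarily often, so no planar
  embedding of the graph itself is at hand. Connections with a common end cannot be kept apart,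
  which is why the topological input ignores such pairs; it then holds for arbitrary, even repeated,
  choices of the six end points, and counting touching pairs becomes a plain average.

  The initial bound is n times the seventh power of a logarithm. The power does not survive, because
  the density g(n) of the given spanner enters only the piece size. Two rounds of contraction leave
  pieces of size polynomial in log(poly(\<alpha>_k(n))), which is eventually below \<alpha>_k(n). So
  a pair of rounds replaces n by \<alpha>_k(n), and \<alpha>_{k+1}(n) pairs finish. From the first
  improvement on the size is linear in the inverse Ackermann function; hence k \<ge> 2. The hop
  count does not grow with the depth of this recursion: an edge either lies inside one piece or has
  an end in a cluster, so spanners of different depths are never composed.\<close>

definition log_change :: "complex \<Rightarrow> (real \<Rightarrow> complex) \<Rightarrow> complex \<Rightarrow> bool" where
  "log_change z g d \<longleftrightarrow> (\<exists>l. continuous_on {0..1} l \<and> (\<forall>t\<in>{0..1}. g t - z = exp (l t)) \<and> d = l 1 - l 0)"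

text \<open>Two continuous logarithms of the same path differ by a continuous function into the
  discrete set of multiples of 2 pi i, hence by a constant.\<close>

lemma log_change_unique:
  assumes "log_change z g d" "log_change z g d'"
  shows "d = d'"
proof -
  obtain l where l: "continuous_on {0..1} l" "\<forall>t\<in>{0..1}. g t - z = exp (l t)" "d = l 1 - l 0"
    using assms(1) unfolding log_change_def by blast
  obtain m where m: "continuous_on {0..1} m" "\<forall>t\<in>{0..1}. g t - z = exp (m t)" "d' = m 1 - m 0"
    using assms(2) unfolding log_change_def by blast
  have e1: "exp (l t - m t) = 1" if "t \<in> {0..1}" for t
    using l(2) m(2) that by (metis exp_diff exp_not_eq_zero divide_self)
  have "(\<lambda>t. l t - m t) constant_on {0..1}"
  proof (rule continuous_discrete_range_constant)
    show "connected {0..1::real}" by simp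
    show "continuous_on {0..1} (\<lambda>t. l t - m t)" using l(1) m(1) by (intro continuous_intros)
    show "\<exists>e>0. \<forall>y. y \<in> {0..1} \<and> l y - m y \<noteq> l x - m x \<longrightarrow> e \<le> norm (l y - m y - (l x - m x))"
      if x: "x \<in> {0..1}" for x
    proof (intro exI[of _ "1::real"] conjI allI impI)
      fix y assume y: "y \<in> {0..1} \<and> l y - m y \<noteq> l x - m x"
      define w where "w = l y - m y - (l x - m x)"
      have "exp w = 1" "w \<noteq> 0" using e1[of x] e1[of y] x y by (auto simp: w_def exp_diff)
      then obtain n where "Re w = 0" and n: "Im w = of_int (2 * n) * pi" using exp_eq_1 by blast
      hence "n \<noteq> 0" using \<open>w \<noteq> 0\<close> by (auto simp: complex_eq_iff)
      hence "1 \<le> \<bar>real_of_int n\<bar>" by linarith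
      hence "1 * 1 \<le> \<bar>real_of_int n\<bar> * (2 * pi)" using pi_gt3 by (intro mult_mono) auto
      also have "\<dots> = \<bar>Im w\<bar>" using n by (simp add: abs_mult)
      also have "\<dots> \<le> norm w" by (rule abs_Im_le_cmod)
      finally show "1 \<le> norm (l y - m y - (l x - m x))" by (simp add: w_def)
    qed simp
  qed
  then have "l 1 - m 1 = l 0 - m 0" unfolding constant_on_def by fastforce
  thus ?thesis using l(3) m(3) by (metis add_diff_cancel_left' diff_add_cancel diff_diff_eq2 diff_right_commute)
qed

text \<open>The end points determine the change up to multiples of 2 pi i. Keeping the complex value
  rather than only the angle makes the final contradiction a rational identity.\<close>

lemma log_change_exp:
  assumes "log_change z g d"
  shows "exp d = (g 1 - z) / (g 0 - z)" "g 0 \<noteq> z" "g 1 \<noteq> z"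
proof -
  obtain l where l: "\<forall>t\<in>{0..1}. g t - z = exp (l t)" "d = l 1 - l 0"
    using assms unfolding log_change_def by blast
  have "g 0 - z = exp (l 0)" "g 1 - z = exp (l 1)" using l(1) by auto
  thus "exp d = (g 1 - z) / (g 0 - z)" "g 0 \<noteq> z" "g 1 \<noteq> z"
    using l(2) by (auto simp: exp_diff)
qed

text \<open>The four sides of the square on which \<open>h t - g s\<close> has a continuous logarithm.\<close>
lemma log_change_square:
  assumes "path g" "path h" "path_image g \<inter> path_image h = {}"
  obtains a b c d where "log_change (g 0) h a" "log_change (g 1) h b"
    "log_change (h 0) g c" "log_change (h 1) g d" "a + d = b + c"
proof -
  define Q :: "(real \<times> real) set" where "Q = {0..1} \<times> {0..1}"
  have cg: "continuous_on {0..1} g" and ch: "continuous_on {0..1} h"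
    using assms by (auto simp: path_def)
  have c1: "continuous_on Q (\<lambda>x. h (snd x) - g (fst x))"
    unfolding Q_def
    by (intro continuous_intros continuous_on_compose2[OF cg] continuous_on_compose2[OF ch]) auto
  have "convex Q" unfolding Q_def by (intro convex_Times) auto
  then have "contractible Q" by (rule convex_imp_contractible)
  moreover have "h (snd x) - g (fst x) \<noteq> 0" if "x \<in> Q" for x
  proof -
    have "h (snd x) \<in> path_image h" "g (fst x) \<in> path_image g"
      using that by (auto simp: Q_def path_image_def)
    then show ?thesis using assms(3) by auto
  qed
  ultimately obtain l where l: "continuous_on Q l" "\<And>x. x \<in> Q \<Longrightarrow> h (snd x) - g (fst x) = exp (l x)"
    using continuous_logarithm_on_contractible[OF c1] by blast
  have 1: "log_change (g s) h (l (s,1) - l (s,0))" if "s \<in> {0..1}" for s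
    unfolding log_change_def
  proof (intro exI[of _ "\<lambda>t. l (s,t)"] conjI ballI)
    show "continuous_on {0..1} (\<lambda>t. l (s, t))"
      using that by (intro continuous_on_compose2[OF l(1)] continuous_intros) (auto simp: Q_def)
    show "h t - g s = exp (l (s, t))" if "t \<in> {0..1}" for t
      using l(2)[of "(s,t)"] that \<open>s \<in> {0..1}\<close> by (simp add: Q_def)
  qed simp
  \<comment> \<open>The difference now has the opposite sign; the constant \<open>\<i> * pi\<close>
    corrects the logarithm and drops out of the change.\<close>
  have 2: "log_change (h t) g (l (1,t) - l (0,t))" if "t \<in> {0..1}" for t
    unfolding log_change_def
  proof (intro exI[of _ "\<lambda>s. l (s,t) + \<i> * pi"] conjI ballI)
    show "continuous_on {0..1} (\<lambda>s. l (s, t) + \<i> * pi)"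
      using that by (intro continuous_intros continuous_on_compose2[OF l(1)]) (auto simp: Q_def)
    show "g s - h t = exp (l (s, t) + \<i> * pi)" if "s \<in> {0..1}" for s
      using l(2)[of "(s,t)"] that \<open>t \<in> {0..1}\<close> by (simp add: Q_def exp_add) (metis minus_diff_eq)
  qed simp
  show ?thesis
    by (rule that[OF 1[of 0] 1[of 1] 2[of 0] 2[of 1]]) (auto simp: algebra_simps)
qed

text \<open>Hanani--Tutte for \<open>K\<^sub>3\<^sub>,\<^sub>3\<close>: only pairs of edges without a common end vertex count, so
  edges at a common vertex may cross.  The relations of \<open>log_change_square\<close> cancel in sums
  over cyclic shifts of the indices and force \<open>X i = 0\<close>, whereas \<open>exp (X i) = - 1\<close>.\<close>
lemma K33_independent_paths_meet:
  fixes p q :: "nat \<Rightarrow> complex" and g :: "nat \<Rightarrow> nat \<Rightarrow> real \<Rightarrow> complex"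
  assumes g: "\<And>i j. i < 3 \<Longrightarrow> j < 3 \<Longrightarrow> path (g i j) \<and> g i j 0 = p i \<and> g i j 1 = q j"
  shows "\<exists>i<3. \<exists>i'<3. \<exists>j<3. \<exists>j'<3. i \<noteq> i' \<and> j \<noteq> j' \<and> path_image (g i j) \<inter> path_image (g i' j') \<noteq> {}"
proof (rule ccontr)
  assume "\<not> ?thesis"
  then have disj: "path_image (g i j) \<inter> path_image (g i' j') = {}"
    if "i < 3" "i' < 3" "j < 3" "j' < 3" "i \<noteq> i'" "j \<noteq> j'" for i i' j j' using that by blast
  \<comment> \<open>Arbitrary if \<open>g\<close> meets \<open>z\<close>; below it is evaluated only
    for independent pairs, where \<open>sq\<close> provides a logarithm.\<close>
  define D where "D z g = (SOME d. log_change z g d)" for z g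
  have D: "log_change z g (D z g)" "D z g = d" if "log_change z g d" for z g d
    using that someI[of "log_change z g"] log_change_unique unfolding D_def by blast+
  define a where "a i i' j' = D (p i) (g i' j')" for i i' j'
  define b where "b j i' j' = D (q j) (g i' j')" for j i' j'
  have sq: "a i i' j' + b j' i j = b j i' j' + a i' i j \<and> log_change (q j) (g i' j') (b j i' j')"
    if "i < 3" "i' < 3" "j < 3" "j' < 3" "i \<noteq> i'" "j \<noteq> j'" for i i' j j'
  proof -
    have "path (g i j)" "path (g i' j')" using g that by auto
    moreover have "path_image (g i j) \<inter> path_image (g i' j') = {}" using disj that by blast
    ultimately obtain x y z w where "log_change (g i j 0) (g i' j') x" "log_change (g i j 1) (g i' j') y"
      "log_change (g i' j' 0) (g i j) z" "log_change (g i' j' 1) (g i j) w" "x + w = y + z"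
      by (rule log_change_square)
    then show ?thesis using g that D unfolding a_def b_def by metis
  qed
  \<comment> \<open>Adding the relations \<open>sq\<close> with \<open>j = j' + 1\<close> and
    subtracting those with \<open>j = j' + 2\<close> (modulo 3) cancels every term in
    \<open>a\<close> and leaves \<open>X i + X i' = 0\<close>.\<close>
  define X where "X i = b 1 i 0 - b 2 i 0 + (b 2 i 1 - b 0 i 1) + (b 0 i 2 - b 1 i 2)" for i
  have X: "X i' = - X i" if "i < 3" "i' < 3" "i \<noteq> i'" for i i'
  proof -
    have e: "a i i' j' + b j' i j = b j i' j' + a i' i j" if "j < 3" "j' < 3" "j \<noteq> j'" for j j'
      using sq \<open>i < 3\<close> \<open>i' < 3\<close> \<open>i \<noteq> i'\<close> that by blast
    show ?thesis
      using e[of 1 0] e[of 2 0] e[of 2 1] e[of 0 1] e[of 0 2] e[of 1 2] unfolding X_def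
      by simp algebra
  qed
  have "X 1 = - X 0" "X 2 = - X 1" "X 0 = - X 2" by (auto intro: X)
  then have "X 0 = 0" by simp
  have E: "exp (b j 0 j') = (q j' - q j) / (p 0 - q j)" "p 0 \<noteq> q j" "q j' \<noteq> q j"
    if "j < 3" "j' < 3" "j \<noteq> j'" for j j'
  proof -
    have l: "log_change (q j) (g 0 j') (b j 0 j')" using sq[of 1 0 j j'] that by auto
    show "exp (b j 0 j') = (q j' - q j) / (p 0 - q j)" "p 0 \<noteq> q j" "q j' \<noteq> q j"
      using log_change_exp[OF l] g that by auto
  qed
  have nz: "p 0 - q 0 \<noteq> 0" "p 0 - q 1 \<noteq> 0" "p 0 - q 2 \<noteq> 0"
    using E(2)[of 0 1] E(2)[of 1 0] E(2)[of 2 0] by auto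
  have nq: "q 0 - q 1 \<noteq> 0" "q 0 - q 2 \<noteq> 0" "q 1 - q 2 \<noteq> 0"
    using E(3)[of 0 1] E(3)[of 1 2] E(3)[of 0 2] by auto
  \<comment> \<open>Every \<open>p 0 - q j\<close> occurs once above and once below. Each difference
    of two \<open>q j\<close> occurs once above and once, reversed, below, so three signs
    remain.\<close>
  have "exp (X 0) = exp (b 1 0 0) / exp (b 2 0 0) * (exp (b 2 0 1) / exp (b 0 0 1))
      * (exp (b 0 0 2) / exp (b 1 0 2))"
    unfolding X_def by (simp add: exp_add exp_diff)
  also have "\<dots> = ((q 0 - q 1) / (p 0 - q 1)) / ((q 0 - q 2) / (p 0 - q 2))
      * (((q 1 - q 2) / (p 0 - q 2)) / ((q 1 - q 0) / (p 0 - q 0)))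
      * (((q 2 - q 0) / (p 0 - q 0)) / ((q 2 - q 1) / (p 0 - q 1)))"
    using E(1)[of 1 0] E(1)[of 2 0] E(1)[of 2 1] E(1)[of 0 1] E(1)[of 0 2] E(1)[of 1 2] by simp
  also have "\<dots> = ((q 0 - q 1) / (p 0 - q 1)) / ((q 0 - q 2) / (p 0 - q 2))
      * (((q 1 - q 2) / (p 0 - q 2)) / (- (q 0 - q 1) / (p 0 - q 0)))
      * ((- (q 0 - q 2) / (p 0 - q 0)) / (- (q 1 - q 2) / (p 0 - q 1)))" by simp
  also have "\<dots> = - 1"
    using nz nq by (simp add: divide_simps del: minus_diff_eq)
  finally show False using \<open>X 0 = 0\<close> by simp
qed

section \<open>Graphs in which independent connections touch\<close>

text \<open>A walk is recorded only by a set \<open>K\<close> containing it: touching, load and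
  weight depend on the vertices alone, and under contraction a set of clusters simply becomes their
  union.\<close>

definition joined :: "('a \<Rightarrow> 'a \<Rightarrow> bool) \<Rightarrow> 'a set \<Rightarrow> 'a \<Rightarrow> 'a \<Rightarrow> bool" where
  "joined adj K u v \<longleftrightarrow> u \<in> K \<and> v \<in> K \<and> (\<lambda>x y. x \<in> K \<and> y \<in> K \<and> adj x y)\<^sup>*\<^sup>* u v"

lemma joined_refl: "u \<in> K \<Longrightarrow> joined adj K u u"
  by (simp add: joined_def)

lemma joined_edge: "u \<in> K \<Longrightarrow> v \<in> K \<Longrightarrow> adj u v \<Longrightarrow> joined adj K u v"
  by (simp add: joined_def r_into_rtranclp)

lemma joined_mono: "joined adj K u v \<Longrightarrow> K \<subseteq> L \<Longrightarrow> joined adj L u v"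
  unfolding joined_def
  by (auto elim!: rtranclp_mono[THEN predicate2D, rotated])

lemma joined_trans: "joined adj K u v \<Longrightarrow> joined adj K v w \<Longrightarrow> joined adj K u w"
  unfolding joined_def by auto

lemma joined_sym:
  assumes "\<And>x y. adj x y \<Longrightarrow> adj y x" "joined adj K u v"
  shows "joined adj K v u"
proof -
  have "symp (\<lambda>x y. x \<in> K \<and> y \<in> K \<and> adj x y)" using assms(1) by (auto simp: symp_def)
  then show ?thesis using assms(2) unfolding joined_def by (meson symp_rtranclp sympE)
qed

lemma joined_induct [consumes 1, case_names refl step]:
  assumes "joined adj K u v" "u \<in> K \<Longrightarrow> R u"
    and "\<And>x y. joined adj K u x \<Longrightarrow> y \<in> K \<Longrightarrow> adj x y \<Longrightarrow> R x \<Longrightarrow> R y"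
  shows "R v"
proof -
  have "(\<lambda>x y. x \<in> K \<and> y \<in> K \<and> adj x y)\<^sup>*\<^sup>* u v" "u \<in> K" using assms(1) by (auto simp: joined_def)
  then have "joined adj K u v \<and> R v"
  proof (induction rule: rtranclp_induct)
    case base then show ?case using assms(2) joined_refl by metis
  next
    case (step x y)
    then show ?case using assms(3) joined_trans joined_edge by metis
  qed
  then show ?thesis by simp
qed

text \<open>A combinatorial substitute for planarity: three vertices cannot be joined with three others
  by nine connected sets without two independent ones of them touching.\<close>
locale k33_graph =
  fixes V :: "'a set" and adj :: "'a \<Rightarrow> 'a \<Rightarrow> bool"
  assumes finite_V: "finite V"
    and adj_refl: "x \<in> V \<Longrightarrow> adj x x"
    and adj_sym: "adj x y \<Longrightarrow> adj y x"
    and touching: "(\<And>i j. i < 3 \<Longrightarrow> j < 3 \<Longrightarrow> K i j \<subseteq> V \<and> joined adj (K i j) (p i) (q j)) \<Longrightarrow>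
      \<exists>i<3::nat. \<exists>i'<3. \<exists>j<3::nat. \<exists>j'<3. i \<noteq> i' \<and> j \<noteq> j' \<and> (\<exists>x\<in>K i j. \<exists>y\<in>K i' j'. adj x y)"

lemma k33_graph_subset:
  assumes "k33_graph V adj" "U \<subseteq> V"
  shows "k33_graph U adj"
proof -
  interpret k33_graph V adj by fact
  show ?thesis
  proof
    show "finite U" using finite_V assms(2) finite_subset by blast
  next
    fix K :: "nat \<Rightarrow> nat \<Rightarrow> 'a set" and p q
    assume K: "\<And>i j. i < 3 \<Longrightarrow> j < 3 \<Longrightarrow> K i j \<subseteq> U \<and> joined adj (K i j) (p i) (q j)"
    have "K i j \<subseteq> V \<and> joined adj (K i j) (p i) (q j)" if "i < 3" "j < 3" for i j
      using K[OF that] assms(2) by auto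
    then show "\<exists>i<3. \<exists>i'<3. \<exists>j<3. \<exists>j'<3. i \<noteq> i' \<and> j \<noteq> j' \<and> (\<exists>x\<in>K i j. \<exists>y\<in>K i' j'. adj x y)"
      by (rule touching)
  qed (use adj_refl adj_sym assms(2) in auto)
qed

text \<open>Consecutive curves of a walk meet, so the union of the curves in \<open>K i j\<close>
  contains a path between the base points of \<open>p i\<close> and \<open>q j\<close>; the base
  point of a curve is its value at 0.\<close>

lemma k33_graph_strings:
  fixes c :: "'a \<Rightarrow> real \<Rightarrow> complex"
  assumes "finite V" "\<And>v. v \<in> V \<Longrightarrow> path (c v)"
  shows "k33_graph V (\<lambda>u v. path_image (c u) \<inter> path_image (c v) \<noteq> {})"
    (is "k33_graph V ?adj")
proof
  fix K :: "nat \<Rightarrow> nat \<Rightarrow> 'a set" and p q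
  assume K: "\<And>i j. i < 3 \<Longrightarrow> j < 3 \<Longrightarrow> K i j \<subseteq> V \<and> joined ?adj (K i j) (p i) (q j)"
  define A where "A i j = (\<Union>v\<in>K i j. path_image (c v))" for i j
  have pc: "path_component (path_image (c v)) a b"
    if "v \<in> V" "a \<in> path_image (c v)" "b \<in> path_image (c v)" for v a b
    using path_connected_path_image[OF assms(2)[OF that(1)]] that(2,3)
    by (auto simp: path_connected_component)
  have ends: "c v 0 \<in> path_image (c v)" for v by (simp add: path_image_def)
  have "\<exists>g. path g \<and> path_image g \<subseteq> A i j \<and> g 0 = c (p i) 0 \<and> g 1 = c (q j) 0"
    if ij: "i < 3" "j < 3" for i j
  proof -
    have KV: "K i j \<subseteq> V" and J: "joined ?adj (K i j) (p i) (q j)" using K ij by blast+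
    have sub: "path_component (A i j) a b" if "v \<in> K i j" "a \<in> path_image (c v)" "b \<in> path_image (c v)"
      for v a b
      using pc[of v a b] that KV unfolding A_def by (blast intro: path_component_of_subset)
    from J have "path_component (A i j) (c (p i) 0) (c (q j) 0)"
    proof (induction rule: joined_induct)
      case refl then show ?case using sub ends by blast
    next
      case (step x y)
      then obtain z where "z \<in> path_image (c x)" "z \<in> path_image (c y)" by blast
      moreover have "x \<in> K i j" using step by (simp add: joined_def)
      ultimately have "path_component (A i j) (c x 0) z" "path_component (A i j) z (c y 0)"
        using sub ends step by blast+
      then show ?case using step.IH path_component_trans by blast
    qed
    then show ?thesis
      unfolding path_component_def by (auto simp: pathstart_def pathfinish_def)
  qed
  then obtain g where g: "\<And>i j. i < 3 \<Longrightarrow> j < 3 \<Longrightarrow> path (g i j) \<and> path_image (g i j) \<subseteq> A i j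
      \<and> g i j 0 = c (p i) 0 \<and> g i j 1 = c (q j) 0" by metis
  obtain i i' j j' where ij: "i < 3" "i' < 3" "j < 3" "j' < 3" "i \<noteq> i'" "j \<noteq> j'"
    and ne: "path_image (g i j) \<inter> path_image (g i' j') \<noteq> {}"
    using K33_independent_paths_meet[of g "\<lambda>i. c (p i) 0" "\<lambda>j. c (q j) 0"] g by blast
  have "A i j \<inter> A i' j' \<noteq> {}" using ne g[of i j] g[of i' j'] ij by blast
  then have "\<exists>x\<in>K i j. \<exists>y\<in>K i' j'. ?adj x y" unfolding A_def by blast
  then show "\<exists>i<3. \<exists>i'<3. \<exists>j<3. \<exists>j'<3. i \<noteq> i' \<and> j \<noteq> j' \<and> (\<exists>x\<in>K i j. \<exists>y\<in>K i' j'. ?adj x y)"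
    using ij by blast
qed (use assms in auto)

text \<open>Replacing the clusters of a walk by their vertices gives a connected set of the original
  graph, and two touching unions contain two touching clusters.\<close>

lemma k33_graph_contract:
  fixes C :: "'b \<Rightarrow> 'a set" and center :: "'b \<Rightarrow> 'a"
  assumes "k33_graph V adj" "finite X"
    and C: "\<And>x y. x \<in> X \<Longrightarrow> y \<in> C x \<Longrightarrow> joined adj (C x) (center x) y"
    and CV: "\<And>x. x \<in> X \<Longrightarrow> center x \<in> C x \<and> C x \<subseteq> V"
  shows "k33_graph X (\<lambda>x x'. \<exists>y\<in>C x. \<exists>y'\<in>C x'. adj y y')"
proof -
  interpret k33_graph V adj by fact
  let ?adj = "\<lambda>x x'. \<exists>y\<in>C x. \<exists>y'\<in>C x'. adj y y'"
  show ?thesis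
  proof
    show "?adj x x" if "x \<in> X" for x using CV[OF that] adj_refl by blast
    show "?adj y x" if "?adj x y" for x y using that adj_sym by blast
  next
    fix K :: "nat \<Rightarrow> nat \<Rightarrow> 'b set" and p q
    assume K: "\<And>i j. i < 3 \<Longrightarrow> j < 3 \<Longrightarrow> K i j \<subseteq> X \<and> joined ?adj (K i j) (p i) (q j)"
    define L where "L i j = (\<Union>x\<in>K i j. C x)" for i j
    have "L i j \<subseteq> V \<and> joined adj (L i j) (center (p i)) (center (q j))" if ij: "i < 3" "j < 3" for i j
    proof
      have KX: "K i j \<subseteq> X" and J: "joined ?adj (K i j) (p i) (q j)" using K ij by blast+
      show "L i j \<subseteq> V" unfolding L_def
      proof (rule UN_least)
        show "C x \<subseteq> V" if "x \<in> K i j" for x using CV[of x] KX that by auto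
      qed
      from J show "joined adj (L i j) (center (p i)) (center (q j))"
      proof (induction rule: joined_induct)
        case refl then show ?case using CV KX by (auto simp: L_def intro!: joined_refl)
      next
        case (step x y)
        then have x: "x \<in> K i j" by (simp add: joined_def)
        obtain a b where ab: "a \<in> C x" "b \<in> C y" "adj a b" using step by blast
        have sub: "C x \<subseteq> L i j" "C y \<subseteq> L i j" using x step by (auto simp: L_def)
        have "joined adj (L i j) (center x) a" "joined adj (L i j) (center y) b"
          using C ab x step KX sub by (meson joined_mono subsetD)+
        moreover have "joined adj (L i j) a b" using ab sub by (blast intro: joined_edge)
        ultimately show ?case using step.IH adj_sym by (meson joined_sym joined_trans)
      qed
    qed
    then have "\<exists>i<3. \<exists>i'<3. \<exists>j<3. \<exists>j'<3. i \<noteq> i' \<and> j \<noteq> j' \<and> (\<exists>x\<in>L i j. \<exists>y\<in>L i' j'. adj x y)"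
      by (rule touching)
    then obtain i i' j j' where ij: "i < 3" "i' < 3" "j < 3" "j' < 3" "i \<noteq> i'" "j \<noteq> j'"
      and t: "\<exists>x\<in>L i j. \<exists>y\<in>L i' j'. adj x y" by blast
    from t have "\<exists>x\<in>K i j. \<exists>y\<in>K i' j'. ?adj x y" unfolding L_def by blast
    then show "\<exists>i<3. \<exists>i'<3. \<exists>j<3. \<exists>j'<3. i \<noteq> i' \<and> j \<noteq> j' \<and> (\<exists>x\<in>K i j. \<exists>y\<in>K i' j'. ?adj x y)"
      using ij by blast
  qed fact
qed

section \<open>Energy of routings and the number of touching pairs\<close>

context k33_graph
begin

definition deg :: "'a \<Rightarrow> nat" where
  "deg x = card {y \<in> V. adj x y}"

definition routing :: "('a \<Rightarrow> 'a \<Rightarrow> 'a set) \<Rightarrow> bool" where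
  "routing P \<longleftrightarrow> (\<forall>u\<in>V. \<forall>v\<in>V. P u v \<subseteq> V \<and> joined adj (P u v) u v)"

definition load :: "('a \<Rightarrow> 'a \<Rightarrow> 'a set) \<Rightarrow> 'a \<Rightarrow> nat" where
  "load P x = card {e \<in> V \<times> V. x \<in> P (fst e) (snd e)}"

text \<open>Quadratic in the loads, so that a minimiser has a useful derivative;
  \<open>deg x\<close> is the number of pairs \<open>(x, y)\<close> over which the squared load at
  \<open>x\<close> is summed when touching pairs are counted.\<close>

definition energy :: "('a \<Rightarrow> 'a \<Rightarrow> 'a set) \<Rightarrow> nat" where
  "energy P = (\<Sum>x\<in>V. deg x * (load P x)\<^sup>2)"

definition touching_pairs :: "('a \<Rightarrow> 'a \<Rightarrow> 'a set) \<Rightarrow> (('a \<times> 'a) \<times> ('a \<times> 'a)) set" where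
  "touching_pairs P = {(e, f). e \<in> V \<times> V \<and> f \<in> V \<times> V \<and>
     (\<exists>x\<in>P (fst e) (snd e). \<exists>y\<in>P (fst f) (snd f). adj x y)}"

lemma finite_touching_pairs: "finite (touching_pairs P)"
  by (rule finite_subset[of _ "(V \<times> V) \<times> (V \<times> V)"]) (auto simp: touching_pairs_def finite_V)

text \<open>A touching pair of routed sets uses some adjacent \<open>x\<close> and \<open>y\<close>,
  and these serve at most \<open>load P x * load P y\<close> pairs, at most half the sum of the two
  squares.\<close>

lemma card_touching_pairs_le_energy:
  assumes "routing P"
  shows "card (touching_pairs P) \<le> energy P"
proof -
  define A where "A = {(x, y). x \<in> V \<and> y \<in> V \<and> adj x y}"
  define L where "L x = {e \<in> V \<times> V. x \<in> P (fst e) (snd e)}" for x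
  have A_Sigma: "A = Sigma V (\<lambda>x. {y \<in> V. adj x y})" by (auto simp: A_def)
  have finA: "finite A" unfolding A_Sigma using finite_V by auto
  have swap: "bij_betw prod.swap A A"
    by (rule bij_betwI[of _ _ _ prod.swap]) (auto simp: A_def adj_sym)
  have "touching_pairs P \<subseteq> (\<Union>(x, y)\<in>A. L x \<times> L y)"
  proof
    fix ef assume "ef \<in> touching_pairs P"
    then obtain e f x y where *: "ef = (e, f)" "e \<in> V \<times> V" "f \<in> V \<times> V"
      "x \<in> P (fst e) (snd e)" "y \<in> P (fst f) (snd f)" "adj x y"
      by (auto simp: touching_pairs_def)
    moreover from * have "x \<in> V" "y \<in> V" using assms unfolding routing_def by (metis mem_Times_iff subsetD)+
    ultimately show "ef \<in> (\<Union>(x, y)\<in>A. L x \<times> L y)" by (auto simp: A_def L_def)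
  qed
  then have "card (touching_pairs P) \<le> card (\<Union>(x, y)\<in>A. L x \<times> L y)"
    by (rule card_mono[rotated]) (use finA finite_V in \<open>auto simp: L_def\<close>)
  also have "\<dots> \<le> (\<Sum>(x, y)\<in>A. card (L x \<times> L y))"
    unfolding case_prod_beta by (rule card_UN_le[OF finA])
  also have "\<dots> = (\<Sum>(x, y)\<in>A. load P x * load P y)"
    by (intro sum.cong) (auto simp: load_def L_def card_cartesian_product)
  finally have "2 * card (touching_pairs P) \<le> (\<Sum>(x, y)\<in>A. 2 * (load P x * load P y))"
    by (simp add: case_prod_beta flip: sum_distrib_left)
  also have "\<dots> \<le> (\<Sum>(x, y)\<in>A. (load P x)\<^sup>2 + (load P y)\<^sup>2)"
  proof (rule sum_mono)
    fix z assume "z \<in> A"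
    have "2 * (a * b) \<le> a\<^sup>2 + b\<^sup>2" for a b :: nat
    proof -
      have "real (2 * (a * b)) \<le> real (a\<^sup>2 + b\<^sup>2)"
        using sum_squares_bound[of "real a" "real b"] by simp
      then show ?thesis by (simp only: of_nat_le_iff)
    qed
    then show "(case z of (x, y) \<Rightarrow> 2 * (load P x * load P y)) \<le> (case z of (x, y) \<Rightarrow> (load P x)\<^sup>2 + (load P y)\<^sup>2)"
      by (auto split: prod.split)
  qed
  also have "\<dots> = (\<Sum>(x, y)\<in>A. (load P x)\<^sup>2) + (\<Sum>(x, y)\<in>A. (load P y)\<^sup>2)"
    by (simp add: case_prod_beta sum.distrib)
  also have "(\<Sum>(x, y)\<in>A. (load P y)\<^sup>2) = (\<Sum>(x, y)\<in>A. (load P x)\<^sup>2)"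
    by (subst sum.reindex_bij_betw[OF swap, symmetric]) (simp add: case_prod_beta)
  also have "(\<Sum>(x, y)\<in>A. (load P x)\<^sup>2) = energy P"
    unfolding A_Sigma energy_def using finite_V by (subst sum.Sigma[symmetric]) (auto simp: deg_def)
  finally show ?thesis by simp
qed

text \<open>Double counting over all \<open>n ^ 6\<close> choices of two triples, repetitions
  allowed. Each choice has an independent touching pair at one of 36 positions; at a fixed position
  the pair determines four of the six vertices, which leaves \<open>n\<^sup>2\<close>
  choices.\<close>

lemma card_power4_le_touching_pairs:
  assumes "routing P"
  shows "card V ^ 4 \<le> 36 * card (touching_pairs P)"
proof (cases "V = {}")
  case False
  define n where "n = card V"
  have n: "n > 0" using False finite_V by (simp add: n_def card_gt_0_iff)
  define T where "T = touching_pairs P"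
  define F where "F = ({..<3::nat} \<rightarrow>\<^sub>E V) \<times> ({..<3::nat} \<rightarrow>\<^sub>E V)"
  define J :: "(nat \<times> nat) set" where "J = {(0,1),(0,2),(1,0),(1,2),(2,0),(2,1)}"
  define E where "E ii jj = {pq \<in> F. ((fst pq (fst ii), snd pq (fst jj)), (fst pq (snd ii), snd pq (snd jj))) \<in> T}"
    for ii jj :: "nat \<times> nat"
  have F_mem: "fst pq i \<in> V \<and> snd pq i \<in> V" if "pq \<in> F" "i < 3" for pq i
  proof -
    have "fst pq \<in> {..<3} \<rightarrow>\<^sub>E V" "snd pq \<in> {..<3} \<rightarrow>\<^sub>E V" "i \<in> {..<3}"
      using that by (simp_all add: F_def mem_Times_iff)
    then show ?thesis by (blast dest: PiE_mem)
  qed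
  have finF: "finite F" unfolding F_def using finite_V by (intro finite_cartesian_product finite_PiE) auto
  have cardF: "card F = n ^ 6"
    unfolding F_def using finite_V by (simp add: card_cartesian_product card_PiE n_def power_add[symmetric])
  have finT: "finite T" unfolding T_def by (rule finite_touching_pairs)
  have cardE: "card (E ii jj) \<le> card T * n\<^sup>2" if ii: "ii \<in> J" and jj: "jj \<in> J" for ii jj
  proof -
    obtain i i' where i: "ii = (i, i')" by (cases ii)
    obtain j j' where j: "jj = (j, j')" by (cases jj)
    \<comment> \<open>The indices 0, 1, 2 sum to 3, so this is the one missing from \<open>i\<close>
      and \<open>i'\<close>.\<close>
    define i'' where "i'' = 3 - i - i'"
    define j'' where "j'' = 3 - j - j'"
    have i3: "{..<3} = {i, i', i''}" and j3: "{..<3} = {j, j', j''}"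
      using ii jj by (auto simp: i j J_def i''_def j''_def)
    define \<phi> where "\<phi> pq = (((fst pq i, snd pq j), (fst pq i', snd pq j')), (fst pq i'', snd pq j''))"
      for pq :: "(nat \<Rightarrow> 'a) \<times> (nat \<Rightarrow> 'a)"
    have "inj_on \<phi> (E ii jj)"
    proof (rule inj_onI)
      fix x y assume xy: "x \<in> E ii jj" "y \<in> E ii jj" "\<phi> x = \<phi> y"
      have F: "fst x \<in> {..<3} \<rightarrow>\<^sub>E V" "fst y \<in> {..<3} \<rightarrow>\<^sub>E V" "snd x \<in> {..<3} \<rightarrow>\<^sub>E V" "snd y \<in> {..<3} \<rightarrow>\<^sub>E V"
        using xy(1,2) by (simp_all add: E_def F_def mem_Times_iff)
      have "fst x k = fst y k" if "k \<in> {..<3}" for k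
        using that xy(3) unfolding i3 \<phi>_def by auto
      then have "fst x = fst y" using F by (intro PiE_ext[of _ "{..<3}" "\<lambda>_. V"])
      have "snd x k = snd y k" if "k \<in> {..<3}" for k
        using that xy(3) unfolding j3 \<phi>_def by auto
      then have "snd x = snd y" using F by (intro PiE_ext[of _ "{..<3}" "\<lambda>_. V"])
      note \<open>fst x = fst y\<close> this
      then show "x = y" by (rule prod_eqI)
    qed
    moreover have "\<phi> ` E ii jj \<subseteq> T \<times> (V \<times> V)"
    proof -
      have "i'' < 3" "j'' < 3" using i3 j3 by blast+
      then show ?thesis using F_mem unfolding E_def \<phi>_def i j by (simp add: image_subset_iff)
    qed
    ultimately have "card (E ii jj) \<le> card (T \<times> (V \<times> V))"
      using finT finite_V by (intro card_inj_on_le) auto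
    then show ?thesis by (simp add: card_cartesian_product n_def power2_eq_square)
  qed
  have "F \<subseteq> (\<Union>(ii, jj)\<in>J \<times> J. E ii jj)"
  proof
    fix pq assume pq: "pq \<in> F"
    have V: "fst pq i \<in> V" "snd pq i \<in> V" if "i < 3" for i
      using F_mem[OF pq that] by auto
    define K where "K i j = P (fst pq i) (snd pq j)" for i j
    have "K i j \<subseteq> V \<and> joined adj (K i j) (fst pq i) (snd pq j)" if "i < 3" "j < 3" for i j
      using V that assms by (auto simp: K_def routing_def)
    then have "\<exists>i<3. \<exists>i'<3. \<exists>j<3. \<exists>j'<3. i \<noteq> i' \<and> j \<noteq> j' \<and> (\<exists>x\<in>K i j. \<exists>y\<in>K i' j'. adj x y)"
      by (rule touching)
    then obtain i i' j j' where ij: "i < 3" "i' < 3" "j < 3" "j' < 3" "i \<noteq> i'" "j \<noteq> j'"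
      and t: "\<exists>x\<in>K i j. \<exists>y\<in>K i' j'. adj x y" by blast
    have J: "(a, b) \<in> J" if "a < 3" "b < 3" "a \<noteq> b" for a b
    proof -
      have "a = 0 \<or> a = 1 \<or> a = 2" "b = 0 \<or> b = 1 \<or> b = 2" using that by linarith+
      then show ?thesis using that(3) unfolding J_def by fastforce
    qed
    have "(i, i') \<in> J" "(j, j') \<in> J" using ij J by blast+
    moreover have "pq \<in> E (i, i') (j, j')"
      using t pq V ij by (auto simp: E_def T_def touching_pairs_def K_def)
    ultimately show "pq \<in> (\<Union>(ii, jj)\<in>J \<times> J. E ii jj)" by blast
  qed
  moreover have finJ: "finite (J \<times> J)" by (simp add: J_def)
  ultimately have "n ^ 6 \<le> card (\<Union>(ii, jj)\<in>J \<times> J. E ii jj)"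
    using cardF finF by (intro order_trans[OF eq_refl card_mono]) (auto simp: E_def)
  also have "\<dots> \<le> (\<Sum>(ii, jj)\<in>J \<times> J. card (E ii jj))"
    unfolding case_prod_beta by (rule card_UN_le[OF finJ])
  also have "\<dots> \<le> (\<Sum>(ii, jj)\<in>J \<times> J. card T * n\<^sup>2)"
    by (rule sum_mono) (auto intro: cardE)
  also have "\<dots> = 36 * card T * n\<^sup>2"
  proof -
    have "card J = 6" by (simp add: J_def)
    then show ?thesis by (simp add: case_prod_beta card_cartesian_product)
  qed
  finally have "n ^ 4 * n\<^sup>2 \<le> 36 * card T * n\<^sup>2" by (simp flip: power_add)
  moreover have "0 < n\<^sup>2" using n by simp
  ultimately show ?thesis unfolding n_def T_def by (simp only: mult_le_cancel2)
qed auto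

lemma card_power4_le_energy: "routing P \<Longrightarrow> card V ^ 4 \<le> 36 * energy P"
  using card_power4_le_touching_pairs[of P] card_touching_pairs_le_energy[of P] by linarith

end

section \<open>Vertex weights from energy minimal routings\<close>

context k33_graph
begin

lemma deg_pos: "x \<in> V \<Longrightarrow> deg x > 0"
  using adj_refl finite_V unfolding deg_def by (auto simp: card_gt_0_iff)

lemma deg_le: "deg x \<le> card V"
  unfolding deg_def using finite_V by (auto intro: card_mono)

lemma sum_deg_le: "(\<Sum>x\<in>V. deg x) \<le> (card V)\<^sup>2"
  using sum_bounded_above[of V deg "card V"] deg_le by (simp add: power2_eq_square)

lemma load_split:
  assumes "u \<in> V" "v \<in> V"
  shows "load P x = card {e \<in> V \<times> V - {(u, v)}. x \<in> P (fst e) (snd e)} + of_bool (x \<in> P u v)"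
proof -
  let ?S = "{e \<in> V \<times> V - {(u, v)}. x \<in> P (fst e) (snd e)}"
  have "{e \<in> V \<times> V. x \<in> P (fst e) (snd e)} = (if x \<in> P u v then insert (u, v) ?S else ?S)"
    using assms by auto
  moreover have "finite ?S" using finite_V by auto
  ultimately show ?thesis unfolding load_def by simp
qed

lemma sum_routing:
  assumes "routing P"
  shows "(\<Sum>u\<in>V. \<Sum>v\<in>V. \<Sum>x\<in>P u v. f x) = (\<Sum>x\<in>V. f x * load P x)"
proof -
  have "(\<Sum>u\<in>V. \<Sum>v\<in>V. \<Sum>x\<in>P u v. f x) = (\<Sum>e\<in>V \<times> V. \<Sum>x\<in>P (fst e) (snd e). f x)"
    by (simp add: sum.cartesian_product case_prod_beta)
  also have "\<dots> = (\<Sum>e\<in>V \<times> V. \<Sum>x | x \<in> V \<and> x \<in> P (fst e) (snd e). f x)"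
    using assms by (intro sum.cong refl) (auto simp: routing_def, blast)
  also have "\<dots> = (\<Sum>x\<in>V. \<Sum>e | e \<in> V \<times> V \<and> x \<in> P (fst e) (snd e). f x)"
    using finite_V by (intro sum.swap_restrict) auto
  also have "\<dots> = (\<Sum>x\<in>V. f x * load P x)"
    by (simp add: load_def mult.commute)
  finally show ?thesis .
qed

text \<open>Plays the role of linear programming duality between routings and metrics.\<close>
lemma energy_minimal_exchange:
  assumes P: "routing P" and min: "\<And>R. routing R \<Longrightarrow> energy P \<le> energy R"
    and uv: "u \<in> V" "v \<in> V" and K: "K \<subseteq> V" "joined adj K u v"
  shows "(\<Sum>x\<in>P u v. deg x * load P x) \<le> (\<Sum>x\<in>K. deg x * (2 * load P x + 1))"
proof -
  define R where "R = P(u := (P u)(v := K))"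
  have R: "routing R" using P K unfolding routing_def R_def by auto
  have Ruv: "R u v = K" by (simp add: R_def)
  have PV: "P u v \<subseteq> V" using P uv by (auto simp: routing_def)
  let ?p = "\<lambda>x. of_bool (x \<in> P u v) :: nat" and ?k = "\<lambda>x. of_bool (x \<in> K) :: nat"
  have loads: "\<exists>m. load P x = m + ?p x \<and> load R x = m + ?k x" for x
  proof -
    have "{e \<in> V \<times> V - {(u, v)}. x \<in> R (fst e) (snd e)} = {e \<in> V \<times> V - {(u, v)}. x \<in> P (fst e) (snd e)}"
      by (auto simp: R_def)
    then show ?thesis using load_split[OF uv, of P x] load_split[OF uv, of R x] Ruv by auto
  qed
  \<comment> \<open>Dropping \<open>x\<close> from the set lowers its squared load by
    \<open>2 * load P x - 1\<close>, which is at least \<open>load P x\<close>; adding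
    \<open>x\<close> raises it by at most \<open>2 * load P x + 1\<close>.\<close>
  have "deg x * (load R x)\<^sup>2 + ?p x * (deg x * load P x)
      \<le> deg x * (load P x)\<^sup>2 + ?k x * (deg x * (2 * load P x + 1))" for x
  proof -
    obtain m where m: "load P x = m + ?p x" "load R x = m + ?k x" using loads by blast
    have "(load R x)\<^sup>2 + ?p x * load P x \<le> (load P x)\<^sup>2 + ?k x * (2 * load P x + 1)"
      unfolding m by (auto simp: power2_eq_square algebra_simps)
    from mult_le_mono2[OF this, of "deg x"] show ?thesis by (simp add: algebra_simps)
  qed
  then have "(\<Sum>x\<in>V. deg x * (load R x)\<^sup>2 + ?p x * (deg x * load P x))
      \<le> (\<Sum>x\<in>V. deg x * (load P x)\<^sup>2 + ?k x * (deg x * (2 * load P x + 1)))"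
    by (rule sum_mono)
  then have "energy R + (\<Sum>x\<in>V. ?p x * (deg x * load P x))
      \<le> energy P + (\<Sum>x\<in>V. ?k x * (deg x * (2 * load P x + 1)))"
    unfolding energy_def sum.distrib .
  moreover have "(\<Sum>x\<in>V. ?p x * (deg x * load P x)) = (\<Sum>x\<in>P u v. deg x * load P x)"
    using PV finite_V by (intro sum.mono_neutral_cong_right) auto
  moreover have "(\<Sum>x\<in>V. ?k x * (deg x * (2 * load P x + 1))) = (\<Sum>x\<in>K. deg x * (2 * load P x + 1))"
    using K finite_V by (intro sum.mono_neutral_cong_right) auto
  ultimately show ?thesis using min[OF R] by linarith
qed

text \<open>The weights are the derivative of the energy at a minimal routing \<open>P\<close>, so
  by exchange every routing has total weight at least \<open>energy P\<close>. Cauchy-Schwarz bounds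
  the sum of the weights by about \<open>sqrt (D * energy P)\<close>, where \<open>D\<close> is the
  degree sum, and \<open>energy P\<close> is at least \<open>n ^ 4 / 36\<close>. Thus the average
  distance is large compared with the total weight.\<close>

theorem spreading_weights:
  assumes conn: "\<And>u v. u \<in> V \<Longrightarrow> v \<in> V \<Longrightarrow> joined adj V u v"
  obtains \<omega> :: "'a \<Rightarrow> nat" where "\<And>x. x \<in> V \<Longrightarrow> \<omega> x > 0"
    "\<And>R. routing R \<Longrightarrow> real (card V)^2 * real (\<Sum>x\<in>V. \<omega> x)
        \<le> 48 * sqrt (real (\<Sum>x\<in>V. deg x)) * real (\<Sum>u\<in>V. \<Sum>v\<in>V. \<Sum>x\<in>R u v. \<omega> x)"
proof -
  have "routing (\<lambda>u v. V)" using conn by (simp add: routing_def)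
  then obtain P where P: "routing P" and min: "\<And>R. routing R \<Longrightarrow> energy P \<le> energy R"
    using ex_has_least_nat[of routing _ energy] by blast
  define \<omega> where "\<omega> x = deg x * (2 * load P x + 1)" for x
  define n where "n = real (card V)"
  define D where "D = real (\<Sum>x\<in>V. deg x)"
  define Q where "Q = real (energy P)"
  define S where "S = real (\<Sum>x\<in>V. deg x * load P x)"
  have D0: "D \<ge> 0" and Q0: "Q \<ge> 0" and n0: "n \<ge> 0" by (auto simp: D_def Q_def n_def intro: sum_nonneg)
  have W: "real (\<Sum>x\<in>V. \<omega> x) = 2 * S + D"
    unfolding \<omega>_def S_def D_def
    by (simp add: sum_distrib_left sum.distrib algebra_simps)
  have "D \<le> n\<^sup>2" unfolding D_def n_def using sum_deg_le by (metis of_nat_le_iff of_nat_power)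
  then have sD: "sqrt D \<le> n" using n0 by (intro real_le_lsqrt) auto
  have "real (card V ^ 4) \<le> real (36 * energy P)"
    using card_power4_le_energy[OF P] by (simp only: of_nat_le_iff)
  then have n4: "n ^ 4 \<le> 36 * Q" by (simp add: n_def Q_def)
  have "(n\<^sup>2)\<^sup>2 \<le> (6 * sqrt Q)\<^sup>2" using n4 Q0 by (simp add: power_mult_distrib)
  then have n2: "n\<^sup>2 \<le> 6 * sqrt Q" by (rule power2_le_imp_le) (use Q0 in auto)
  have "S = (\<Sum>x\<in>V. sqrt (deg x) * (sqrt (deg x) * load P x))"
    unfolding S_def by (simp add: mult.assoc[symmetric])
  then have "S\<^sup>2 \<le> (\<Sum>x\<in>V. (sqrt (deg x))\<^sup>2) * (\<Sum>x\<in>V. (sqrt (deg x) * load P x)\<^sup>2)"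
    using Cauchy_Schwarz_ineq_sum by metis
  also have "\<dots> = D * Q"
    unfolding D_def Q_def energy_def by (simp add: power_mult_distrib)
  finally have S: "S \<le> sqrt D * sqrt Q" using D0 Q0 by (metis real_le_rsqrt real_sqrt_mult)
  have "2 * (n\<^sup>2 * S) \<le> 2 * ((6 * sqrt Q) * (sqrt D * sqrt Q))"
    using n2 S D0 Q0 by (intro mult_left_mono mult_mono) (auto simp: S_def intro!: sum_nonneg)
  also have "\<dots> = 12 * sqrt D * Q" using Q0 by simp
  finally have 1: "2 * (n\<^sup>2 * S) \<le> 12 * sqrt D * Q" .
  have "n\<^sup>2 * D = n\<^sup>2 * (sqrt D * sqrt D)" using D0 by simp
  also have "\<dots> \<le> n\<^sup>2 * (n * sqrt D)" using sD D0 by (intro mult_left_mono mult_right_mono) auto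
  also have "\<dots> = n ^ 3 * sqrt D" by (simp add: power2_eq_square power3_eq_cube)
  also have "\<dots> \<le> n ^ 4 * sqrt D"
  proof -
    have "n ^ 3 \<le> n ^ 4"
    proof (cases "card V = 0")
      case False
      then have "n \<ge> 1" by (simp add: n_def)
      then show ?thesis by (intro power_increasing) auto
    qed (simp add: n_def)
    then show ?thesis using D0 by (intro mult_right_mono) auto
  qed
  also have "\<dots> \<le> 36 * Q * sqrt D" using n4 D0 by (intro mult_right_mono) auto
  finally have 2: "n\<^sup>2 * D \<le> 36 * Q * sqrt D" .
  \<comment> \<open>48 is 12 from the load part \<open>2 * S\<close> of the weights plus 36 from the
    part \<open>D\<close>.\<close>
  have main: "n\<^sup>2 * real (\<Sum>x\<in>V. \<omega> x) \<le> 48 * sqrt D * Q"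
    using 1 2 unfolding W by (simp add: algebra_simps)
  show thesis
  proof (rule that[of \<omega>])
    show "\<omega> x > 0" if "x \<in> V" for x using deg_pos[OF that] by (simp add: \<omega>_def)
    fix R assume R: "routing R"
    have "energy P = (\<Sum>u\<in>V. \<Sum>v\<in>V. \<Sum>x\<in>P u v. deg x * load P x)"
      unfolding sum_routing[OF P] energy_def by (simp add: power2_eq_square mult.assoc)
    also have "\<dots> \<le> (\<Sum>u\<in>V. \<Sum>v\<in>V. \<Sum>x\<in>R u v. \<omega> x)"
      unfolding \<omega>_def using R
      by (intro sum_mono energy_minimal_exchange[OF P min]) (auto simp: routing_def)
    finally have "Q \<le> real (\<Sum>u\<in>V. \<Sum>v\<in>V. \<Sum>x\<in>R u v. \<omega> x)"
      unfolding Q_def by (simp only: of_nat_le_iff)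
    then have "48 * sqrt D * Q \<le> 48 * sqrt D * real (\<Sum>u\<in>V. \<Sum>v\<in>V. \<Sum>x\<in>R u v. \<omega> x)"
      using D0 by (intro mult_left_mono) auto
    with main show "real (card V)^2 * real (\<Sum>x\<in>V. \<omega> x)
        \<le> 48 * sqrt (real (\<Sum>x\<in>V. deg x)) * real (\<Sum>u\<in>V. \<Sum>v\<in>V. \<Sum>x\<in>R u v. \<omega> x)"
      unfolding n_def D_def by linarith
  qed
qed

end

section \<open>Separators\<close>

definition component_of :: "('a \<Rightarrow> 'a \<Rightarrow> bool) \<Rightarrow> 'a set \<Rightarrow> 'a \<Rightarrow> 'a set" where
  "component_of adj U x = {y. joined adj U x y}"

definition separates :: "('a \<Rightarrow> 'a \<Rightarrow> bool) \<Rightarrow> 'a set \<Rightarrow> 'a set \<Rightarrow> nat \<Rightarrow> bool" where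
  "separates adj U S b \<longleftrightarrow> S \<subseteq> U \<and> (\<forall>x\<in>U - S. card (component_of adj (U - S) x) \<le> b)"

lemma component_of_subset: "component_of adj U x \<subseteq> U"
  by (auto simp: component_of_def joined_def)

lemma component_of_closed:
  assumes "x \<in> A" "\<And>y z. y \<in> A \<Longrightarrow> z \<in> U - A \<Longrightarrow> \<not> adj y z"
  shows "component_of adj U x \<subseteq> component_of adj (U \<inter> A) x"
proof
  fix y assume "y \<in> component_of adj U x"
  then have "joined adj U x y" by (simp add: component_of_def)
  then have "joined adj (U \<inter> A) x y"
  proof (induction rule: joined_induct)
    case refl then show ?case using assms(1) by (simp add: joined_refl)
  next
    case (step y z)
    then have "y \<in> U \<inter> A" by (simp add: joined_def)
    moreover from this step assms(2) have "z \<in> U \<inter> A" by blast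
    ultimately show ?case using step joined_trans joined_edge by metis
  qed
  then show "y \<in> component_of adj (U \<inter> A) x" by (simp add: component_of_def)
qed

lemma component_of_mono: "U \<subseteq> U' \<Longrightarrow> component_of adj U x \<subseteq> component_of adj U' x"
  by (auto simp: component_of_def intro: joined_mono)

lemma separates_trivial: "finite U \<Longrightarrow> card U \<le> b \<Longrightarrow> separates adj U {} b"
  unfolding separates_def by (auto intro: order_trans[OF card_mono[OF _ component_of_subset]])

lemma separates_self: "separates adj U U b"
  by (simp add: separates_def)

lemma separates_mono: "separates adj U S b \<Longrightarrow> b \<le> b' \<Longrightarrow> separates adj U S b'"
  by (force simp: separates_def)

lemma separates_Un:
  assumes "finite U" "U = A \<union> S \<union> B" "A \<inter> B = {}" "A \<inter> S = {}" "B \<inter> S = {}"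
    and adj: "\<And>x y. x \<in> A \<Longrightarrow> y \<in> B \<Longrightarrow> \<not> adj x y" "\<And>x y. adj x y \<Longrightarrow> adj y x"
    and sep: "separates adj A SA b" "separates adj B SB b"
  shows "separates adj U (S \<union> SA \<union> SB) b"
  unfolding separates_def
proof (intro conjI ballI)
  show "S \<union> SA \<union> SB \<subseteq> U" using sep assms(2) by (auto simp: separates_def)
  fix x assume x: "x \<in> U - (S \<union> SA \<union> SB)"
  let ?R = "U - (S \<union> SA \<union> SB)"
  have fin: "finite A" "finite B" using assms(1,2) by auto
  have S: "SA \<subseteq> A" "SB \<subseteq> B" using sep by (auto simp: separates_def)
  show "card (component_of adj ?R x) \<le> b"
  proof (cases "x \<in> A")
    case True
    have "component_of adj ?R x \<subseteq> component_of adj (?R \<inter> A) x"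
      by (rule component_of_closed[OF True]) (use adj assms(2) in blast)
    also have "?R \<inter> A = A - SA" using assms S by auto
    finally have "card (component_of adj ?R x) \<le> card (component_of adj (A - SA) x)"
      using fin by (intro card_mono) (auto intro: finite_subset[OF component_of_subset])
    moreover have "card (component_of adj (A - SA) x) \<le> b"
      using sep(1) True x by (simp add: separates_def)
    ultimately show ?thesis by simp
  next
    case False
    then have xB: "x \<in> B" using x assms(2) by auto
    have "component_of adj ?R x \<subseteq> component_of adj (?R \<inter> B) x"
      by (rule component_of_closed[OF xB]) (use adj assms(2) in blast)
    also have "?R \<inter> B = B - SB" using assms S by auto
    finally have "card (component_of adj ?R x) \<le> card (component_of adj (B - SB) x)"
      using fin by (intro card_mono) (auto intro: finite_subset[OF component_of_subset])
    moreover have "card (component_of adj (B - SB) x) \<le> b"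
      using sep(2) xB x by (simp add: separates_def)
    ultimately show ?thesis by simp
  qed
qed

section \<open>Region growing by hops\<close>

primrec hop_ball :: "('a \<Rightarrow> 'a \<Rightarrow> bool) \<Rightarrow> 'a set \<Rightarrow> 'a \<Rightarrow> nat \<Rightarrow> 'a set" where
  "hop_ball adj U v 0 = {v}"
| "hop_ball adj U v (Suc i) = hop_ball adj U v i \<union> {y \<in> U. \<exists>x\<in>hop_ball adj U v i. adj x y}"

lemma hop_ball_subset: "v \<in> U \<Longrightarrow> hop_ball adj U v i \<subseteq> U"
  by (induction i) auto

lemma hop_ball_mono: "i \<le> j \<Longrightarrow> hop_ball adj U v i \<subseteq> hop_ball adj U v j"
  by (induction rule: inc_induct) auto

lemma hop_ball_mono_set: "U \<subseteq> U' \<Longrightarrow> hop_ball adj U v i \<subseteq> hop_ball adj U' v i"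
  by (induction i) auto

lemma self_in_hop_ball: "v \<in> hop_ball adj U v i"
  by (induction i) auto

text \<open>Some layer below radius \<open>q * l\<close> is thin because \<open>(1 + 1 / q) ^ q \<ge> 2\<close>.\<close>
lemma thin_layer:
  assumes U: "finite U" "card U < 2 ^ l" "v \<in> U" and q: "q \<ge> 1"
  shows "\<exists>i<q * l. q * card (hop_ball adj U v (Suc i) - hop_ball adj U v i) \<le> card (hop_ball adj U v i)"
proof (rule ccontr)
  define B where "B = hop_ball adj U v"
  have fin: "finite (B i)" for i
    unfolding B_def using hop_ball_subset[OF U(3)] U(1) finite_subset by metis
  assume "\<not> ?thesis"
  then have *: "card (B i) < q * card (B (Suc i) - B i)" if "i < q * l" for i
    using that by (auto simp: B_def not_le)
  have step: "(q + 1) * card (B i) \<le> q * card (B (Suc i))" if "i < q * l" for i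
  proof -
    have "B i \<subseteq> B (Suc i)" unfolding B_def by (rule hop_ball_mono) simp
    then have "card (B (Suc i)) = card (B (Suc i) - B i) + card (B i)"
      using card_Diff_subset[OF fin] card_mono[OF fin] by (metis le_add_diff_inverse2)
    then have "q * card (B (Suc i)) = q * card (B (Suc i) - B i) + q * card (B i)"
      by (simp add: algebra_simps)
    with *[OF that] show ?thesis by simp
  qed
  have grow: "(q + 1) ^ i \<le> q ^ i * card (B i)" if "i \<le> q * l" for i
    using that
  proof (induction i)
    case 0 then show ?case by (simp add: B_def)
  next
    case (Suc i)
    have "(q + 1) ^ i \<le> q ^ i * card (B i)" using Suc by simp
    from mult_le_mono2[OF this, of "q + 1"]
    have "(q + 1) ^ Suc i \<le> (q + 1) * (q ^ i * card (B i))" by simp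
    also have "\<dots> = q ^ i * ((q + 1) * card (B i))" by (simp add: algebra_simps)
    also have "\<dots> \<le> q ^ i * (q * card (B (Suc i)))" using step Suc.prems by (intro mult_le_mono2) auto
    finally show ?case by (simp add: algebra_simps)
  qed
  have "(1 + 1 / real q) ^ q \<ge> 1 + real q * (1 / real q)"
    by (rule Bernoulli_inequality) (use q in \<open>auto intro: order_trans[of _ 0]\<close>)
  then have two: "2 \<le> (1 + 1 / real q) ^ q" using q by simp
  have "2 ^ l \<le> ((1 + 1 / real q) ^ q) ^ l" by (rule power_mono[OF two]) simp
  also have "\<dots> = (real q + 1) ^ (q * l) / real q ^ (q * l)"
  proof -
    have "1 + 1 / real q = (real q + 1) / real q" using q by (simp add: field_simps)
    then show ?thesis by (simp only: power_mult[symmetric] power_divide)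
  qed
  also have "\<dots> \<le> card (B (q * l))"
  proof -
    have "real ((q + 1) ^ (q * l)) \<le> real (q ^ (q * l) * card (B (q * l)))"
      using grow[OF order_refl] by (simp only: of_nat_le_iff)
    then show ?thesis using q by (simp add: field_simps)
  qed
  also have "\<dots> \<le> card U" using hop_ball_subset[OF U(3)] U(1) by (auto simp: B_def intro: card_mono)
  finally have "2 ^ l \<le> real (card U)" .
  then have "2 ^ l \<le> card U" by (metis of_nat_le_iff of_nat_numeral of_nat_power)
  then show False using U by simp
qed

text \<open>Cut along a thin layer around a vertex and continue outside. The inner ball is a
  finished piece and pays for the layer; these balls are disjoint, so nothing is charged twice.
  Balls of the remaining graph lie in balls of the old one, so the size bound persists.\<close>

lemma separates_small_balls:
  assumes "finite U" "card U < 2 ^ l" "q \<ge> 1"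
    and sym: "\<And>x y. adj x y \<Longrightarrow> adj y x"
    and "\<And>v. v \<in> U \<Longrightarrow> card (hop_ball adj U v (q * l)) \<le> b"
  shows "\<exists>S. separates adj U S b \<and> q * card S \<le> card U"
  using assms(1,2,5)
proof (induction "card U" arbitrary: U rule: less_induct)
  case less
  show ?case
  proof (cases "U = {}")
    case True then show ?thesis by (intro exI[of _ "{}"]) (simp add: separates_def)
  next
    case False
    then obtain v where v: "v \<in> U" by blast
    define B where "B = hop_ball adj U v"
    obtain i where i: "i < q * l" "q * card (B (Suc i) - B i) \<le> card (B i)"
      using thin_layer[OF less.prems(1,2) v assms(3)] by (auto simp: B_def)
    have BU: "B j \<subseteq> U" for j unfolding B_def using hop_ball_subset[OF v] .
    have fin: "finite (B j)" for j using BU less.prems(1) finite_subset by metis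
    have Bi: "B i \<subseteq> B (Suc i)" unfolding B_def by (rule hop_ball_mono) simp
    define U' where "U' = U - B (Suc i)"
    have vB: "v \<in> B (Suc i)" unfolding B_def by (rule self_in_hop_ball)
    have lt: "card U' < card U" unfolding U'_def using vB v less.prems(1) by (intro psubset_card_mono) auto
    have "\<exists>S. separates adj U' S b \<and> q * card S \<le> card U'"
    proof (rule less.hyps[OF lt])
      show "finite U'" "card U' < 2 ^ l" using less.prems lt by (auto simp: U'_def)
      fix w assume w: "w \<in> U'"
      have "card (hop_ball adj U' w (q * l)) \<le> card (hop_ball adj U w (q * l))"
        using w less.prems(1) hop_ball_subset[of w U]
        by (intro card_mono hop_ball_mono_set) (auto simp: U'_def intro: finite_subset)
      also have "\<dots> \<le> b" using less.prems(3) w by (auto simp: U'_def)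
      finally show "card (hop_ball adj U' w (q * l)) \<le> b" .
    qed
    then obtain S where S: "separates adj U' S b" "q * card S \<le> card U'" by blast
    have "card (B i) \<le> card (B (q * l))" using i(1) fin
      unfolding B_def by (intro card_mono hop_ball_mono) auto
    also have "\<dots> \<le> b" using less.prems(3)[OF v] by (simp add: B_def)
    finally have sepB: "separates adj (B i) {} b" using fin by (intro separates_trivial)
    have "separates adj U ((B (Suc i) - B i) \<union> {} \<union> S) b"
    proof (rule separates_Un[OF less.prems(1) _ _ _ _ _ sym sepB S(1)])
      show "U = B i \<union> (B (Suc i) - B i) \<union> U'" using BU Bi by (auto simp: U'_def)
      show "\<not> adj x y" if "x \<in> B i" "y \<in> U'" for x y using that by (auto simp: U'_def B_def)
    qed (use Bi in \<open>auto simp: U'_def\<close>)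
    moreover have "q * card ((B (Suc i) - B i) \<union> {} \<union> S) \<le> card U"
    proof -
      have "q * card ((B (Suc i) - B i) \<union> {} \<union> S) \<le> q * (card (B (Suc i) - B i) + card S)"
        using card_Un_le[of "B (Suc i) - B i" S] by simp
      also have "\<dots> \<le> card (B i) + card U'" using i(2) S(2) by (simp add: algebra_simps)
      also have "\<dots> = card (B i \<union> U')" using Bi less.prems(1) fin
        by (subst card_Un_disjoint) (auto simp: U'_def)
      also have "\<dots> \<le> card U" using less.prems(1) BU by (intro card_mono) (auto simp: U'_def)
      finally show ?thesis .
    qed
    ultimately show ?thesis by blast
  qed
qed

section \<open>Weighted distances and two ways of cutting\<close>

context k33_graph
begin

text \<open>The weights sit on vertices and both ends count, so for \<open>v\<close> in
  \<open>V\<close> the value \<open>wdist \<omega> v v\<close> is \<open>\<omega> v\<close> and not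
  0.\<close>

definition wdist :: "('a \<Rightarrow> nat) \<Rightarrow> 'a \<Rightarrow> 'a \<Rightarrow> nat" where
  "wdist \<omega> u v = (LEAST w. \<exists>K\<subseteq>V. joined adj K u v \<and> w = sum \<omega> K)"

lemma wdist_le: "K \<subseteq> V \<Longrightarrow> joined adj K u v \<Longrightarrow> wdist \<omega> u v \<le> sum \<omega> K"
  unfolding wdist_def by (rule Least_le) blast

lemma wdist_witness:
  assumes "joined adj V u v"
  obtains K where "K \<subseteq> V" "joined adj K u v" "sum \<omega> K = wdist \<omega> u v"
proof -
  have "\<exists>K\<subseteq>V. joined adj K u v \<and> wdist \<omega> u v = sum \<omega> K"
    unfolding wdist_def by (rule LeastI[of _ "sum \<omega> V"]) (use assms in blast)
  then show thesis using that by metis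
qed

lemma wdist_triangle:
  assumes "joined adj V u v" "joined adj V v w"
  shows "wdist \<omega> u w \<le> wdist \<omega> u v + wdist \<omega> v w"
proof -
  obtain K where K: "K \<subseteq> V" "joined adj K u v" "sum \<omega> K = wdist \<omega> u v" using wdist_witness[OF assms(1)] .
  obtain L where L: "L \<subseteq> V" "joined adj L v w" "sum \<omega> L = wdist \<omega> v w" using wdist_witness[OF assms(2)] .
  have "joined adj (K \<union> L) u w" using K(2) L(2) by (meson joined_trans joined_mono Un_upper1 Un_upper2)
  then have "wdist \<omega> u w \<le> sum \<omega> (K \<union> L)" using K L by (intro wdist_le) auto
  also have "\<dots> \<le> sum \<omega> K + sum \<omega> L"
    using sum.union_inter[of K L \<omega>] K(1) L(1) finite_V finite_subset by (metis le_add1)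
  finally show ?thesis using K L by simp
qed

lemma wdist_step:
  assumes "joined adj V v x" "y \<in> V" "adj x y"
  shows "wdist \<omega> v y \<le> wdist \<omega> v x + \<omega> y"
proof -
  obtain K where K: "K \<subseteq> V" "joined adj K v x" "sum \<omega> K = wdist \<omega> v x" using wdist_witness[OF assms(1)] .
  have "x \<in> K" using K(2) by (simp add: joined_def)
  then have "joined adj (insert y K) x y" using assms by (intro joined_edge) auto
  then have "joined adj (insert y K) v y" using K(2) by (meson joined_trans joined_mono subset_insertI)
  then have "wdist \<omega> v y \<le> sum \<omega> (insert y K)" using K assms by (intro wdist_le) auto
  also have "\<dots> \<le> sum \<omega> K + \<omega> y"
    using K(1) finite_V finite_subset[OF K(1)] by (cases "y \<in> K") (auto simp: insert_absorb)
  finally show ?thesis using K by simp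
qed

lemma wdist_sym: "wdist \<omega> u v = wdist \<omega> v u"
  unfolding wdist_def using adj_sym by (metis joined_sym)

lemma wdist_self: "v \<in> V \<Longrightarrow> wdist \<omega> v v \<le> \<omega> v"
  using wdist_le[of "{v}" v v \<omega>] by (simp add: joined_refl)

text \<open>Sweep cut: if half of the vertices lie close to \<open>v\<close> although the average distance is
  large, then the spheres around \<open>v\<close> are, on average, small compared to what they cut off.\<close>
lemma core_cut:
  fixes R :: nat and e :: real
  assumes conn: "\<And>u v. u \<in> V \<Longrightarrow> v \<in> V \<Longrightarrow> joined adj V u v"
    and pos: "\<And>x. x \<in> V \<Longrightarrow> \<omega> x > 0"
    and spread: "real (card V)^2 * real (sum \<omega> V)
        \<le> 48 * e * real (\<Sum>u\<in>V. \<Sum>v\<in>V. wdist \<omega> u v)"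
    and e: "e > 0" "384 * e \<le> card V"
    and R: "192 * e * real R \<le> real (sum \<omega> V)"
    and v: "v \<in> V" and core: "card V \<le> 2 * card {x \<in> V. wdist \<omega> v x \<le> R}"
  shows "\<exists>A S B. V = A \<union> S \<union> B \<and> A \<inter> B = {} \<and> A \<inter> S = {} \<and> B \<inter> S = {} \<and>
    (\<forall>x\<in>A. \<forall>y\<in>B. \<not> adj x y) \<and> card V \<le> 2 * card A \<and> B \<noteq> {} \<and> card V * card S \<le> 384 * e * card B"
proof -
  define f where "f = wdist \<omega> v"
  define n where "n = card V"
  define W where "W = sum \<omega> V"
  define Out where "Out r = {x \<in> V. r < f x}" for r
  \<comment> \<open>\<open>x\<close> is on the sphere for the radii \<open>r\<close> in an interval
    of length \<open>\<omega> x\<close> ending at \<open>f x\<close>, hence for at most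
    \<open>\<omega> x\<close> radii. An edge cannot jump over a sphere of this thickness.\<close>
  define Sph where "Sph r = {x \<in> V. f x \<le> r + \<omega> x \<and> r < f x}" for r
  have n: "n > 0" using v finite_V by (auto simp: n_def card_gt_0_iff)
  have W: "W > 0" unfolding W_def using pos[OF v] member_le_sum[OF v, of \<omega>] finite_V by simp
  have fW: "f x \<le> W" if "x \<in> V" for x
    unfolding f_def W_def using conn[OF v that] by (intro wdist_le) auto
  have fin: "finite (Out r)" "finite (Sph r)" for r using finite_V by (auto simp: Out_def Sph_def)
  have "(\<Sum>u\<in>V. \<Sum>w\<in>V. wdist \<omega> u w) \<le> (\<Sum>u\<in>V. \<Sum>w\<in>V. f u + f w)"
  proof (intro sum_mono)
    fix u w assume "u \<in> V" "w \<in> V"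
    then show "wdist \<omega> u w \<le> f u + f w"
      using wdist_triangle[of u v w \<omega>] wdist_sym[of \<omega> u v] conn v by (auto simp: f_def)
  qed
  also have "\<dots> = 2 * n * sum f V"
    by (simp add: sum.distrib n_def mult.commute flip: sum_distrib_left)
  finally have "(\<Sum>u\<in>V. \<Sum>w\<in>V. wdist \<omega> u w) \<le> 2 * n * sum f V" .
  then have "real (\<Sum>u\<in>V. \<Sum>w\<in>V. wdist \<omega> u w) \<le> real (2 * n * sum f V)"
    by (simp only: of_nat_le_iff)
  then have "48 * e * real (\<Sum>u\<in>V. \<Sum>w\<in>V. wdist \<omega> u w) \<le> 48 * e * real (2 * n * sum f V)"
    using e(1) by (intro mult_left_mono) auto
  then have "real n * (real n * real W) \<le> real n * (96 * e * real (sum f V))"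
    using spread by (simp add: n_def W_def power2_eq_square algebra_simps)
  then have F: "real n * W \<le> 96 * e * sum f V" using n by (subst (asm) mult_le_cancel_left_pos) auto
  have sumOut: "real (\<Sum>r\<in>{R..<W}. card (Out r)) \<ge> sum f V - real n * R"
  proof -
    have "(\<Sum>r\<in>{R..<W}. card (Out r)) = (\<Sum>r\<in>{R..<W}. \<Sum>x | x \<in> V \<and> r < f x. 1)"
      by (simp add: Out_def)
    also have "\<dots> = (\<Sum>x\<in>V. \<Sum>r | r \<in> {R..<W} \<and> r < f x. 1)"
      using finite_V by (intro sum.swap_restrict) auto
    also have "\<dots> = (\<Sum>x\<in>V. f x - R)"
    proof (rule sum.cong[OF refl])
      fix x assume "x \<in> V"
      then have "{r. r \<in> {R..<W} \<and> r < f x} = {R..<f x}" using fW by fastforce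
      then show "(\<Sum>r | r \<in> {R..<W} \<and> r < f x. 1) = f x - R" by simp
    qed
    finally have "real (\<Sum>r\<in>{R..<W}. card (Out r)) = (\<Sum>x\<in>V. real (f x - R))" by simp
    also have "\<dots> \<ge> (\<Sum>x\<in>V. real (f x) - real R)" by (rule sum_mono) auto
    finally show ?thesis by (simp add: sum_subtractf n_def)
  qed
  have sumSph: "(\<Sum>r\<in>{R..<W}. card (Sph r)) \<le> W"
  proof -
    have "(\<Sum>r\<in>{R..<W}. card (Sph r)) = (\<Sum>r\<in>{R..<W}. \<Sum>x | x \<in> V \<and> (f x \<le> r + \<omega> x \<and> r < f x). 1)"
      by (simp add: Sph_def)
    also have "\<dots> = (\<Sum>x\<in>V. \<Sum>r | r \<in> {R..<W} \<and> (f x \<le> r + \<omega> x \<and> r < f x). 1)"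
      using finite_V by (intro sum.swap_restrict) auto
    also have "\<dots> \<le> (\<Sum>x\<in>V. \<omega> x)"
    proof (rule sum_mono)
      fix x
      have "card {r. r \<in> {R..<W} \<and> (f x \<le> r + \<omega> x \<and> r < f x)} \<le> card {f x - \<omega> x..<f x}"
        by (intro card_mono) auto
      then show "(\<Sum>r | r \<in> {R..<W} \<and> (f x \<le> r + \<omega> x \<and> r < f x). 1) \<le> \<omega> x" by simp
    qed
    finally show ?thesis by (simp add: W_def)
  qed
  \<comment> \<open>Since \<open>192 * e * R\<close> is at most \<open>W\<close>, distances beyond
    \<open>R\<close> still carry half of the bound \<open>F\<close>; hence 192 instead of
    96.\<close>
  have big: "n * real W \<le> 192 * e * real (\<Sum>r\<in>{R..<W}. card (Out r))"
  proof -
    have "192 * e * (sum f V - real n * R) \<le> 192 * e * real (\<Sum>r\<in>{R..<W}. card (Out r))"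
      using sumOut e(1) by (intro mult_left_mono) auto
    moreover have "192 * e * (sum f V - real n * R) = 2 * (96 * e * sum f V) - n * (192 * e * R)"
      by (simp add: algebra_simps)
    moreover have "n * (192 * e * R) \<le> n * real W" using R by (intro mult_left_mono) (auto simp: W_def)
    ultimately show ?thesis using F by linarith
  qed
  \<comment> \<open>Plain averaging might return a radius with nothing outside, where the inequality
    is void; a strict comparison of the two sums excludes this.\<close>
  have "\<exists>r\<in>{R..<W}. Out r \<noteq> {} \<and> n * card (Sph r) \<le> 192 * e * card (Out r)"
  proof (rule ccontr)
    assume neg: "\<not> ?thesis"
    have le: "192 * e * card (Out r) \<le> n * real (card (Sph r))" if "r \<in> {R..<W}" for r
      using neg that e(1) by (cases "Out r = {}") (force simp: not_le)+
    have "\<exists>r\<in>{R..<W}. 192 * e * card (Out r) < n * real (card (Sph r))"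
    proof (rule ccontr)
      assume "\<not> ?thesis"
      then have "Out r = {}" if "r \<in> {R..<W}" for r using neg that by (force simp: not_le)
      then have "n * real W \<le> 0" using big by simp
      then show False using n W by (simp add: mult_le_0_iff)
    qed
    then have "(\<Sum>r\<in>{R..<W}. 192 * e * card (Out r)) < (\<Sum>r\<in>{R..<W}. n * real (card (Sph r)))"
      using le by (intro sum_strict_mono_ex1) auto
    also have "\<dots> = n * real (\<Sum>r\<in>{R..<W}. card (Sph r))" by (simp add: sum_distrib_left)
    also have "\<dots> \<le> n * real W" using sumSph by (intro mult_left_mono) (simp_all only: of_nat_le_iff of_nat_0_le_iff)
    finally show False using big by (simp add: sum_distrib_left)
  qed
  then obtain r where r: "R \<le> r" "Out r \<noteq> {}" "n * card (Sph r) \<le> 192 * e * card (Out r)"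
    by (metis atLeastLessThan_iff)
  define A where "A = {x \<in> V. f x \<le> r}"
  define B where "B = {x \<in> V. r + \<omega> x < f x}"
  have "Out r = Sph r \<union> B" "Sph r \<inter> B = {}" by (auto simp: Out_def Sph_def B_def)
  then have cOut: "card (Out r) = card (Sph r) + card B"
    using fin finite_V by (metis card_Un_disjoint finite_Un)
  define s where "s = real (card (Sph r))"
  have "n * s \<le> 192 * e * s + 192 * e * card B" using r(3) by (simp add: cOut s_def algebra_simps)
  \<comment> \<open>The sphere itself accounts for at most half of \<open>n * s\<close>, so charging
    the rest to \<open>B\<close> doubles 192 to 384.\<close>
  moreover have "384 * e * s \<le> n * s" using e by (intro mult_right_mono) (auto simp: n_def s_def)
  ultimately have cut: "n * s \<le> 384 * e * card B" by (simp add: algebra_simps)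
  have "B \<noteq> {}"
  proof
    assume "B = {}"
    then have "n * s \<le> 0" using cut by simp
    then have "s = 0" using n by (simp add: s_def mult_le_0_iff)
    then have "card (Out r) = 0" using cOut \<open>B = {}\<close> by (simp add: s_def)
    then show False using r(2) fin by simp
  qed
  moreover have "card V \<le> 2 * card A"
  proof -
    have "card {x \<in> V. wdist \<omega> v x \<le> R} \<le> card A"
      using finite_V r(1) by (intro card_mono) (auto simp: A_def f_def)
    then show ?thesis using core by simp
  qed
  moreover have "\<forall>x\<in>A. \<forall>y\<in>B. \<not> adj x y"
  proof (intro ballI notI)
    fix x y assume xy: "x \<in> A" "y \<in> B" "adj x y"
    then have "f y \<le> f x + \<omega> y"
      unfolding f_def A_def B_def by (intro wdist_step conn v) auto
    then show False using xy by (auto simp: A_def B_def)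
  qed
  moreover have "V = A \<union> Sph r \<union> B" "A \<inter> B = {}" "A \<inter> Sph r = {}" "B \<inter> Sph r = {}"
    by (auto simp: A_def B_def Sph_def)
  moreover have "card V * card (Sph r) \<le> 384 * e * card B" using cut by (simp add: n_def s_def)
  ultimately show ?thesis
    by (intro exI[of _ A] exI[of _ "Sph r"] exI[of _ B] conjI)
qed

text \<open>No ball of weighted radius \<open>R\<close> holds half of the vertices. Heavy vertices
  are few, as the total weight is limited; without them \<open>q * l\<close> hops stay within
  weighted radius \<open>R\<close>, so hop balls are small and region growing applies.\<close>

lemma coreless_separator:
  fixes q l b R :: nat and e :: real
  assumes conn: "\<And>u v. u \<in> V \<Longrightarrow> v \<in> V \<Longrightarrow> joined adj V u v"
    and e: "e > 0" and R: "real (sum \<omega> V) < 192 * e * (real R + 1)"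
    and nocore: "\<And>v. v \<in> V \<Longrightarrow> 2 * card {x \<in> V. wdist \<omega> v x \<le> R} < card V"
    and q: "q \<ge> 1" and l: "card V < 2 ^ l" and b: "card V \<le> 2 * b"
  shows "\<exists>S. separates adj V S b \<and> real (card S) \<le> card V / q + 192 * e * (q * l + 1)"
proof -
  define L :: nat where "L = q * l"
  \<comment> \<open>A walk of \<open>L\<close> hops has \<open>L + 1\<close> vertices, and each
    light one weighs at most \<open>R / (L + 1)\<close>.\<close>
  define Hv where "Hv = {x \<in> V. R < \<omega> x * (L + 1)}"
  define U where "U = V - Hv"
  have fin: "finite U" "finite Hv" using finite_V by (auto simp: U_def Hv_def)
  have balls: "y \<in> V \<and> wdist \<omega> v y * (L + 1) \<le> (i + 1) * R"
    if "v \<in> U" "y \<in> hop_ball adj U v i" for v y i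
    using that
  proof (induction i arbitrary: y)
    case 0
    then have "v \<in> V" "y = v" "\<omega> v * (L + 1) \<le> R" unfolding U_def Hv_def by (auto simp only: hop_ball.simps Diff_iff mem_Collect_eq not_less)
    moreover have "wdist \<omega> v v * (L + 1) \<le> \<omega> v * (L + 1)"
      using wdist_self[OF \<open>v \<in> V\<close>] by (rule mult_le_mono1)
    ultimately show ?case by simp
  next
    case (Suc i)
    show ?case
    proof (cases "y \<in> hop_ball adj U v i")
      case True
      then have "y \<in> V \<and> wdist \<omega> v y * (L + 1) \<le> (i + 1) * R" using Suc by blast
      then show ?thesis by auto
    next
      case False
      then obtain x where x: "x \<in> hop_ball adj U v i" "adj x y" "y \<in> U" using Suc by auto
      have IH: "x \<in> V" "wdist \<omega> v x * (L + 1) \<le> (i + 1) * R" using Suc.IH[OF Suc.prems(1) x(1)] by auto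
      have y: "y \<in> V" "\<omega> y * (L + 1) \<le> R"
        using x(3) unfolding U_def Hv_def by (auto simp only: Diff_iff mem_Collect_eq not_less)
      have "wdist \<omega> v y \<le> wdist \<omega> v x + \<omega> y"
        using Suc.prems IH x y by (intro wdist_step conn) (auto simp: U_def)
      then have "wdist \<omega> v y * (L + 1) \<le> (wdist \<omega> v x + \<omega> y) * (L + 1)" by (rule mult_le_mono1)
      also have "\<dots> \<le> (i + 1) * R + R" using IH y by (simp add: algebra_simps)
      finally show ?thesis using y by simp
    qed
  qed
  have small: "card (hop_ball adj U v (q * l)) \<le> b" if v: "v \<in> U" for v
  proof -
    have "hop_ball adj U v (q * l) \<subseteq> {x \<in> V. wdist \<omega> v x \<le> R}"
    proof
      fix y assume "y \<in> hop_ball adj U v (q * l)"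
      then have *: "y \<in> V" "wdist \<omega> v y * (L + 1) \<le> (L + 1) * R" using balls[OF v] by (auto simp: L_def)
      from *(2) have "(L + 1) * wdist \<omega> v y \<le> (L + 1) * R" by (simp only: mult.commute)
      then have "wdist \<omega> v y \<le> R" by (subst (asm) nat_mult_le_cancel1) auto
      with * show "y \<in> {x \<in> V. wdist \<omega> v x \<le> R}" by simp
    qed
    then have "card (hop_ball adj U v (q * l)) \<le> card {x \<in> V. wdist \<omega> v x \<le> R}"
      using finite_V by (intro card_mono) auto
    then show ?thesis using nocore[of v] v b by (auto simp: U_def)
  qed
  have "card U < 2 ^ l"
    using l card_mono[OF finite_V, of U] by (auto simp: U_def)
  then have "\<exists>S. separates adj U S b \<and> q * card S \<le> card U"
    by (rule separates_small_balls[OF fin(1) _ q adj_sym small])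
  then obtain S where S: "separates adj U S b" "q * card S \<le> card U" by blast
  have "V - (Hv \<union> S) = U - S" "S \<subseteq> U" "Hv \<subseteq> V"
    using S by (auto simp: U_def separates_def Hv_def)
  then have sep: "separates adj V (Hv \<union> S) b" using S(1) by (auto simp: separates_def U_def)
  \<comment> \<open>By integrality the strict bound for heavy vertices gives \<open>R + 1\<close>,
    which matches the hypothesis on \<open>R\<close> and covers \<open>R = 0\<close>.\<close>
  have "real (card Hv) * (real R + 1) = real (\<Sum>x\<in>Hv. R + 1)" by (simp add: algebra_simps)
  also have "\<dots> \<le> real (\<Sum>x\<in>Hv. \<omega> x * (L + 1))"
    unfolding of_nat_le_iff by (intro sum_mono) (auto simp: Hv_def)
  also have "\<dots> = (L + 1) * real (\<Sum>x\<in>Hv. \<omega> x)"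
    unfolding sum_distrib_right[symmetric] of_nat_mult by simp
  also have "\<dots> \<le> (L + 1) * real (sum \<omega> V)"
  proof -
    have "(\<Sum>x\<in>Hv. \<omega> x) \<le> sum \<omega> V" using finite_V by (intro sum_mono2) (auto simp: Hv_def)
    then show ?thesis by (intro mult_left_mono) (simp_all only: of_nat_le_iff of_nat_0_le_iff)
  qed
  also have "\<dots> \<le> (L + 1) * (192 * e * (real R + 1))" using R by (intro mult_left_mono) auto
  finally have "real (card Hv) * (real R + 1) \<le> (192 * e * (L + 1)) * (real R + 1)"
    by (simp add: algebra_simps)
  then have Hv: "real (card Hv) \<le> 192 * e * (L + 1)" by (subst (asm) mult_le_cancel_right_pos) auto
  have "real (q * card S) \<le> real (card V)"
    unfolding of_nat_le_iff using S(2) card_mono[OF finite_V, of U] by (auto simp: U_def)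
  then have "real (card S) \<le> card V / q" using q by (simp add: field_simps)
  then have "real (card (Hv \<union> S)) \<le> card V / q + 192 * e * (L + 1)"
    using Hv card_Un_le[of Hv S] by linarith
  then show ?thesis using sep unfolding L_def by (metis of_nat_1 of_nat_add of_nat_mult)
qed

end

text \<open>\<open>n0\<close> and \<open>e\<close> stay fixed while \<open>U\<close> shrinks, so all
  cuts share one rate. A sweep cut is charged to the side \<open>B\<close> that it cuts off for
  good, which gives the term proportional to \<open>card U\<close>; a coreless graph is finished at
  once, so the other two terms are paid only once.\<close>

lemma k33_separator_aux:
  fixes b d l n0 q :: nat and e :: real
  assumes e: "e = sqrt (d * n0)" "768 * e \<le> n0" and n0: "n0 \<le> 2 * b" "n0 < 2 ^ l" and q: "q \<ge> 1"
  shows "k33_graph U adj \<Longrightarrow> card U \<le> n0 \<Longrightarrow> (\<And>x. x \<in> U \<Longrightarrow> card {y \<in> U. adj x y} \<le> d) \<Longrightarrow>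
    \<exists>S. separates adj U S b \<and> card S \<le> n0 / q + 192 * e * (q * l + 1) + 768 * e / n0 * card U"
proof (induction "card U" arbitrary: U rule: less_induct)
  case less
  interpret k33_graph U adj by fact
  let ?bd = "\<lambda>W. n0 / q + 192 * e * (q * l + 1) + 768 * e / n0 * card W"
  have e0: "e \<ge> 0" using e by simp
  have rec: "\<exists>S. separates adj A S b \<and> card S \<le> ?bd A" if "A \<subset> U" for A
  proof (rule less.hyps)
    have "card A < card U" using that finite_V by (rule psubset_card_mono[rotated])
    then show "card A < card U" "card A \<le> n0" using less.prems(2) by auto
    show "k33_graph A adj" using k33_graph_subset[OF less.prems(1)] that by blast
    show "card {y \<in> A. adj x y} \<le> d" if "x \<in> A" for x
    proof -
      have "card {y \<in> A. adj x y} \<le> card {y \<in> U. adj x y}"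
        using finite_V \<open>A \<subset> U\<close> by (intro card_mono) auto
      then show ?thesis using less.prems(3)[of x] that \<open>A \<subset> U\<close> by fastforce
    qed
  qed
  have fin: "finite A" if "A \<subseteq> U" for A using that finite_V finite_subset by blast
  have peel: "\<exists>S. separates adj U S b \<and> card S \<le> ?bd U"
    if U: "U = A \<union> T \<union> B" "A \<inter> B = {}" "A \<inter> T = {}" "B \<inter> T = {}" and na: "\<And>x y. x \<in> A \<Longrightarrow> y \<in> B \<Longrightarrow> \<not> adj x y"
      and B: "B \<noteq> {}" "card B \<le> b" and T: "card T \<le> 768 * e / n0 * card B" for A B T
  proof -
    have "A \<subset> U" using U B by blast
    then obtain S where S: "separates adj A S b" "card S \<le> ?bd A" using rec by blast
    have "separates adj U (T \<union> S \<union> {}) b"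
      using B fin[of B] U S(1) by (intro separates_Un[OF finite_V U na adj_sym] separates_trivial) auto
    moreover have "real (card (T \<union> S \<union> {})) \<le> ?bd U"
    proof -
      have "card A + card B \<le> card U"
        using U finite_V by (subst card_Un_disjoint[symmetric]) (auto intro: card_mono finite_subset)
      then have "real (card A) + real (card B) \<le> real (card U)" by linarith
      then have "768 * e / n0 * (real (card A) + real (card B)) \<le> 768 * e / n0 * real (card U)"
        using e0 by (intro mult_left_mono) auto
      moreover have "real (card (T \<union> S \<union> {})) \<le> real (card T) + real (card S)"
        using card_Un_le[of T S] by simp
      ultimately show ?thesis using S(2) T by (simp only: distrib_left)
    qed
    ultimately show ?thesis by blast
  qed
  consider "card U \<le> b" | "b < card U" "\<exists>u\<in>U. \<exists>v\<in>U. \<not> joined adj U u v"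
    | "b < card U" "\<And>u v. u \<in> U \<Longrightarrow> v \<in> U \<Longrightarrow> joined adj U u v"
    by (meson not_le)
  then show ?case
  proof cases
    case 1
    then show ?thesis using e0 finite_V by (intro exI[of _ "{}"]) (auto intro!: separates_trivial)
  next
    case 2
    then obtain u v where uv: "u \<in> U" "v \<in> U" "\<not> joined adj U u v" by blast
    define A where "A = component_of adj U u"
    define B where "B = U - A"
    have AU: "A \<subseteq> U" unfolding A_def by (rule component_of_subset)
    have na: "\<not> adj x y" if "x \<in> A" "y \<in> B" for x y
    proof
      assume "adj x y"
      then have "joined adj U x y" using that AU by (intro joined_edge) (auto simp: B_def)
      then have "y \<in> A" using that(1) unfolding A_def component_of_def by (auto intro: joined_trans)
      then show False using that by (simp add: B_def)
    qed
    have ne: "A \<noteq> {}" "B \<noteq> {}"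
      using uv joined_refl[of u U adj] by (auto simp: A_def B_def component_of_def)
    have "card A + card B = card U" using AU finite_V unfolding B_def
      by (simp add: card_Diff_subset card_mono fin)
    then have "card A \<le> b \<or> card B \<le> b" using less.prems(2) n0(1) by linarith
    then show ?thesis
    proof
      assume "card B \<le> b"
      then show ?thesis using AU na ne e0 by (intro peel[of A "{}" B]) (auto simp: B_def)
    next
      assume "card A \<le> b"
      moreover have "\<not> adj x y" if "x \<in> B" "y \<in> A" for x y using na that adj_sym by blast
      ultimately show ?thesis using AU ne e0 by (intro peel[of B "{}" A]) (auto simp: B_def)
    qed
  next
    case 3
    define D where "D = real (\<Sum>x\<in>U. deg x)"
    define eU where "eU = sqrt D"
    have n: "card U > 0" using 3 by linarith
    then have "U \<noteq> {}" by auto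
    have "(\<Sum>x\<in>U. deg x) > 0" using deg_pos finite_V \<open>U \<noteq> {}\<close> by (intro sum_pos) auto
    then have "D > 0" unfolding D_def by linarith
    then have eU0: "eU > 0" by (simp add: eU_def)
    have "(\<Sum>x\<in>U. deg x) \<le> card U * d"
      using less.prems(3) sum_bounded_above[of U deg d] by (simp add: deg_def)
    also have "\<dots> \<le> d * n0" using less.prems(2) by simp
    finally have "D \<le> real (d * n0)" unfolding D_def by (simp only: of_nat_le_iff)
    then have eUe: "eU \<le> e" unfolding eU_def e(1) by simp
    obtain \<omega> where pos: "\<And>x. x \<in> U \<Longrightarrow> \<omega> x > 0"
      and sp: "\<And>R. routing R \<Longrightarrow> real (card U)^2 * real (\<Sum>x\<in>U. \<omega> x)
        \<le> 48 * sqrt (real (\<Sum>x\<in>U. deg x)) * real (\<Sum>u\<in>U. \<Sum>v\<in>U. \<Sum>x\<in>R u v. \<omega> x)"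
      using spreading_weights[OF 3(2)] by metis
    have "\<forall>u v. \<exists>K. u \<in> U \<longrightarrow> v \<in> U \<longrightarrow> K \<subseteq> U \<and> joined adj K u v \<and> sum \<omega> K = wdist \<omega> u v"
      using wdist_witness 3(2) by metis
    then obtain P where P: "\<And>u v. u \<in> U \<Longrightarrow> v \<in> U \<Longrightarrow> P u v \<subseteq> U \<and> joined adj (P u v) u v \<and> sum \<omega> (P u v) = wdist \<omega> u v"
      by metis
    then have "routing P" by (simp add: routing_def)
    from sp[OF this] have spread: "real (card U)^2 * real (sum \<omega> U)
        \<le> 48 * eU * real (\<Sum>u\<in>U. \<Sum>v\<in>U. wdist \<omega> u v)"
      using P by (simp add: eU_def D_def)
    \<comment> \<open>The integer part makes \<open>R\<close> fit both cases: \<open>R1\<close> is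
      what the sweep cut needs, \<open>R2\<close> what region growing needs.\<close>
    define R where "R = nat \<lfloor>sum \<omega> U / (192 * eU)\<rfloor>"
    have "real R \<le> sum \<omega> U / (192 * eU)"
      unfolding R_def using eU0 by (intro of_nat_floor) (auto intro!: divide_nonneg_nonneg sum_nonneg)
    then have R1: "192 * eU * real R \<le> real (sum \<omega> U)" using eU0 by (simp add: field_simps)
    have "sum \<omega> U / (192 * eU) < real R + 1" unfolding R_def by linarith
    then have R2: "real (sum \<omega> U) < 192 * eU * (real R + 1)" using eU0 by (simp add: field_simps)
    have n2: "real n0 \<le> 2 * real (card U)" using 3(1) n0(1) by linarith
    show ?thesis
    proof (cases "\<exists>v\<in>U. card U \<le> 2 * card {x \<in> U. wdist \<omega> v x \<le> R}")
      case True
      then obtain v where v: "v \<in> U" "card U \<le> 2 * card {x \<in> U. wdist \<omega> v x \<le> R}" by blast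
      have "384 * eU \<le> card U" using e(2) eUe n2 by linarith
      from core_cut[OF 3(2) pos spread eU0 this R1 v] obtain A T B where
        U: "U = A \<union> T \<union> B" "A \<inter> B = {}" "A \<inter> T = {}" "B \<inter> T = {}"
        and na: "\<forall>x\<in>A. \<forall>y\<in>B. \<not> adj x y" and A: "card U \<le> 2 * card A" and "B \<noteq> {}"
        and T: "card U * card T \<le> 384 * eU * card B" by blast
      have fAB: "finite A" "finite B" using U(1) fin[of A] fin[of B] by auto
      have "card A + card B \<le> card U"
        using U finite_V by (subst card_Un_disjoint[symmetric]) (auto intro: card_mono finite_subset)
      then have "card B \<le> b" using A less.prems(2) n0(1) by linarith
      moreover have "card T \<le> 768 * e / n0 * card B"
      proof -
        have "real n0 * card T \<le> 2 * (card U * card T)" using mult_right_mono[OF n2, of "card T"] by simp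
        also have "\<dots> \<le> 2 * (384 * eU * card B)" using T by linarith
        also have "\<dots> \<le> 2 * (384 * e * card B)" using eUe by (intro mult_left_mono mult_right_mono) auto
        finally have "real n0 * card T \<le> 768 * e * card B" by simp
        moreover have "n0 > 0" using n less.prems(2) by linarith
        ultimately show ?thesis by (simp add: field_simps)
      qed
      ultimately show ?thesis using na \<open>B \<noteq> {}\<close> by (intro peel[OF U]) auto
    next
      case False
      then have nc: "2 * card {x \<in> U. wdist \<omega> v x \<le> R} < card U" if "v \<in> U" for v
        using that by (meson not_le)
      have "\<exists>S. separates adj U S b \<and> real (card S) \<le> card U / q + 192 * eU * (q * l + 1)"
        using n0 less.prems(2) by (intro coreless_separator[OF 3(2) eU0 R2 nc q]) auto
      then obtain S where S: "separates adj U S b" "real (card S) \<le> card U / q + 192 * eU * (q * l + 1)" by blast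
      have "real (card U) / q \<le> n0 / q" using less.prems(2) by (intro divide_right_mono) auto
      moreover have "192 * eU * (q * l + 1) \<le> 192 * e * (q * l + 1)"
        using eUe by (intro mult_right_mono mult_left_mono) auto
      moreover have "0 \<le> 768 * e / n0 * card U" using e0 by simp
      ultimately show ?thesis using S by (intro exI[of _ S]) auto
    qed
  qed
qed

text \<open>If \<open>768 * e\<close> exceeds \<open>n\<close>, the claimed bound exceeds
  \<open>card V\<close> and all of \<open>V\<close> may be removed. Otherwise 960 is 192 from region
  growing plus 768 from the sweep cuts.\<close>

theorem k33_separator:
  fixes b d l n q :: nat
  assumes G: "k33_graph V adj" and V: "card V \<le> n" "\<And>x. x \<in> V \<Longrightarrow> card {y \<in> V. adj x y} \<le> d"
    and n: "n \<le> 2 * b" "n < 2 ^ l" and q: "q \<ge> 1"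
  shows "\<exists>S. separates adj V S b \<and> card S \<le> n / q + 960 * (q * l + 1) * sqrt (d * n)"
proof -
  define e where "e = sqrt (d * n)"
  have e0: "e \<ge> 0" by (simp add: e_def)
  have lql: "e * 1 \<le> e * (q * l + 1)" using e0 by (intro mult_left_mono) auto
  show ?thesis
  proof (cases "768 * e \<le> n")
    case True
    obtain S where S: "separates adj V S b"
      "card S \<le> n / q + 192 * e * (q * l + 1) + 768 * e / n * card V"
      using k33_separator_aux[OF e_def True n q G V] by blast
    have "768 * e / n * card V \<le> 768 * e / n * n"
      using V(1) e0 by (intro mult_left_mono) auto
    also have "\<dots> \<le> 768 * (e * 1)" using e0 by simp
    also have "\<dots> \<le> 768 * (e * (q * l + 1))" using lql by linarith
    finally show ?thesis using S by (intro exI[of _ S]) (auto simp: e_def algebra_simps)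
  next
    case False
    then have "real (card V) \<le> 768 * (e * 1)" using V(1) by linarith
    also have "\<dots> \<le> 768 * (e * (q * l + 1))" using lql by linarith
    also have "\<dots> \<le> 960 * (e * (q * l + 1))" using e0 by (intro mult_right_mono) auto
    also have "\<dots> \<le> n / q + 960 * (q * l + 1) * sqrt (d * n)" by (simp add: e_def algebra_simps)
    finally show ?thesis using separates_self by blast
  qed
qed

section \<open>Iterated separation into pieces of bounded size\<close>

lemma components_induct:
  assumes "finite U" "separates adj U {} b" "\<And>x y. adj x y \<Longrightarrow> adj y x" "P {}"
    and step: "\<And>C A. C \<subseteq> U \<Longrightarrow> card C \<le> b \<Longrightarrow> A \<subseteq> U \<Longrightarrow> C \<inter> A = {} \<Longrightarrow>
      (\<And>x y. x \<in> C \<Longrightarrow> y \<in> A \<Longrightarrow> \<not> adj x y) \<Longrightarrow> P A \<Longrightarrow> P (C \<union> A)"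
  shows "P U"
proof -
  have "P A" if "A \<subseteq> U" "separates adj A {} b" for A
    using that
  proof (induction "card A" arbitrary: A rule: less_induct)
    case less
    show ?case
    proof (cases "A = {}")
      case True then show ?thesis using assms(4) by simp
    next
      case False
      then obtain x where x: "x \<in> A" by blast
      define C where "C = component_of adj A x"
      have CA: "C \<subseteq> A" unfolding C_def by (rule component_of_subset)
      have fA: "finite A" using less.prems(1) assms(1) finite_subset by blast
      have xC: "x \<in> C" using x joined_refl unfolding C_def component_of_def by fastforce
      have lt: "card (A - C) < card A" using x xC fA by (intro psubset_card_mono) auto
      have sep: "separates adj (A - C) {} b"
        unfolding separates_def
      proof (intro conjI ballI)
        fix y assume y: "y \<in> A - C - {}"
        have "card (component_of adj (A - C) y) \<le> card (component_of adj A y)"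
          using fA by (intro card_mono component_of_mono) (auto intro: finite_subset[OF component_of_subset])
        also have "\<dots> \<le> b" using less.prems(2) y by (auto simp: separates_def)
        finally show "card (component_of adj (A - C - {}) y) \<le> b" by simp
      qed simp
      have "P (C \<union> (A - C))"
      proof (rule step)
        show "card C \<le> b" using less.prems(2) x by (simp add: separates_def C_def)
        show "P (A - C)" using less.prems(1) sep lt by (intro less.hyps) auto
        show "\<not> adj y z" if "y \<in> C" "z \<in> A - C" for y z
        proof
          assume "adj y z"
          then have "joined adj A y z" using that CA by (intro joined_edge) auto
          then have "z \<in> C" using that(1) unfolding C_def component_of_def by (auto intro: joined_trans)
          then show False using that by simp
        qed
      qed (use CA less.prems in auto)
      then show ?thesis using CA by (simp add: Un_absorb1)
    qed
  qed
  then show ?thesis using assms(2) by blast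
qed

lemma separates_refine:
  fixes r :: real
  assumes "finite U" "separates adj U {} b" and sym: "\<And>x y. adj x y \<Longrightarrow> adj y x" and "r \<ge> 0"
    and C: "\<And>C. C \<subseteq> U \<Longrightarrow> card C \<le> b \<Longrightarrow> \<exists>T. separates adj C T b' \<and> card T \<le> r * card C"
  shows "\<exists>T. separates adj U T b' \<and> card T \<le> r * card U"
  using assms(1,2) sym
proof (rule components_induct)
  show "\<exists>T. separates adj {} T b' \<and> card T \<le> r * card {}"
    by (intro exI[of _ "{}"]) (simp add: separates_def)
next
  fix C A assume *: "C \<subseteq> U" "card C \<le> b" "A \<subseteq> U" "C \<inter> A = {}"
    and na: "\<And>x y. x \<in> C \<Longrightarrow> y \<in> A \<Longrightarrow> \<not> adj x y"
    and "\<exists>T. separates adj A T b' \<and> card T \<le> r * card A"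
  then obtain T where T: "separates adj A T b'" "card T \<le> r * card A" by blast
  obtain T' where T': "separates adj C T' b'" "card T' \<le> r * card C" using C * by blast
  have fin: "finite C" "finite A" using * assms(1) finite_subset by blast+
  have "separates adj (C \<union> A) ({} \<union> T' \<union> T) b'"
    by (rule separates_Un[of _ C _ A, OF _ _ _ _ _ na sym T'(1) T(1)]) (use fin * in auto)
  moreover have "card ({} \<union> T' \<union> T) \<le> r * card (C \<union> A)"
    using card_Un_le[of T' T] T(2) T'(2) fin *(4) by (simp add: card_Un_disjoint distrib_left)
  ultimately show "\<exists>T. separates adj (C \<union> A) T b' \<and> card T \<le> r * card (C \<union> A)" by blast
qed

lemma separates_Diff: "separates adj U S b \<Longrightarrow> separates adj (U - S) {} b"
  by (simp add: separates_def)

lemma separates_Un_Diff: "S \<subseteq> U \<Longrightarrow> separates adj (U - S) T b \<Longrightarrow> separates adj U (S \<union> T) b"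
proof -
  have "U - (S \<union> T) = U - S - T" by blast
  then show "S \<subseteq> U \<Longrightarrow> separates adj (U - S) T b \<Longrightarrow> separates adj U (S \<union> T) b"
    by (simp add: separates_def subset_iff)
qed

text \<open>The fraction of vertices taken by \<open>k33_separator\<close> with \<open>q = 2 ^ (m div 4)\<close> when the number of
  vertices is between \<open>2 ^ (m - 1)\<close> and \<open>2 ^ m\<close>.\<close>
definition cut_rate :: "nat \<Rightarrow> nat \<Rightarrow> real" where
  "cut_rate d m = 2 * (1 / 2 ^ (m div 4) + 960 * (2 ^ (m div 4) * (real m + 1) + 1) * sqrt (d / 2 ^ m))"

lemma cut_rate_nonneg: "cut_rate d m \<ge> 0"
  by (simp add: cut_rate_def)

text \<open>The piece size is halved one step at a time. Pieces are disjoint, so each step takes at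
  most the fraction \<open>cut_rate d m\<close> of all vertices, and the fractions add up.\<close>

lemma k33_dyadic_pieces:
  assumes "i \<le> j" "k33_graph V adj" "card V \<le> 2 ^ j" "\<And>x. x \<in> V \<Longrightarrow> card {y \<in> V. adj x y} \<le> d"
  shows "\<exists>S. separates adj V S (2 ^ i) \<and> card S \<le> (\<Sum>m\<in>{i<..j}. cut_rate d m) * card V"
  using assms
proof (induction j arbitrary: V rule: dec_induct)
  case base
  then show ?case
    by (intro exI[of _ "{}"]) (auto intro: separates_trivial k33_graph.finite_V)
next
  case (step j)
  interpret k33_graph V adj by fact
  have sumS: "(\<Sum>m\<in>{i<..Suc j}. cut_rate d m) = cut_rate d (Suc j) + (\<Sum>m\<in>{i<..j}. cut_rate d m)"
  proof -
    have "{i<..Suc j} = insert (Suc j) {i<..j}" using step.hyps by auto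
    then show ?thesis by simp
  qed
  have s0: "(\<Sum>m\<in>{i<..j}. cut_rate d m) \<ge> 0" by (intro sum_nonneg cut_rate_nonneg)
  show ?case
  proof (cases "card V \<le> 2 ^ j")
    case True
    then obtain S where "separates adj V S (2 ^ i)" "card S \<le> (\<Sum>m\<in>{i<..j}. cut_rate d m) * card V"
      using step.IH[OF step.prems(1) True step.prems(3)] by blast
    moreover have "0 \<le> cut_rate d (Suc j) * card V" using cut_rate_nonneg by simp
    ultimately show ?thesis unfolding sumS by (intro exI[of _ S]) (auto simp: distrib_right)
  next
    case False
    define m where "m = Suc j"
    define q :: nat where "q = 2 ^ (m div 4)"
    have "\<exists>S. separates adj V S (2 ^ j) \<and>
        card S \<le> (2 ^ m :: nat) / q + 960 * (q * (m + 1) + 1) * sqrt (d * (2 ^ m :: nat))"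
      by (rule k33_separator) (use step.prems in \<open>auto simp: m_def q_def\<close>)
    then obtain S where S: "separates adj V S (2 ^ j)"
      "card S \<le> (2 ^ m :: nat) / q + 960 * (q * (m + 1) + 1) * sqrt (d * (2 ^ m :: nat))" by blast
    have cS: "card S \<le> cut_rate d m * card V"
    proof -
      have "sqrt (d * (2 ^ m :: nat)) = 2 ^ m * sqrt (d / 2 ^ m)"
      proof -
        have "real d * 2 ^ m = (2 ^ m)\<^sup>2 * (d / 2 ^ m)" by (simp add: power2_eq_square)
        then have "sqrt (real d * 2 ^ m) = sqrt ((2 ^ m)\<^sup>2) * sqrt (d / 2 ^ m)" by (simp only: real_sqrt_mult)
        then show ?thesis by simp
      qed
      then have "card S \<le> 2 ^ m * (1 / q + 960 * (q * (m + 1) + 1) * sqrt (d / 2 ^ m))"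
        using S(2) by (simp add: algebra_simps)
      \<comment> \<open>The separator is bounded in terms of \<open>2 ^ m\<close>; that
        \<open>V\<close> has at least half as many vertices is the factor 2 in
        \<open>cut_rate\<close>.\<close>
      also have "\<dots> \<le> (2 * card V) * (1 / q + 960 * (q * (m + 1) + 1) * sqrt (d / 2 ^ m))"
      proof (rule mult_right_mono)
        have "2 ^ j \<le> real (card V)" using False by (simp add: not_le less_imp_le)
        then show "2 ^ m \<le> real (2 * card V)" by (simp add: m_def)
      qed auto
      also have "\<dots> = cut_rate d m * card V" by (simp add: cut_rate_def q_def algebra_simps)
      finally show ?thesis .
    qed
    have "\<exists>T. separates adj (V - S) T (2 ^ i) \<and> card T \<le> (\<Sum>m\<in>{i<..j}. cut_rate d m) * card (V - S)"
    proof (rule separates_refine[OF _ separates_Diff[OF S(1)] adj_sym s0])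
      fix C assume C: "C \<subseteq> V - S" "card C \<le> 2 ^ j"
      show "\<exists>T. separates adj C T (2 ^ i) \<and> card T \<le> (\<Sum>m\<in>{i<..j}. cut_rate d m) * card C"
      proof (rule step.IH)
        show "k33_graph C adj" using C k33_graph_subset[OF step.prems(1)] by blast
        show "card {y \<in> C. adj x y} \<le> d" if "x \<in> C" for x
        proof -
          have "card {y \<in> C. adj x y} \<le> card {y \<in> V. adj x y}"
            using finite_V C by (intro card_mono) auto
          also have "\<dots> \<le> d" using step.prems(3) that C by auto
          finally show ?thesis .
        qed
      qed fact
    qed (use finite_V in auto)
    then obtain T where T: "separates adj (V - S) T (2 ^ i)"
      "card T \<le> (\<Sum>m\<in>{i<..j}. cut_rate d m) * card (V - S)" by blast
    have "S \<subseteq> V" using S(1) by (simp add: separates_def)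
    then have "separates adj V (S \<union> T) (2 ^ i)" using T(1) by (rule separates_Un_Diff)
    moreover have "real (card (S \<union> T)) \<le> (\<Sum>m\<in>{i<..Suc j}. cut_rate d m) * card V"
    proof -
      have "(\<Sum>m\<in>{i<..j}. cut_rate d m) * card (V - S) \<le> (\<Sum>m\<in>{i<..j}. cut_rate d m) * card V"
        using s0 finite_V by (intro mult_left_mono) (auto intro: card_mono)
      then show ?thesis using cS T(2) card_Un_le[of S T] unfolding sumS m_def distrib_right by linarith
    qed
    ultimately show ?thesis by blast
  qed
qed

text \<open>With \<open>a = m div 4\<close> both terms are about \<open>sqrt d / 2 ^ a\<close>, up
  to a factor linear in \<open>m\<close>. That factor is absorbed into \<open>(5 / 4) ^ a\<close>,
  and \<open>5 / 8\<close> is below \<open>(9 / 10) ^ 4\<close>.\<close>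

lemma cut_rate_le:
  assumes "d \<ge> 1"
  shows "cut_rate d m \<le> 45000 * sqrt d * (9 / 10) ^ m"
proof -
  define a where "a = m div 4"
  have m: "4 * a \<le> m" "m \<le> 4 * a + 3" by (auto simp: a_def)
  have "sqrt (2 ^ (4 * a)) \<le> sqrt (2 ^ m)" using m by (intro real_sqrt_le_mono power_increasing) auto
  moreover have "sqrt (2 ^ (4 * a)) = (2 ^ a)\<^sup>2"
    by (rule real_sqrt_unique) (simp_all add: power_mult[symmetric] mult.commute)
  ultimately have p: "(2 ^ a)\<^sup>2 \<le> sqrt (2 ^ m)" by simp
  have "sqrt (d / 2 ^ m) = sqrt d / sqrt (2 ^ m)" by (rule real_sqrt_divide)
  also have "\<dots> \<le> sqrt d / (2 ^ a)\<^sup>2" using p by (intro divide_left_mono mult_pos_pos) auto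
  finally have sq: "sqrt (d / 2 ^ m) \<le> sqrt d / (2 ^ a)\<^sup>2" .
  have B: "1 + real a * (1 / 4) \<le> (1 + 1 / 4) ^ a" by (rule Bernoulli_inequality) auto
  have lin: "2 ^ a * (real m + 1) + 1 \<le> 2 ^ a * (16 * (5 / 4) ^ a)"
  proof -
    have "2 ^ a * (real m + 1) + 1 \<le> 2 ^ a * (real m + 2)" by (simp add: distrib_left)
    also have "\<dots> \<le> 2 ^ a * (16 * (5 / 4) ^ a)" using B m(2) by (intro mult_left_mono) auto
    finally show ?thesis .
  qed
  have "1 \<le> sqrt d" using assms by simp
  have "cut_rate d m \<le> 2 * (sqrt d / 2 ^ a + 960 * (2 ^ a * (16 * (5 / 4) ^ a)) * (sqrt d / (2 ^ a)\<^sup>2))"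
    unfolding cut_rate_def a_def[symmetric]
  proof (intro mult_left_mono add_mono)
    show "1 / 2 ^ a \<le> sqrt d / 2 ^ a" using \<open>1 \<le> sqrt d\<close> by (intro divide_right_mono) auto
    show "960 * (2 ^ a * (real m + 1) + 1) * sqrt (d / 2 ^ m)
        \<le> 960 * (2 ^ a * (16 * (5 / 4) ^ a)) * (sqrt d / (2 ^ a)\<^sup>2)"
      using lin sq by (intro mult_mono mult_left_mono) auto
  qed auto
  also have "\<dots> = sqrt d * (2 * (1 / 2) ^ a + 30720 * (5 / 8) ^ a)"
  proof -
    have "(5 / 4 :: real) ^ a / 2 ^ a = (5 / 8) ^ a" by (simp add: power_divide[symmetric])
    moreover have "(1 / 2 :: real) ^ a = 1 / 2 ^ a" by (simp add: power_one_over)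
    ultimately show ?thesis by (simp add: power2_eq_square field_simps)
  qed
  also have "\<dots> \<le> sqrt d * (30722 * (5 / 8) ^ a)"
    using power_mono[of "1 / 2 :: real" "5 / 8" a] by (intro mult_left_mono) auto
  also have "\<dots> \<le> sqrt d * (45000 * (9 / 10) ^ m)"
  proof (intro mult_left_mono)
    have "(5 / 8 :: real) ^ a \<le> ((9 / 10) ^ 4) ^ a" by (rule power_mono) (auto simp: power4_eq_xxxx)
    also have "\<dots> = (9 / 10) ^ (4 * a)" by (simp add: power_mult)
    also have "\<dots> = (9 / 10) ^ (4 * a + 3) * (1000 / 729)" by (simp add: power_add power3_eq_cube)
    also have "\<dots> \<le> (9 / 10) ^ m * (1000 / 729)" using m by (intro mult_right_mono power_decreasing) auto
    finally show "30722 * (5 / 8 :: real) ^ a \<le> 45000 * (9 / 10) ^ m"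
      using zero_le_power[of "9 / 10 :: real" m] by linarith
  qed auto
  finally show ?thesis by simp
qed

text \<open>A geometric series: 450000 is 45000 divided by \<open>1 - 9 / 10\<close>, and
  subtracting \<open>(9 / 10) ^ j\<close> lets the induction telescope.\<close>

lemma sum_cut_rate_le:
  assumes "d \<ge> 1"
  shows "(\<Sum>m\<in>{i<..j}. cut_rate d m) \<le> 450000 * sqrt d * (9 / 10) ^ i"
proof (cases "i \<le> j")
  case True
  then have "(\<Sum>m\<in>{i<..j}. cut_rate d m) \<le> 450000 * sqrt d * ((9 / 10) ^ i - (9 / 10) ^ j)"
  proof (induction rule: dec_induct)
    case (step j)
    have "{i<..Suc j} = insert (Suc j) {i<..j}" using step.hyps by auto
    then have "(\<Sum>m\<in>{i<..Suc j}. cut_rate d m) = cut_rate d (Suc j) + (\<Sum>m\<in>{i<..j}. cut_rate d m)" by simp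
    also have "\<dots> \<le> 45000 * sqrt d * (9 / 10) ^ Suc j + 450000 * sqrt d * ((9 / 10) ^ i - (9 / 10) ^ j)"
      using step.IH cut_rate_le[OF assms] by (rule add_mono[rotated])
    also have "\<dots> \<le> 450000 * sqrt d * ((9 / 10) ^ i - (9 / 10) ^ Suc j)"
      by (simp add: algebra_simps)
    finally show ?case .
  qed simp
  also have "\<dots> \<le> 450000 * sqrt d * (9 / 10) ^ i" by (intro mult_left_mono) auto
  finally show ?thesis .
qed auto

text \<open>The fraction removed must drop below \<open>1 / d\<close>. Seven factors
  \<open>9 / 10\<close> give one halving, and \<open>2 * s + 19\<close> halvings suffice, where
  \<open>2 ^ s\<close> is \<open>d\<close> rounded up to a power of 2, \<open>sqrt d\<close> is
  estimated by \<open>d\<close>, and 450000 is below \<open>2 ^ 19\<close>. This yields the exponent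
  14.\<close>

theorem k33_bounded_pieces:
  assumes "k33_graph V adj" "d \<ge> 1" "\<And>x. x \<in> V \<Longrightarrow> card {y \<in> V. adj x y} \<le> d"
  shows "\<exists>S. separates adj V S (2 ^ 147 * d ^ 14) \<and> d * card S \<le> card V"
proof -
  interpret k33_graph V adj by fact
  define s where "s = (LEAST s. d \<le> 2 ^ s)"
  have ds: "d \<le> 2 ^ s" unfolding s_def by (rule LeastI[of _ d]) simp
  have s2: "2 ^ s \<le> 2 * d"
  proof (cases s)
    case (Suc s')
    then have "\<not> d \<le> 2 ^ s'" using not_less_Least[of s' "\<lambda>s. d \<le> 2 ^ s"] by (simp add: s_def)
    then show ?thesis using Suc by simp
  qed (use assms(2) in simp)
  define i where "i = 7 * (2 * s + 19)" \<comment> \<open>so that \<open>(10 / 9) ^ i \<ge> 2 ^ 19 * d\<^sup>2\<close>\<close>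
  define j where "j = i + card V"
  have "card V < 2 ^ card V" by (rule less_exp)
  also have "\<dots> \<le> 2 ^ j" by (rule power_increasing) (auto simp: j_def)
  finally have "card V \<le> 2 ^ j" by simp
  then obtain S where S: "separates adj V S (2 ^ i)" "card S \<le> (\<Sum>m\<in>{i<..j}. cut_rate d m) * card V"
    using k33_dyadic_pieces[OF _ assms(1) _ assms(3), of i j] by (auto simp: j_def)
  have "i = 133 + s * 14" by (simp add: i_def)
  then have "2 ^ i = 2 ^ 133 * ((2::nat) ^ s) ^ 14" by (simp only: power_add power_mult)
  also have "\<dots> \<le> 2 ^ 133 * (2 * d) ^ 14" using s2 by (intro mult_left_mono power_mono) auto
  also have "\<dots> = 2 ^ 147 * d ^ 14" by (simp add: power_mult_distrib)
  finally have "separates adj V S (2 ^ 147 * d ^ 14)" using S(1) separates_mono by blast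
  moreover have "d * card S \<le> card V"
  proof -
    have "2 * ((9 / 10) ^ 7 :: real) \<le> 1" by (simp add: power_divide)
    then have "(2 * (9 / 10) ^ 7) ^ (2 * s + 19) \<le> (1::real)" by (intro power_le_one) auto
    then have small: "2 ^ (2 * s + 19) * (9 / 10) ^ i \<le> (1::real)"
      by (simp only: i_def power_mult power_mult_distrib)
    have dr: "real d \<le> 2 ^ s" using ds by (metis of_nat_le_iff of_nat_numeral of_nat_power)
    have "sqrt d \<le> d" using assms(2) by (intro real_le_lsqrt) (auto simp: self_le_power)
    then have "d * (450000 * sqrt d) \<le> d * (450000 * real d)" by (intro mult_left_mono) auto
    also have "\<dots> \<le> 2 ^ 19 * (real d)\<^sup>2" by (simp add: power2_eq_square mult_right_mono)
    also have "\<dots> \<le> 2 ^ 19 * (2 ^ s)\<^sup>2"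
      using dr by (intro mult_left_mono power_mono) auto
    also have "\<dots> = 2 ^ (2 * s + 19)" by (simp add: power_add power_mult mult.commute)
    finally have "d * (450000 * sqrt d) * (9 / 10) ^ i \<le> 2 ^ (2 * s + 19) * (9 / 10) ^ i"
      by (intro mult_right_mono) auto
    then have one: "d * (450000 * sqrt d * (9 / 10) ^ i) \<le> 1" using small by (simp only: mult.assoc)
    have "real (d * card S) \<le> d * ((\<Sum>m\<in>{i<..j}. cut_rate d m) * card V)"
      using S(2) by (simp add: mult_left_mono)
    also have "\<dots> \<le> d * ((450000 * sqrt d * (9 / 10) ^ i) * card V)"
      using sum_cut_rate_le[OF assms(2)] by (intro mult_left_mono mult_right_mono) auto
    also have "\<dots> = (d * (450000 * sqrt d * (9 / 10) ^ i)) * card V" by (simp only: mult.assoc)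
    also have "\<dots> \<le> 1 * real (card V)" using one by (rule mult_right_mono) auto
    finally show ?thesis by (simp only: mult_1 of_nat_le_iff)
  qed
  ultimately show ?thesis by blast
qed

section \<open>Hop spanners\<close>

lemma hop_connected_relpow:
  "hop_connected H t u v \<longleftrightarrow> (\<exists>m\<le>t. (u, v) \<in> {(x, y). {x, y} \<in> H} ^^ m)"
proof
  assume "hop_connected H t u v"
  then obtain xs where xs: "xs \<noteq> []" "hd xs = u" "last xs = v" "length xs \<le> t + 1"
    "\<And>i. Suc i < length xs \<Longrightarrow> {xs ! i, xs ! Suc i} \<in> H" unfolding hop_connected_def by blast
  have "(u, v) \<in> {(x, y). {x, y} \<in> H} ^^ (length xs - 1)"
    unfolding relpow_fun_conv
    by (rule exI[of _ "\<lambda>i. xs ! i"]) (use xs in \<open>auto simp: hd_conv_nth last_conv_nth\<close>)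
  then show "\<exists>m\<le>t. (u, v) \<in> {(x, y). {x, y} \<in> H} ^^ m" using xs(4) by (intro exI[of _ "length xs - 1"]) auto
next
  assume "\<exists>m\<le>t. (u, v) \<in> {(x, y). {x, y} \<in> H} ^^ m"
  then obtain m f where f: "m \<le> t" "f 0 = u" "f m = v" "\<And>i. i < m \<Longrightarrow> {f i, f (Suc i)} \<in> H"
    unfolding relpow_fun_conv by auto
  moreover have "hd [0..<Suc m] = 0" by (simp add: upt_conv_Cons del: upt_Suc)
  moreover have "last [0..<Suc m] = m" by simp
  ultimately show "hop_connected H t u v" unfolding hop_connected_def
    by (intro exI[of _ "map f [0..<Suc m]"]) (auto simp: hd_map last_map simp del: upt_Suc)
qed

lemma hop_connected_refl: "hop_connected H t u u"
  unfolding hop_connected_relpow by (intro exI[of _ 0]) auto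

lemma hop_connected_step: "u = v \<or> {u, v} \<in> H \<Longrightarrow> hop_connected H 1 u v"
proof -
  assume "u = v \<or> {u, v} \<in> H"
  then show ?thesis
  proof
    assume "{u, v} \<in> H"
    then show ?thesis unfolding hop_connected_relpow by (intro exI[of _ 1]) auto
  qed (simp add: hop_connected_refl)
qed

lemma hop_connected_trans:
  "hop_connected H s u v \<Longrightarrow> hop_connected H t v w \<Longrightarrow> hop_connected H (s + t) u w"
  unfolding hop_connected_relpow
  by (elim exE conjE, rule_tac x="m + ma" in exI) (auto intro: relpow_trans)

lemma hop_connected_mono: "hop_connected H s u v \<Longrightarrow> H \<subseteq> H' \<Longrightarrow> s \<le> t \<Longrightarrow> hop_connected H' t u v"
  unfolding hop_connected_def by (elim exE, rule_tac x=xs in exI) auto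

lemma hop_connected_sym:
  assumes "hop_connected H t u v"
  shows "hop_connected H t v u"
proof -
  have "sym ({(x, y). {x, y} \<in> H} ^^ m)" for m
  proof (induction m)
    case (Suc m)
    have "sym {(x, y). {x, y} \<in> H}" by (auto simp: sym_def insert_commute)
    with Suc show ?case unfolding sym_conv_converse_eq by (metis converse_relcomp relpow.simps(2) relpow_commute)
  qed (auto simp: sym_Id)
  then show ?thesis using assms unfolding hop_connected_relpow by (meson symD)
qed

lemma hop_connected_lift:
  assumes "\<And>x y. {x, y} \<in> H' \<Longrightarrow> hop_connected H k x y" "hop_connected H' t u v"
  shows "hop_connected H (k * t) u v"
proof -
  obtain m where m: "m \<le> t" "(u, v) \<in> {(x, y). {x, y} \<in> H'} ^^ m"
    using assms(2) unfolding hop_connected_relpow by blast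
  from m(2) have "hop_connected H (k * m) u v"
  proof (induction m arbitrary: v)
    case (Suc m)
    then obtain w where "(u, w) \<in> {(x, y). {x, y} \<in> H'} ^^ m" "{w, v} \<in> H'" by auto
    then have "hop_connected H (k * m + k) u v"
      using Suc.IH assms(1) by (intro hop_connected_trans) auto
    then show ?case by (simp add: add.commute)
  qed (simp add: hop_connected_refl)
  then show ?thesis by (rule hop_connected_mono) (use m(1) in auto)
qed

section \<open>Spanner sizes under unions, components and star removal\<close>

definition touch_edges :: "('a \<Rightarrow> 'a \<Rightarrow> bool) \<Rightarrow> 'a set \<Rightarrow> 'a set set" where
  "touch_edges adj V = {{u, v} | u v. u \<in> V \<and> v \<in> V \<and> u \<noteq> v \<and> adj u v}"

text \<open>A reflexive \<open>adj\<close> does no harm, as pairs \<open>u = v\<close> have a walk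
  of length 0. The size bound is real so that rates per vertex can be added over pieces.\<close>

definition has_spanner :: "('a \<Rightarrow> 'a \<Rightarrow> bool) \<Rightarrow> 'a set \<Rightarrow> nat \<Rightarrow> real \<Rightarrow> bool" where
  "has_spanner adj V t s \<longleftrightarrow> (\<exists>H. H \<subseteq> touch_edges adj V \<and> finite H \<and> real (card H) \<le> s \<and>
     (\<forall>u\<in>V. \<forall>v\<in>V. adj u v \<longrightarrow> hop_connected H t u v))"

lemma touch_edges_mono: "U \<subseteq> V \<Longrightarrow> touch_edges adj U \<subseteq> touch_edges adj V"
  unfolding touch_edges_def by blast

lemma finite_touch_edges: "finite V \<Longrightarrow> finite (touch_edges adj V)"
  by (rule finite_subset[of _ "Pow V"]) (auto simp: touch_edges_def)

lemma has_spannerI: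
  assumes "H \<subseteq> touch_edges adj V" "finite H" "real (card H) \<le> s"
    and "\<And>u v. u \<in> V \<Longrightarrow> v \<in> V \<Longrightarrow> adj u v \<Longrightarrow> hop_connected H t u v"
  shows "has_spanner adj V t s"
  unfolding has_spanner_def using assms by (intro exI[of _ H]) simp

lemma has_spanner_mono: "has_spanner adj V t s \<Longrightarrow> s \<le> s' \<Longrightarrow> has_spanner adj V t s'"
  unfolding has_spanner_def by (meson order_trans)

lemma has_spanner_complete:
  assumes "finite V" "t \<ge> 1"
  shows "has_spanner adj V t (real (card V) * card V)"
proof (rule has_spannerI)
  have "touch_edges adj V \<subseteq> (\<lambda>(u, v). {u, v}) ` (V \<times> V)" by (auto simp: touch_edges_def)
  then have "card (touch_edges adj V) \<le> card ((\<lambda>(u, v). {u, v}) ` (V \<times> V))"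
    using assms(1) by (intro card_mono) auto
  also have "\<dots> \<le> card (V \<times> V)" using assms(1) by (intro card_image_le) auto
  finally show "card (touch_edges adj V) \<le> real (card V) * card V"
    by (simp add: card_cartesian_product flip: of_nat_mult)
  show "hop_connected (touch_edges adj V) t u v" if "u \<in> V" "v \<in> V" "adj u v" for u v
  proof -
    have "u = v \<or> {u, v} \<in> touch_edges adj V" using that by (auto simp: touch_edges_def)
    then show ?thesis using hop_connected_step hop_connected_mono assms(2) by (metis subset_refl)
  qed
qed (use assms finite_touch_edges in auto)

text \<open>The sets may overlap, like two sides that both keep their separator; every edge of the
  union lies within one of them.\<close>

lemma has_spanner_Un:
  assumes "has_spanner adj A t r" "has_spanner adj B t s"
    and "\<And>x y. x \<in> A - B \<Longrightarrow> y \<in> B - A \<Longrightarrow> \<not> adj x y" "\<And>x y. adj x y \<Longrightarrow> adj y x"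
  shows "has_spanner adj (A \<union> B) t (r + s)"
proof -
  obtain H where H: "H \<subseteq> touch_edges adj A" "finite H" "card H \<le> r"
    "\<And>u v. u \<in> A \<Longrightarrow> v \<in> A \<Longrightarrow> adj u v \<Longrightarrow> hop_connected H t u v"
    using assms(1) unfolding has_spanner_def by blast
  obtain K where K: "K \<subseteq> touch_edges adj B" "finite K" "card K \<le> s"
    "\<And>u v. u \<in> B \<Longrightarrow> v \<in> B \<Longrightarrow> adj u v \<Longrightarrow> hop_connected K t u v"
    using assms(2) unfolding has_spanner_def by blast
  show ?thesis
  proof (rule has_spannerI[of "H \<union> K"])
    show "H \<union> K \<subseteq> touch_edges adj (A \<union> B)"
      using H(1) K(1) touch_edges_mono[of A "A \<union> B" adj] touch_edges_mono[of B "A \<union> B" adj] by blast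
    show "card (H \<union> K) \<le> r + s" using card_Un_le[of H K] H(3) K(3) by linarith
    show "hop_connected (H \<union> K) t u v" if "u \<in> A \<union> B" "v \<in> A \<union> B" "adj u v" for u v
    proof -
      have "u \<in> A \<and> v \<in> A \<or> u \<in> B \<and> v \<in> B" using that assms(3)[of u v] assms(3)[of v u] assms(4) by blast
      then show ?thesis using H(4) K(4) that(3) by (meson hop_connected_mono Un_upper1 Un_upper2 order_refl)
    qed
  qed (use H K in auto)
qed

lemma has_spanner_components:
  fixes r :: real
  assumes "finite U" "separates adj U {} b" "\<And>x y. adj x y \<Longrightarrow> adj y x"
    and "\<And>C. C \<subseteq> U \<Longrightarrow> card C \<le> b \<Longrightarrow> has_spanner adj C t (r * card C)"
  shows "has_spanner adj U t (r * card U)"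
  using assms(1-3)
proof (rule components_induct)
  show "has_spanner adj {} t (r * card {})" by (rule has_spannerI[of "{}"]) auto
next
  fix C A assume *: "C \<subseteq> U" "card C \<le> b" "A \<subseteq> U" "C \<inter> A = {}"
    "\<And>x y. x \<in> C \<Longrightarrow> y \<in> A \<Longrightarrow> \<not> adj x y" "has_spanner adj A t (r * card A)"
  have fin: "finite C" "finite A" using * assms(1) finite_subset by blast+
  have "has_spanner adj (C \<union> A) t (r * card C + r * card A)"
    using *(5,6) assms(3,4) *(1,2) by (intro has_spanner_Un) auto
  then show "has_spanner adj (C \<union> A) t (r * card (C \<union> A))"
    using fin *(4) by (simp add: card_Un_disjoint distrib_left)
qed

text \<open>An edge \<open>u w\<close> with \<open>w\<close> in the star of \<open>v\<close> is replaced by \<open>u\<close>, \<open>g u\<close>, \<open>v\<close>, \<open>w\<close>, where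
  \<open>g u\<close> is a fixed neighbour of \<open>u\<close> in the star.\<close>
lemma has_spanner_star:
  assumes V: "finite V" "v \<in> V" and T: "T = {w \<in> V. adj v w}"
    and sym: "\<And>x y. adj x y \<Longrightarrow> adj y x"
    and rest: "has_spanner adj (V - T) 3 s"
  shows "has_spanner adj V 3 (s + 2 * card V)"
proof -
  obtain H where H: "H \<subseteq> touch_edges adj (V - T)" "finite H" "card H \<le> s"
    "\<And>a b. a \<in> V - T \<Longrightarrow> b \<in> V - T \<Longrightarrow> adj a b \<Longrightarrow> hop_connected H 3 a b"
    using rest unfolding has_spanner_def by blast
  have "\<forall>u. \<exists>w'. (\<exists>w\<in>T. adj u w) \<longrightarrow> w' \<in> T \<and> adj u w'" by blast
  from choice[OF this] obtain g where g: "\<And>u. \<exists>w\<in>T. adj u w \<Longrightarrow> g u \<in> T \<and> adj u (g u)" by blast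
  define I where "I = {u \<in> V. (\<exists>w\<in>T. adj u w) \<and> u \<noteq> g u}"
  define F where "F = H \<union> ((\<lambda>w. {v, w}) ` (T - {v}) \<union> (\<lambda>u. {u, g u}) ` I)"
  have cost: "card ((\<lambda>w. {v, w}) ` (T - {v}) \<union> (\<lambda>u. {u, g u}) ` I) \<le> 2 * card V"
  proof -
    have "card ((\<lambda>w. {v, w}) ` (T - {v})) \<le> card V" "card ((\<lambda>u. {u, g u}) ` I) \<le> card V"
      using V(1) by (auto intro!: order_trans[OF card_image_le card_mono] simp: T I_def)
    then show ?thesis
      using card_Un_le[of "(\<lambda>w. {v, w}) ` (T - {v})" "(\<lambda>u. {u, g u}) ` I"] by linarith
  qed
  have via: "hop_connected F 3 u w" if "u \<in> V" "w \<in> T" "adj u w" for u w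
  proof -
    have gu: "g u \<in> T" "adj u (g u)" using g that by blast+
    have "u = g u \<or> {u, g u} \<in> F" using that by (auto simp: F_def I_def)
    then have 1: "hop_connected F 1 u (g u)" by (rule hop_connected_step)
    have "g u = v \<or> {g u, v} \<in> F" using gu by (auto simp: F_def insert_commute)
    then have 2: "hop_connected F 1 (g u) v" by (rule hop_connected_step)
    have "v = w \<or> {v, w} \<in> F" using that by (auto simp: F_def)
    then have 3: "hop_connected F 1 v w" by (rule hop_connected_step)
    have "hop_connected F (1 + 1 + 1) u w"
      using hop_connected_trans[OF hop_connected_trans[OF 1 2] 3] .
    then show ?thesis by (simp add: numeral_3_eq_3)
  qed
  show ?thesis
  proof (rule has_spannerI[of F])
    have "(\<lambda>w. {v, w}) ` (T - {v}) \<subseteq> touch_edges adj V" using V(2) by (auto simp: touch_edges_def T)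
    moreover have "(\<lambda>u. {u, g u}) ` I \<subseteq> touch_edges adj V"
    proof
      fix e assume "e \<in> (\<lambda>u. {u, g u}) ` I"
      then obtain u where u: "u \<in> V" "\<exists>w\<in>T. adj u w" "u \<noteq> g u" "e = {u, g u}" by (auto simp: I_def)
      moreover have "g u \<in> V" "adj u (g u)" using g[OF u(2)] by (auto simp: T)
      ultimately show "e \<in> touch_edges adj V" unfolding touch_edges_def by blast
    qed
    ultimately show "F \<subseteq> touch_edges adj V"
      using H(1) touch_edges_mono[of "V - T" V adj] by (auto simp: F_def)
    show "finite F" using H(2) V(1) by (auto simp: F_def T I_def)
    show "card F \<le> s + 2 * card V"
      using card_Un_le[of H "(\<lambda>w. {v, w}) ` (T - {v}) \<union> (\<lambda>u. {u, g u}) ` I"] cost H(3)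
      unfolding F_def[symmetric] by linarith
    show "hop_connected F 3 a b" if ab: "a \<in> V" "b \<in> V" "adj a b" for a b
    proof -
      consider "b \<in> T" | "a \<in> T" | "a \<in> V - T" "b \<in> V - T" using ab by blast
      then show ?thesis
      proof cases
        case 1 then show ?thesis using via ab by blast
      next
        case 2 show ?thesis by (rule hop_connected_sym[OF via[OF ab(2) 2 sym[OF ab(3)]]])
      next
        case 3 then show ?thesis using H(4) ab hop_connected_mono[of H 3 a b F 3] by (auto simp: F_def)
      qed
    qed
  qed
qed

text \<open>Each star takes at least \<open>D\<close> of the remaining vertices, which limits
  \<open>r\<close>, and restoring a star costs at most \<open>2 * N\<close> edges.\<close>

lemma remove_large_stars:
  assumes "k33_graph V adj" "card V \<le> N" "D \<ge> 1"
  shows "\<exists>U\<subseteq>V. \<exists>r. (\<forall>x\<in>U. card {y \<in> U. adj x y} < D) \<and> r * D + card U \<le> card V \<and>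
    (\<forall>s. has_spanner adj U 3 s \<longrightarrow> has_spanner adj V 3 (s + 2 * N * r))"
  using assms(1,2)
proof (induction "card V" arbitrary: V rule: less_induct)
  case less
  interpret k33_graph V adj by fact
  show ?case
  proof (cases "\<forall>x\<in>V. card {y \<in> V. adj x y} < D")
    case True
    then show ?thesis by (intro exI[of _ V] conjI exI[of _ 0]) auto
  next
    case False
    then obtain v where v: "v \<in> V" "D \<le> card {y \<in> V. adj v y}" by (auto simp: not_less)
    define T where "T = {y \<in> V. adj v y}"
    have "v \<in> T" using v adj_refl by (simp add: T_def)
    have TV: "T \<subseteq> V" by (auto simp: T_def)
    then have cT: "card (V - T) + card T = card V" using finite_V
      by (simp add: card_Diff_subset card_mono finite_subset)
    have lt: "card (V - T) < card V" using cT v assms(3) by (simp add: T_def)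
    have "k33_graph (V - T) adj" using k33_graph_subset[OF less.prems(1)] by blast
    then obtain U r where U: "U \<subseteq> V - T" "\<forall>x\<in>U. card {y \<in> U. adj x y} < D" "r * D + card U \<le> card (V - T)"
      "\<forall>s. has_spanner adj U 3 s \<longrightarrow> has_spanner adj (V - T) 3 (s + 2 * N * r)"
      using less.hyps[OF lt _ order_trans[OF less_imp_le[OF lt] less.prems(2)]] by blast
    show ?thesis
    proof (intro exI[of _ U] conjI exI[of _ "Suc r"] allI impI)
      show "Suc r * D + card U \<le> card V" using U(3) cT v by (simp add: T_def)
      fix s assume "has_spanner adj U 3 s"
      then have "has_spanner adj (V - T) 3 (s + 2 * N * r)" using U(4) by blast
      then have "has_spanner adj V 3 (s + 2 * N * r + 2 * card V)"
        using has_spanner_star[where adj = adj, OF finite_V v(1) T_def] adj_sym by blast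
      then show "has_spanner adj V 3 (s + 2 * N * Suc r)"
        by (rule has_spanner_mono) (use less.prems(2) in \<open>simp add: algebra_simps\<close>)
    qed (use U in auto)
  qed
qed

text \<open>Adding each component to the smaller side keeps the difference of the sides within the
  size of one component.\<close>

lemma group_components:
  assumes "finite U" "separates adj U {} b" "\<And>x y. adj x y \<Longrightarrow> adj y x"
  shows "\<exists>A B. U = A \<union> B \<and> A \<inter> B = {} \<and> (\<forall>x\<in>A. \<forall>y\<in>B. \<not> adj x y) \<and>
    card A \<le> card B + b \<and> card B \<le> card A + b"
  using assms
proof (rule components_induct)
  show "\<exists>A B. {} = A \<union> B \<and> A \<inter> B = {} \<and> (\<forall>x\<in>A. \<forall>y\<in>B. \<not> adj x y) \<and> card A \<le> card B + b \<and> card B \<le> card A + b"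
    by (intro exI[of _ "{}"]) auto
next
  fix C W assume *: "C \<subseteq> U" "card C \<le> b" "W \<subseteq> U" "C \<inter> W = {}"
    and na: "\<And>x y. x \<in> C \<Longrightarrow> y \<in> W \<Longrightarrow> \<not> adj x y"
    and IH: "\<exists>A B. W = A \<union> B \<and> A \<inter> B = {} \<and> (\<forall>x\<in>A. \<forall>y\<in>B. \<not> adj x y) \<and> card A \<le> card B + b \<and> card B \<le> card A + b"
  obtain A B where AB: "W = A \<union> B" "A \<inter> B = {}" "\<forall>x\<in>A. \<forall>y\<in>B. \<not> adj x y"
    "card A \<le> card B + b" "card B \<le> card A + b" "card A \<le> card B"
  proof -
    obtain A B where "W = A \<union> B" "A \<inter> B = {}" "\<forall>x\<in>A. \<forall>y\<in>B. \<not> adj x y"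
      "card A \<le> card B + b" "card B \<le> card A + b" using IH by blast
    then show thesis using that[of A B] that[of B A] assms(3) by (metis Int_commute Un_commute nle_le)
  qed
  have fin: "finite A" "finite C" using AB(1) * assms(1) by (auto intro: finite_subset)
  have c: "card (C \<union> A) = card C + card A" using fin AB(1) *(4) by (intro card_Un_disjoint) auto
  have d: "\<forall>x\<in>C \<union> A. \<forall>y\<in>B. \<not> adj x y" using AB na by blast
  show "\<exists>A B. C \<union> W = A \<union> B \<and> A \<inter> B = {} \<and> (\<forall>x\<in>A. \<forall>y\<in>B. \<not> adj x y) \<and> card A \<le> card B + b \<and> card B \<le> card A + b"
  proof (rule exI[of _ "C \<union> A"], rule exI[of _ B], intro conjI)
    show "card (C \<union> A) \<le> card B + b" "card B \<le> card (C \<union> A) + b" using c AB *(2) by auto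
    show "(C \<union> A) \<inter> B = {}" using AB *(4) by auto
  qed (use AB d in auto)
qed

lemma k33_balanced_separator:
  fixes n d l q :: nat
  assumes G: "k33_graph V adj" "card V \<le> n" "\<And>x. x \<in> V \<Longrightarrow> card {y \<in> V. adj x y} \<le> d"
    and l: "n < 2 ^ l" and q: "q \<ge> 1"
  shows "\<exists>A S B. V = A \<union> S \<union> B \<and> A \<inter> B = {} \<and> A \<inter> S = {} \<and> B \<inter> S = {} \<and> (\<forall>x\<in>A. \<forall>y\<in>B. \<not> adj x y) \<and>
    4 * card A \<le> 3 * n + 1 \<and> 4 * card B \<le> 3 * n + 1 \<and>
    card S \<le> n / q + 960 * (q * l + 1) * sqrt (d * n)"
proof -
  interpret k33_graph V adj by fact
  \<comment> \<open>Sides of total at most \<open>n\<close> and difference at most \<open>b\<close>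
    have at most \<open>(n + b) / 2\<close> vertices each, which is at most
    \<open>(3 * n + 1) / 4\<close>.\<close>
  define b where "b = (n + 1) div 2"
  have b: "n \<le> 2 * b" "2 * b \<le> n + 1" by (auto simp: b_def)
  obtain S where S: "separates adj V S b" "card S \<le> n / q + 960 * (q * l + 1) * sqrt (d * n)"
    using k33_separator[OF G b(1) l q] by blast
  obtain A B where AB: "V - S = A \<union> B" "A \<inter> B = {}" "\<forall>x\<in>A. \<forall>y\<in>B. \<not> adj x y"
    "card A \<le> card B + b" "card B \<le> card A + b"
    using group_components[OF _ separates_Diff[OF S(1)] adj_sym] finite_V by auto
  have SV: "S \<subseteq> V" using S(1) by (simp add: separates_def)
  have fin: "finite A" "finite B" using AB(1) finite_V by (metis finite_Diff finite_Un)+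
  have "card A + card B = card (V - S)" using AB fin by (simp add: card_Un_disjoint)
  also have "\<dots> \<le> n" using G(2) card_mono[OF finite_V, of "V - S"] by auto
  finally have "card A + card B \<le> n" .
  then have "4 * card A \<le> 3 * n + 1" "4 * card B \<le> 3 * n + 1" using AB(4,5) b by linarith+
  then show ?thesis using AB S(2) SV by (intro exI[of _ A] exI[of _ S] exI[of _ B]) auto
qed

section \<open>Three hops\<close>

text \<open>Divide and conquer with the separator kept on both sides. Per level the parts shrink to
  \<open>7 / 8\<close>, while the total number of vertices grows by at most the factor
  \<open>1 + 1 / L1\<close>. Stars cost at most \<open>2 * \<mu> ^ 2\<close> edges per vertex at
  each level, which the factor \<open>real j + 1\<close> sums up.\<close>

lemma three_hop_aux:
  fixes L L1 \<mu> :: nat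
  assumes L: "L \<ge> 1" and L1: "L1 = 96 * L" and mu: "\<mu> = 40000000 * L ^ 3"
  shows "k33_graph V adj \<Longrightarrow> card V < 2 ^ L \<Longrightarrow> real (card V) \<le> (8 / 7) ^ j \<Longrightarrow>
    has_spanner adj V 3 (real (card V) * (2 * real \<mu> ^ 2 + 3) * (real j + 1) * (1 + 1 / L1) ^ j)"
proof (induction j arbitrary: V)
  case (0 V)
  then have "card V \<le> 1" by simp
  interpret k33_graph V adj by fact
  have "has_spanner adj V 3 (real (card V) * card V)" using has_spanner_complete[OF finite_V] by simp
  then show ?case
  proof (rule has_spanner_mono)
    show "real (card V) * card V \<le> real (card V) * (2 * real \<mu> ^ 2 + 3) * (real 0 + 1) * (1 + 1 / L1) ^ 0"
    proof -
      have "real (card V) \<le> 1" using \<open>card V \<le> 1\<close> by simp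
      also have "\<dots> \<le> 2 * real \<mu> ^ 2 + 3" by simp
      finally have "real (card V) * card V \<le> real (card V) * (2 * real \<mu> ^ 2 + 3)"
        by (rule mult_left_mono) simp
      then show ?thesis by simp
    qed
  qed
next
  case (Suc j V)
  interpret k33_graph V adj by fact
  define N where "N = card V"
  define M where "M = 2 * real \<mu> ^ 2 + 3"
  define g where "g = 1 + 1 / real L1"
  have g: "g \<ge> 1" by (simp add: g_def)
  have M: "M \<ge> 3" by (simp add: M_def)
  have mu0: "\<mu> \<ge> 1" using L mu by simp
  have L10: "L1 \<ge> 96" using L L1 by simp
  show ?case
  proof (cases "N \<le> 3")
    case True
    have "has_spanner adj V 3 (real (card V) * card V)" using has_spanner_complete[OF finite_V] by simp
    then show ?thesis
    proof (rule has_spanner_mono)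
      have "real N * N \<le> real N * (M * (real (Suc j) + 1) * g ^ Suc j)"
      proof (rule mult_left_mono)
        have "real N \<le> 3 * 1 * 1" using True by simp
        also have "\<dots> \<le> M * (real (Suc j) + 1) * g ^ Suc j"
          using M g by (intro mult_mono one_le_power) auto
        finally show "real N \<le> M * (real (Suc j) + 1) * g ^ Suc j" .
      qed simp
      then show "real (card V) * card V \<le> real (card V) * (2 * real \<mu> ^ 2 + 3) * (real (Suc j) + 1) * (1 + 1 / L1) ^ Suc j"
        by (simp add: N_def M_def g_def mult.assoc)
    qed
  next
    case False
    \<comment> \<open>This threshold serves two ends: \<open>sqrt (d * N)\<close> is at most
      \<open>N / \<mu>\<close>, so the separator is thin, and at most \<open>\<mu>\<^sup>2\<close>
      stars with \<open>d + 1\<close> vertices fit into \<open>V\<close>.\<close>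
    define d where "d = N div \<mu>\<^sup>2"
    obtain U r where U: "U \<subseteq> V" "\<forall>x\<in>U. card {y \<in> U. adj x y} < d + 1" "r * (d + 1) + card U \<le> card V"
      and Us: "\<And>s. has_spanner adj U 3 s \<Longrightarrow> has_spanner adj V 3 (s + 2 * N * r)"
      using remove_large_stars[OF Suc.prems(1), of N "d + 1"] by (auto simp: N_def)
    have kU: "k33_graph U adj" using k33_graph_subset[OF Suc.prems(1) U(1)] .
    have UN: "card U \<le> N" using U(3) by (simp add: N_def)
    have "\<exists>A S B. U = A \<union> S \<union> B \<and> A \<inter> B = {} \<and> A \<inter> S = {} \<and> B \<inter> S = {} \<and> (\<forall>x\<in>A. \<forall>y\<in>B. \<not> adj x y) \<and>
      4 * card A \<le> 3 * N + 1 \<and> 4 * card B \<le> 3 * N + 1 \<and>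
      card S \<le> N / (2 * L1) + 960 * ((2 * L1) * L + 1) * sqrt (d * N)"
      using U(2) Suc.prems(2) L10 by (intro k33_balanced_separator[OF kU UN]) (auto simp: N_def)
    then obtain A S B where ASB: "U = A \<union> S \<union> B" "A \<inter> B = {}" "A \<inter> S = {}" "B \<inter> S = {}"
      "\<And>x y. x \<in> A \<Longrightarrow> y \<in> B \<Longrightarrow> \<not> adj x y" "4 * card A \<le> 3 * N + 1" "4 * card B \<le> 3 * N + 1"
      and S: "card S \<le> N / (2 * L1) + 960 * ((2 * L1) * L + 1) * sqrt (d * N)" by blast
    have fin: "finite A" "finite S" "finite B" using ASB(1) U(1) finite_V by (auto intro: finite_subset)
    have Sle: "card S \<le> N / L1"
    proof -
      have "real d * \<mu>\<^sup>2 \<le> N" unfolding d_def by (metis div_times_less_eq_dividend of_nat_le_iff of_nat_mult)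
      then have "real d \<le> N / (real \<mu>)\<^sup>2" using mu0 by (simp add: field_simps)
      then have "real d * N \<le> N / (real \<mu>)\<^sup>2 * N" by (rule mult_right_mono) simp
      also have "\<dots> = (N / \<mu>)\<^sup>2" by (simp add: power2_eq_square)
      finally have "real d * N \<le> (N / \<mu>)\<^sup>2" .
      then have sq: "sqrt (d * N) \<le> N / \<mu>" by (simp add: real_le_lsqrt)
      \<comment> \<open>This product dictates \<open>\<mu>\<close>: it is cubic in \<open>L\<close>,
        and 960 times 193 times 192 is below 40000000.\<close>
      have "960 * (2 * real L1 * L + 1) * (2 * L1) \<le> 960 * (193 * real L ^ 2) * (192 * L)"
      proof (rule mult_mono)
        have "1 \<le> real L ^ 2" using L by simp
        then show "960 * (2 * real L1 * L + 1) \<le> 960 * (193 * real L ^ 2)" by (simp add: L1 power2_eq_square)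
      qed (simp_all add: L1)
      also have "\<dots> \<le> \<mu>" by (simp add: mu power2_eq_square power3_eq_cube)
      finally have m: "960 * (2 * real L1 * L + 1) * (2 * L1) \<le> \<mu>" .
      have "960 * (2 * real L1 * L + 1) * sqrt (d * N) \<le> 960 * (2 * real L1 * L + 1) * (N / \<mu>)"
        using sq by (intro mult_left_mono) auto
      also have "\<dots> \<le> N / (2 * L1)"
      proof -
        have "960 * (2 * real L1 * L + 1) * (2 * L1) * N \<le> \<mu> * real N" using m by (rule mult_right_mono) simp
        then show ?thesis using mu0 L10 by (simp add: field_simps)
      qed
      finally have "960 * (2 * real L1 * L + 1) * sqrt (d * N) \<le> N / (2 * L1)" .
      moreover have "card S \<le> N / (2 * L1) + 960 * (2 * real L1 * L + 1) * sqrt (d * N)"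
        using S by (simp add: algebra_simps)
      ultimately have "card S \<le> N / (2 * L1) + N / (2 * L1)" by linarith
      also have "\<dots> = N / L1" by (simp add: field_simps)
      finally show ?thesis .
    qed
    have rle: "r \<le> \<mu>\<^sup>2"
    proof (rule ccontr)
      assume "\<not> r \<le> \<mu>\<^sup>2"
      then have "(\<mu>\<^sup>2 + 1) * (d + 1) \<le> r * (d + 1)" by (intro mult_right_mono) auto
      also have "\<dots> \<le> N" using U(3) by (simp add: N_def)
      finally have "\<mu>\<^sup>2 * (d + 1) < N" by simp
      moreover have "N < \<mu>\<^sup>2 * (d + 1)"
        unfolding d_def using mu0 by (metis Suc_eq_plus1 dividend_less_times_div mult.commute mult_Suc_right zero_less_one_class.zero_less_one less_le_trans power_eq_0_iff gr0I not_less_eq_eq add.commute)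
      ultimately show False by simp
    qed
    have size: "card (X \<union> S) \<le> real (card X) + N / L1" if "4 * card X \<le> 3 * N + 1" for X
      using card_Un_le[of X S] Sle by linarith
    have small: "real (card (X \<union> S)) \<le> (8 / 7) ^ j \<and> card (X \<union> S) < 2 ^ L" if "4 * card X \<le> 3 * N + 1" "X \<subseteq> U" for X
    proof
      have "real N / L1 \<le> N / 96" using L10 by (intro divide_left_mono) auto
      moreover have "4 * real (card X) \<le> 3 * N + 1" using that(1) by linarith
      ultimately have "8 * card (X \<union> S) \<le> 7 * real N" using size[OF that(1)] False by linarith
      then show "real (card (X \<union> S)) \<le> (8 / 7) ^ j" using Suc.prems(3) by (simp add: N_def)
      have "X \<union> S \<subseteq> V" using that ASB U by auto
      then show "card (X \<union> S) < 2 ^ L" using Suc.prems(2) card_mono[OF finite_V] by (meson le_less_trans)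
    qed
    have IH: "has_spanner adj (X \<union> S) 3 (real (card (X \<union> S)) * (M * (real j + 1) * g ^ j))"
      if "4 * card X \<le> 3 * N + 1" "X \<subseteq> U" for X
    proof -
      have "k33_graph (X \<union> S) adj" using k33_graph_subset[OF kU] that(2) ASB(1) by blast
      from Suc.IH[OF this] small[OF that] show ?thesis by (simp add: M_def g_def mult.assoc)
    qed
    have "has_spanner adj ((A \<union> S) \<union> (B \<union> S)) 3 (real (card (A \<union> S)) * (M * (real j + 1) * g ^ j)
        + real (card (B \<union> S)) * (M * (real j + 1) * g ^ j))"
      using ASB by (intro has_spanner_Un IH) (auto intro: adj_sym)
    moreover have "(A \<union> S) \<union> (B \<union> S) = U" using ASB(1) by auto
    ultimately have "has_spanner adj U 3 (real (card (A \<union> S) + card (B \<union> S)) * (M * (real j + 1) * g ^ j))"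
      by (simp add: distrib_right)
    from Us[OF this] show ?thesis
    proof (rule has_spanner_mono)
      have "card (A \<union> S) + card (B \<union> S) = card U + card S"
      proof -
        have "(A \<union> S) \<inter> B = {}" using ASB(2,4) by auto
        then show ?thesis unfolding ASB(1) using fin ASB(3,4) by (simp add: card_Un_disjoint)
      qed
      then have "real (card (A \<union> S) + card (B \<union> S)) \<le> N * g"
        using UN Sle by (simp add: g_def distrib_left)
      then have "real (card (A \<union> S) + card (B \<union> S)) * (M * (real j + 1) * g ^ j) \<le> N * g * (M * (real j + 1) * g ^ j)"
        using M g by (intro mult_right_mono mult_nonneg_nonneg) auto
      moreover have "real (2 * N * r) \<le> N * (M * g ^ Suc j)"
      proof -
        have "2 * real r \<le> M * 1" using rle by (simp add: M_def flip: of_nat_power)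
        also have "\<dots> \<le> M * g ^ Suc j" using M g by (intro mult_left_mono one_le_power) auto
        finally have "real N * (2 * real r) \<le> real N * (M * g ^ Suc j)" by (rule mult_left_mono) simp
        then show ?thesis by simp
      qed
      ultimately have "real (card (A \<union> S) + card (B \<union> S)) * (M * (real j + 1) * g ^ j) + real (2 * N * r)
        \<le> N * g * (M * (real j + 1) * g ^ j) + N * (M * g ^ Suc j)" by (rule add_mono)
      also have "\<dots> = N * M * (real (Suc j) + 1) * g ^ Suc j" by (simp add: algebra_simps)
      finally show "real (card (A \<union> S) + card (B \<union> S)) * (M * (real j + 1) * g ^ j) + real (2 * N * r)
        \<le> real (card V) * (2 * real \<mu> ^ 2 + 3) * (real (Suc j) + 1) * (1 + 1 / L1) ^ Suc j"
        by (simp add: M_def N_def g_def)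
    qed
  qed
qed

text \<open>\<open>(8 / 7) ^ 6\<close> exceeds 2, so \<open>6 * L\<close> levels suffice, and
  \<open>L1 = 96 * L\<close> keeps the growth over all of them below a constant. Of the seven
  factors \<open>L\<close>, six come from \<open>\<mu>\<^sup>2\<close> and one from the
  depth.\<close>

theorem three_hop_spanner:
  assumes "k33_graph V adj" "card V < 2 ^ L" "L \<ge> 1"
  shows "has_spanner adj V 3 (10 ^ 18 * real (card V) * real L ^ 7)"
proof -
  define j where "j = 6 * L"
  have "2 ^ L \<le> ((8 / 7) ^ 6 :: real) ^ L" by (rule power_mono) (auto simp: power_divide)
  then have "2 ^ L \<le> (8 / 7 :: real) ^ j" by (simp add: j_def power_mult)
  moreover have "real (card V) < 2 ^ L" using assms(2) by (metis of_nat_less_iff of_nat_numeral of_nat_power)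
  ultimately have "real (card V) \<le> (8 / 7) ^ j" by linarith
  from three_hop_aux[OF assms(3) refl refl assms(1,2) this] show ?thesis
  proof (rule has_spanner_mono)
    have L: "real L \<ge> 1" using assms(3) by simp
    have "(1 + 1 / real (96 * L)) ^ j \<le> (exp (1 / real (96 * L))) ^ j"
      by (intro power_mono exp_ge_add_one_self) auto
    also have "\<dots> = exp (real j / (96 * L))" by (simp add: exp_of_nat_mult[symmetric])
    also have "\<dots> = exp (1 / 16)" using L by (simp add: j_def)
    also have "\<dots> \<le> exp 1" by simp
    also have "\<dots> \<le> 3" by (rule exp_le)
    finally have e: "(1 + 1 / real (96 * L)) ^ j \<le> 3" .
    have L6: "1 \<le> real L ^ 6" using L by (rule one_le_power)
    have "(2 * real (40000000 * L ^ 3) ^ 2 + 3) * (real j + 1) * (1 + 1 / real (96 * L)) ^ j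
        \<le> (4 * 10 ^ 15 * real L ^ 6) * (7 * real L) * 3"
    proof (intro mult_mono e)
      have "(real (40000000 * L ^ 3))\<^sup>2 = 1600000000000000 * real L ^ 6"
        by (simp add: power_mult_distrib flip: power_mult)
      then show "2 * real (40000000 * L ^ 3) ^ 2 + 3 \<le> 4 * 10 ^ 15 * real L ^ 6" using L6 by simp
      show "real j + 1 \<le> 7 * real L" using L by (simp add: j_def)
    qed auto
    also have "\<dots> = 84 * 10 ^ 15 * real L ^ 7"
    proof -
      have "real L ^ 7 = real L ^ 6 * real L" by (simp flip: power_Suc2)
      then show ?thesis by simp
    qed
    also have "\<dots> \<le> 10 ^ 18 * real L ^ 7" by (intro mult_right_mono) auto
    finally have "real (card V) * ((2 * real (40000000 * L ^ 3) ^ 2 + 3) * (real j + 1) * (1 + 1 / real (96 * L)) ^ j)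
        \<le> real (card V) * (10 ^ 18 * real L ^ 7)" by (intro mult_left_mono) auto
    then show "real (card V) * (2 * real (40000000 * L ^ 3) ^ 2 + 3) * (real j + 1) * (1 + 1 / real (96 * L)) ^ j
        \<le> 10 ^ 18 * real (card V) * real L ^ 7"
      by (simp add: mult.assoc mult.left_commute[of "10 ^ 18"])
  qed
qed

section \<open>Contraction of clusters\<close>

text \<open>Greedy: while some vertex has more than \<open>d\<close> neighbours left, itself
  included, remove them as one star. \<open>c\<close> sends a vertex to the centre of its star, so
  the clusters are the fibres of \<open>c\<close>.\<close>

lemma star_packing:
  assumes "k33_graph V adj"
  shows "\<exists>Z\<subseteq>V. \<exists>c. (\<forall>z\<in>Z. c z \<in> Z \<and> c (c z) = c z \<and> adj (c z) z) \<and>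
    (\<forall>x\<in>V - Z. card {y \<in> V - Z. adj x y} \<le> d) \<and> d * card (c ` Z) \<le> card Z"
  using assms
proof (induction "card V" arbitrary: V rule: less_induct)
  case less
  interpret k33_graph V adj by fact
  show ?case
  proof (cases "\<forall>x\<in>V. card {y \<in> V. adj x y} \<le> d")
    case True
    then show ?thesis by (intro exI[of _ "{}"]) auto
  next
    case False
    then obtain v where v: "v \<in> V" "d < card {y \<in> V. adj v y}" by (auto simp: not_le)
    define T where "T = {y \<in> V. adj v y}"
    have vT: "v \<in> T" using v adj_refl by (simp add: T_def)
    have TV: "T \<subseteq> V" by (auto simp: T_def)
    have lt: "card (V - T) < card V" using finite_V vT v by (intro psubset_card_mono) auto
    obtain Z c where Z: "Z \<subseteq> V - T" and c: "\<forall>z\<in>Z. c z \<in> Z \<and> c (c z) = c z \<and> adj (c z) z"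
      and deg: "\<forall>x\<in>V - T - Z. card {y \<in> V - T - Z. adj x y} \<le> d" and card: "d * card (c ` Z) \<le> card Z"
      using less.hyps[OF lt k33_graph_subset[OF less.prems Diff_subset]] by (elim exE conjE) (rule that)
    define c' where "c' z = (if z \<in> T then v else c z)" for z
    have fZ: "finite Z" "finite T" using Z TV finite_V by (auto intro: finite_subset)
    have "V - (Z \<union> T) = V - T - Z" by auto
    then have a2: "\<forall>x\<in>V - (Z \<union> T). card {y \<in> V - (Z \<union> T). adj x y} \<le> d" using deg by simp
    have a1: "\<forall>z\<in>Z \<union> T. c' z \<in> Z \<union> T \<and> c' (c' z) = c' z \<and> adj (c' z) z"
      using c Z vT by (auto simp: c'_def T_def)
    have a3: "d * card (c' ` (Z \<union> T)) \<le> card (Z \<union> T)"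
    proof -
      have "c' ` (Z \<union> T) \<subseteq> insert v (c ` Z)" by (auto simp: c'_def)
      then have "card (c' ` (Z \<union> T)) \<le> card (insert v (c ` Z))" using fZ by (intro card_mono) auto
      also have "\<dots> \<le> Suc (card (c ` Z))" by (rule card_insert_le_m1) auto
      finally have "d * card (c' ` (Z \<union> T)) \<le> d * Suc (card (c ` Z))" by (rule mult_le_mono2)
      also have "\<dots> \<le> card T + card Z" using card v(2) by (simp add: T_def)
      also have "\<dots> = card (Z \<union> T)" using Z fZ by (subst card_Un_disjoint) auto
      finally show ?thesis .
    qed
    have a0: "Z \<union> T \<subseteq> V" using Z TV by auto
    show ?thesis
      by (rule exI[of _ "Z \<union> T"], rule conjI[OF a0], rule exI[of _ c'], rule conjI[OF a1 conjI[OF a2 a3]])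
  qed
qed

text \<open>The stars of high degree vertices, together with the boundary vertices of the pieces of the
  remaining low degree graph as trivial stars.\<close>
lemma star_piece_decomposition:
  assumes "k33_graph V adj" "d \<ge> 1"
  shows "\<exists>Z\<subseteq>V. \<exists>c. (\<forall>z\<in>Z. c z \<in> Z \<and> c (c z) = c z \<and> adj (c z) z) \<and>
    separates adj (V - Z) {} (2 ^ 147 * d ^ 14) \<and> d * card (c ` Z) \<le> card V"
proof -
  interpret k33_graph V adj by fact
  obtain Z c where Z: "Z \<subseteq> V" and c: "\<forall>z\<in>Z. c z \<in> Z \<and> c (c z) = c z \<and> adj (c z) z"
    and deg: "\<forall>x\<in>V - Z. card {y \<in> V - Z. adj x y} \<le> d" and card: "d * card (c ` Z) \<le> card Z"
    using star_packing[OF assms(1), of d] by (elim exE conjE) (rule that)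
  have "k33_graph (V - Z) adj" using k33_graph_subset[OF assms(1)] by blast
  from k33_bounded_pieces[OF this assms(2)] deg obtain S where
    S: "separates adj (V - Z) S (2 ^ 147 * d ^ 14)" "d * card S \<le> card (V - Z)" by blast
  have SV: "S \<subseteq> V - Z" using S(1) by (simp add: separates_def)
  define c' where "c' z = (if z \<in> S then z else c z)" for z
  have fin: "finite Z" "finite S" using Z SV finite_V by (auto intro: finite_subset)
  have "V - (Z \<union> S) = V - Z - S" by auto
  then have a2: "separates adj (V - (Z \<union> S)) {} (2 ^ 147 * d ^ 14)" using separates_Diff[OF S(1)] by simp
  have a1: "\<forall>z\<in>Z \<union> S. c' z \<in> Z \<union> S \<and> c' (c' z) = c' z \<and> adj (c' z) z"
    using c Z SV adj_refl by (auto simp: c'_def)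
  have a3: "d * card (c' ` (Z \<union> S)) \<le> card V"
  proof -
    have "c' ` (Z \<union> S) \<subseteq> c ` Z \<union> S" by (auto simp: c'_def)
    then have "card (c' ` (Z \<union> S)) \<le> card (c ` Z \<union> S)" using fin by (intro card_mono) auto
    also have "\<dots> \<le> card (c ` Z) + card S" by (rule card_Un_le)
    finally have "d * card (c' ` (Z \<union> S)) \<le> d * (card (c ` Z) + card S)" by (rule mult_le_mono2)
    also have "\<dots> \<le> card Z + card (V - Z)" using card S(2) by (simp add: distrib_left)
    also have "\<dots> = card V" using Z finite_V fin by (simp add: card_Diff_subset card_mono)
    finally show ?thesis .
  qed
  have a0: "Z \<union> S \<subseteq> V" using Z SV by auto
  show ?thesis
    by (rule exI[of _ "Z \<union> S"], rule conjI[OF a0], rule exI[of _ c'], rule conjI[OF a1 conjI[OF a2 a3]])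
qed

text \<open>Clusters have radius 2, so an edge of the contracted spanner costs \<open>2 + 1 + 2\<close> hops from
  centre to centre.  An edge that is not inside a piece has an end at distance at most 1 from its
  centre, which leaves \<open>1 + 5 * t + 2\<close> hops.\<close>
theorem contraction_step:
  fixes r s :: real
  assumes G: "k33_graph V adj" and d: "d \<ge> 1" and r: "r \<ge> 0"
    and contracted: "\<And>X adj'. k33_graph X adj' \<Longrightarrow> X \<subseteq> V \<Longrightarrow> d * card X \<le> card V \<Longrightarrow> has_spanner adj' X t s"
    and pieces: "\<And>C. C \<subseteq> V \<Longrightarrow> card C \<le> 2 ^ 147 * d ^ 14 \<Longrightarrow> has_spanner adj C (5 * t + 3) (r * card C)"
  shows "has_spanner adj V (5 * t + 3) (card V + s + r * card V)"
proof -
  interpret k33_graph V adj by fact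
  obtain Z c where ZV: "Z \<subseteq> V" and c: "\<And>z. z \<in> Z \<Longrightarrow> c z \<in> Z \<and> c (c z) = c z \<and> adj (c z) z"
    and sep: "separates adj (V - Z) {} (2 ^ 147 * d ^ 14)" and few: "d * card (c ` Z) \<le> card V"
    using star_piece_decomposition[OF G d] by (elim exE conjE) (rule that, auto)
  define I where "I = V - Z"
  have fI: "finite I" using finite_V by (simp add: I_def)
  have "has_spanner adj I (5 * t + 3) (r * card I)"
    unfolding I_def by (rule has_spanner_components[OF _ sep adj_sym]) (use finite_V pieces in auto)
  then obtain HI where HI: "HI \<subseteq> touch_edges adj I" "finite HI" "real (card HI) \<le> r * card I"
    "\<And>u v. u \<in> I \<Longrightarrow> v \<in> I \<Longrightarrow> adj u v \<Longrightarrow> hop_connected HI (5 * t + 3) u v"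
    unfolding has_spanner_def by blast
  define h where "h y = (SOME z. z \<in> Z \<and> adj y z)" for y
  have h: "h y \<in> Z \<and> adj y (h y)" if "\<exists>z\<in>Z. adj y z" for y
    unfolding h_def by (rule someI_ex) (use that in blast)
  \<comment> \<open>Clusters absorb outside neighbours, each through one chosen \<open>h y\<close>,
    so that an edge with an end in \<open>Z\<close> has both ends in clusters.\<close>
  define Y where "Y = Z \<union> {y \<in> I. \<exists>z\<in>Z. adj y z}"
  define par where "par y = (if y \<in> Z then c y else h y)" for y
  have YV: "Y \<subseteq> V" using ZV by (auto simp: Y_def I_def)
  have ZY: "Z \<subseteq> Y" by (auto simp: Y_def)
  have par: "par y \<in> Z" "adj y (par y)" if "y \<in> Y" for y
    using that c[of y] h[of y] adj_sym[of "c y" y] unfolding Y_def par_def by (auto split: if_splits)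
  have cpar: "c (par z) = c z" "par z = c z" if "z \<in> Z" for z using c that by (auto simp: par_def)
  \<comment> \<open>Centres serve as vertices of the contracted graph, which thus stays in the type
    of \<open>V\<close>; so \<open>contracted\<close> can be supplied by an induction hypothesis at
    a fixed type.\<close>
  define X where "X = c ` Z"
  define K where "K x = {y \<in> Y. c (par y) = x}" for x
  have X: "x \<in> Z" "c x = x" "x \<in> K x" if "x \<in> X" for x
    using that c cpar ZY by (auto simp: X_def K_def)
  have KV: "K x \<subseteq> V" for x using YV by (auto simp: K_def)
  define adj' where "adj' = (\<lambda>x x'. \<exists>y\<in>K x. \<exists>y'\<in>K x'. adj y y')"
  have k33': "k33_graph X (\<lambda>x x'. \<exists>y\<in>K x. \<exists>y'\<in>K x'. adj y y')"
  proof (rule k33_graph_contract[OF G, where center = "\<lambda>x. x"])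
    show "finite X" unfolding X_def using ZV finite_V by (auto intro: finite_subset)
    show "x \<in> K x \<and> K x \<subseteq> V" if "x \<in> X" for x using X that KV by blast
    show "joined adj (K x) x y" if "x \<in> X" "y \<in> K x" for x y
    proof -
      have y: "y \<in> Y" "c (par y) = x" using that by (auto simp: K_def)
      have p: "par y \<in> K x" using par[OF y(1)] y cpar ZY by (auto simp: K_def)
      have "adj x (par y)" using c[OF par(1)[OF y(1)]] y by simp
      then have "joined adj (K x) x (par y)" using X that p by (intro joined_edge)
      moreover have "joined adj (K x) (par y) y" using p that par[OF y(1)] adj_sym by (intro joined_edge)
      ultimately show ?thesis by (rule joined_trans)
    qed
  qed
  have "X \<subseteq> V" using ZV X by blast
  then have "has_spanner adj' X t s"
    unfolding adj'_def by (rule contracted[OF k33']) (use few in \<open>simp add: X_def\<close>)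
  then obtain H' where H': "H' \<subseteq> touch_edges adj' X" "finite H'" "real (card H') \<le> s"
    "\<And>x x'. x \<in> X \<Longrightarrow> x' \<in> X \<Longrightarrow> adj' x x' \<Longrightarrow> hop_connected H' t x x'"
    unfolding has_spanner_def by blast
  \<comment> \<open>The original edge \<open>f\<close> realises the contracted edge
    \<open>e\<close>; one realisation per edge of \<open>H'\<close> is kept.\<close>
  define link where "link e f \<longleftrightarrow> (\<exists>x x' y y'. e = {x, x'} \<and> x \<noteq> x' \<and> y \<in> K x \<and> y' \<in> K x' \<and> adj y y' \<and> f = {y, y'})"
    for e f
  define rep where "rep e = (SOME f. link e f)" for e
  have rep: "link e (rep e)" if e: "e \<in> H'" for e
  proof -
    have "e \<in> touch_edges adj' X" using H'(1) e by blast
    then obtain x x' where "e = {x, x'}" "x \<noteq> x'" "adj' x x'" unfolding touch_edges_def by blast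
    moreover from this(3) obtain y y' where "y \<in> K x" "y' \<in> K x'" "adj y y'" unfolding adj'_def by blast
    ultimately have "link e {y, y'}" unfolding link_def by blast
    then have "\<exists>f. link e f" by blast
    then show ?thesis unfolding rep_def by (rule someI_ex)
  qed
  define F where "F = (\<lambda>y. {y, par y}) ` {y \<in> Y. y \<noteq> par y}"
  define H where "H = F \<union> rep ` H' \<union> HI"
  have parF: "hop_connected H 1 y (par y)" if "y \<in> Y" for y
    by (rule hop_connected_step) (use that in \<open>auto simp: H_def F_def\<close>)
  have Zc: "hop_connected H 1 z (c z)" if "z \<in> Z" for z
    using parF[of z] cpar(2)[OF that] ZY that by auto
  have Kc: "hop_connected H 2 y x" if "y \<in> K x" for x y
  proof -
    have "y \<in> Y" "c (par y) = x" using that by (auto simp: K_def)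
    then have "hop_connected H (1 + 1) y x"
      using hop_connected_trans[OF parF Zc[OF par(1)]] by blast
    then show ?thesis by (simp add: numeral_2_eq_2)
  qed
  have five: "hop_connected H 5 a b" if ab: "{a, b} \<in> H'" for a b
  proof -
    obtain x x' y y' where l: "{a, b} = {x, x'}" "x \<noteq> x'" "y \<in> K x" "y' \<in> K x'" "adj y y'" "rep {a, b} = {y, y'}"
      using rep[OF ab] unfolding link_def by blast
    have "{y, y'} \<in> H" using ab l(6) by (auto simp: H_def intro!: image_eqI[of _ rep "{a, b}"])
    then have "hop_connected H 1 y y'" by (intro hop_connected_step) simp
    then have "hop_connected H (2 + 1 + 2) x x'"
      using hop_connected_trans[OF hop_connected_trans[OF hop_connected_sym[OF Kc[OF l(3)]]] Kc[OF l(4)]] by blast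
    then have "hop_connected H 5 x x'" by simp
    then show ?thesis using l(1) hop_connected_sym by (metis doubleton_eq_iff)
  qed
  have out: "hop_connected H (5 * t + 3) u v" if u: "u \<in> Z" and v: "v \<in> V" and uv: "adj u v" for u v
  proof -
    have vY: "v \<in> Y" using u v adj_sym[OF uv] by (auto simp: Y_def I_def)
    have cu: "c u \<in> X" "u \<in> K (c u)" using u cpar ZY by (auto simp: X_def K_def)
    have cv: "c (par v) \<in> X" "v \<in> K (c (par v))" using par[OF vY] vY by (auto simp: X_def K_def)
    have "adj' (c u) (c (par v))" unfolding adj'_def using cu cv uv by blast
    then have "hop_connected H' t (c u) (c (par v))" using H'(4) cu cv by blast
    then have "hop_connected H (5 * t) (c u) (c (par v))"
      using hop_connected_lift[of H' H 5 t] five by blast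
    from hop_connected_trans[OF hop_connected_trans[OF Zc[OF u] this] hop_connected_sym[OF Kc[OF cv(2)]]]
    show ?thesis by (rule hop_connected_mono) auto
  qed
  show ?thesis
  proof (rule has_spannerI[of H])
    have "F \<subseteq> touch_edges adj V"
    proof
      fix e assume "e \<in> F"
      then obtain y where y: "y \<in> Y" "y \<noteq> par y" "e = {y, par y}" by (auto simp: F_def)
      moreover have "par y \<in> V" "y \<in> V" using par[OF y(1)] y ZV YV by auto
      ultimately show "e \<in> touch_edges adj V" using par(2)[OF y(1)] unfolding touch_edges_def by blast
    qed
    moreover have "rep ` H' \<subseteq> touch_edges adj V"
    proof
      fix f assume "f \<in> rep ` H'"
      then obtain x x' y y' where l: "x \<noteq> x'" "y \<in> K x" "y' \<in> K x'" "adj y y'" "f = {y, y'}"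
        using rep unfolding link_def by blast
      moreover from l have "y \<noteq> y'" by (auto simp: K_def)
      moreover have "y \<in> V" "y' \<in> V" using l KV by blast+
      ultimately show "f \<in> touch_edges adj V" unfolding touch_edges_def by blast
    qed
    moreover have "HI \<subseteq> touch_edges adj V"
      using HI(1) touch_edges_mono[of I V adj] by (auto simp: I_def)
    ultimately show "H \<subseteq> touch_edges adj V" by (auto simp: H_def)
    have fY: "finite Y" using YV finite_V finite_subset by blast
    then show "finite H" using HI(2) H'(2) by (auto simp: H_def F_def)
    have "card F \<le> card {y \<in> Y. y \<noteq> par y}" unfolding F_def using fY by (intro card_image_le) auto
    also have "\<dots> \<le> card V" using YV finite_V by (intro card_mono) auto
    finally have "card F \<le> card V" .
    moreover have "card (rep ` H') \<le> card H'" using H'(2) by (rule card_image_le)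
    moreover have "r * card I \<le> r * card V"
      using r finite_V by (intro mult_left_mono) (auto simp: I_def intro: card_mono)
    ultimately show "real (card H) \<le> card V + s + r * card V"
      using card_Un_le[of F "rep ` H'"] card_Un_le[of "F \<union> rep ` H'" HI] HI(3) H'(3)
      unfolding H_def by linarith
    show "hop_connected H (5 * t + 3) u v" if u: "u \<in> V" and v: "v \<in> V" and uv: "adj u v" for u v
    proof -
      consider "u \<in> Z" | "v \<in> Z" | "u \<in> I" "v \<in> I" using u v by (auto simp: I_def)
      then show ?thesis
      proof cases
        case 1 then show ?thesis using out v uv by blast
      next
        case 2 show ?thesis by (rule hop_connected_sym[OF out[OF 2 u adj_sym[OF uv]]])
      next
        case 3
        show ?thesis by (rule hop_connected_mono[OF HI(4)[OF 3 uv]]) (auto simp: H_def)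
      qed
    qed
  qed
qed

section \<open>The inverse Ackermann hierarchy\<close>

text \<open>This is \<open>inv_ack (Suc k)\<close> on natural numbers, so the index is shifted by
  one and \<open>alpha 0\<close> is the binary logarithm, rounded up. The shift skips halving, the
  only level that leaves the integers.\<close>

definition alpha :: "nat \<Rightarrow> nat \<Rightarrow> nat" where
  "alpha k n = (LEAST i. (inv_ack k ^^ i) (real n) \<le> 1)"

lemma inv_ack_Suc_alpha: "inv_ack (Suc k) (real n) = real (alpha k n)"
  by (simp add: alpha_def)

lemma alpha_0: "alpha 0 n = (LEAST i. n \<le> 2 ^ i)"
proof -
  have "(inv_ack 0 ^^ i) x = x / 2 ^ i" for i and x :: real
    by (induction i) auto
  moreover have "(real n / 2 ^ i \<le> 1) = (n \<le> 2 ^ i)" for i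
  proof -
    have "(real n / 2 ^ i \<le> 1) = (real n \<le> real (2 ^ i))" by simp
    then show ?thesis by (simp only: of_nat_le_iff)
  qed
  ultimately show ?thesis by (simp add: alpha_def)
qed

lemma alpha_Suc: "alpha (Suc k) n = (LEAST i. (alpha k ^^ i) n \<le> 1)"
proof -
  have "(inv_ack (Suc k) ^^ i) (real n) = real ((alpha k ^^ i) n)" for i
    by (induction i) (simp_all add: inv_ack_Suc_alpha del: inv_ack.simps)
  then show ?thesis by (simp add: alpha_def[of "Suc k"] del: inv_ack.simps)
qed

lemma le_power_alpha_0: "n \<le> 2 ^ alpha 0 n"
  unfolding alpha_0 by (rule LeastI[of _ n]) simp

lemma alpha_0_le: "n \<le> 2 ^ i \<Longrightarrow> alpha 0 n \<le> i"
  unfolding alpha_0 by (rule Least_le)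

lemma power_less_alpha_0:
  assumes "alpha 0 n = Suc i"
  shows "2 ^ i < n"
  using alpha_0_le[of n i] assms by (cases "n \<le> 2 ^ i") auto

lemma alpha_0_mono: "m \<le> n \<Longrightarrow> alpha 0 m \<le> alpha 0 n"
  using alpha_0_le le_power_alpha_0 order_trans by blast

lemma alpha_0_less:
  assumes "n \<ge> 1"
  shows "alpha 0 n < n"
proof -
  have "n - 1 < 2 ^ (n - 1)" by (rule less_exp)
  then have "alpha 0 n \<le> n - 1" by (intro alpha_0_le) linarith
  then show ?thesis using assms by simp
qed

text \<open>One simultaneous induction: the iteration at level \<open>Suc k\<close> terminates
  because \<open>alpha k n < n\<close>, and this decrease is itself obtained from the comparison
  with \<open>alpha 0\<close>.\<close>

lemma alpha_props:
  "(\<forall>n\<le>1. alpha k n = 0) \<and> (\<forall>n\<ge>2. 1 \<le> alpha k n \<and> alpha k n < n) \<and> mono (alpha k) \<and>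
    (\<forall>n. alpha k n \<le> alpha 0 n) \<and> (\<forall>n\<ge>2. alpha (Suc k) n = Suc (alpha (Suc k) (alpha k n)))"
proof (induction k)
  have rec: "alpha (Suc k) n = Suc (alpha (Suc k) (alpha k n))"
    if lt: "\<forall>n\<ge>2. alpha k n < n" and n: "n \<ge> 2" for k n
  proof -
    have "\<exists>i. (alpha k ^^ i) m \<le> 1" for m
    proof (induction m rule: less_induct)
      case (less m)
      show ?case
      proof (cases "m \<le> 1")
        case True then show ?thesis by (intro exI[of _ 0]) simp
      next
        case False
        then obtain i where "(alpha k ^^ i) (alpha k m) \<le> 1" using less lt by fastforce
        then have "(alpha k ^^ Suc i) m \<le> 1" by (simp add: funpow_swap1)
        then show ?thesis by blast
      qed
    qed
    then obtain i where "(alpha k ^^ i) n \<le> 1" by blast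
    then have "(LEAST i. (alpha k ^^ i) n \<le> 1) = Suc (LEAST i. (alpha k ^^ Suc i) n \<le> 1)"
      by (rule Least_Suc) (use n in simp)
    then show ?thesis unfolding alpha_Suc by (simp add: funpow_swap1)
  qed
  {
    case 0
    have z: "alpha 0 n = 0" if "n \<le> 1" for n using alpha_0_le[of n 0] that by simp
    moreover have "1 \<le> alpha 0 n" if "n \<ge> 2" for n
      using le_power_alpha_0[of n] that by (cases "alpha 0 n") auto
    moreover have "alpha 0 n < n" if "n \<ge> 2" for n using alpha_0_less that by simp
    ultimately show ?case using rec alpha_0_mono by (simp add: mono_def)
  next
    case (Suc k)
    then have IH: "\<And>n. n \<le> 1 \<Longrightarrow> alpha k n = 0" "\<And>n. n \<ge> 2 \<Longrightarrow> 1 \<le> alpha k n" "\<And>n. n \<ge> 2 \<Longrightarrow> alpha k n < n"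
      "\<And>m n. m \<le> n \<Longrightarrow> alpha k m \<le> alpha k n" "\<And>n. alpha k n \<le> alpha 0 n"
      "\<And>n. n \<ge> 2 \<Longrightarrow> alpha (Suc k) n = Suc (alpha (Suc k) (alpha k n))"
      by (auto simp: mono_def)
    have z: "alpha (Suc k) n = 0" if "n \<le> 1" for n
      unfolding alpha_Suc by (rule Least_eq_0) (use that in simp)
    have pos: "1 \<le> alpha (Suc k) n" if "n \<ge> 2" for n using IH(6)[OF that] by simp
    \<comment> \<open>After one application, \<open>m = alpha k n\<close> is at most
      \<open>alpha 0 n\<close>; the remaining count is at most \<open>alpha 0 m < m\<close>, which
      leaves room for the step just made.\<close>
    have le0: "alpha (Suc k) n \<le> alpha 0 n" for n
    proof (induction n rule: less_induct)
      case (less n)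
      show ?case
      proof (cases "n \<ge> 2")
        case True
        define m where "m = alpha k n"
        have m: "1 \<le> m" "m < n" "m \<le> alpha 0 n" using IH True by (auto simp: m_def)
        have "alpha (Suc k) n = Suc (alpha (Suc k) m)" using IH(6)[OF True] by (simp add: m_def)
        also have "\<dots> \<le> Suc (alpha 0 m)" using less m by simp
        also have "\<dots> \<le> m" using alpha_0_less[OF m(1)] by simp
        finally show ?thesis using m by simp
      qed (use z in simp)
    qed
    have lt: "alpha (Suc k) n < n" if "n \<ge> 2" for n using le0[of n] alpha_0_less[of n] that by simp
    have mono: "alpha (Suc k) m \<le> alpha (Suc k) n" if "m \<le> n" for m n
      using that
    proof (induction n arbitrary: m rule: less_induct)
      case (less n)
      show ?case
      proof (cases "m \<ge> 2")
        case True
        then have "n \<ge> 2" using less by simp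
        then show ?thesis using True IH(6)[of m] IH(6)[of n] less.IH[OF IH(3)] IH(4)[OF less.prems] by simp
      qed (use z in simp)
    qed
    show ?case using z pos lt mono le0 rec by (simp add: mono_def)
  }
qed

lemma
  shows alpha_le_1: "n \<le> 1 \<Longrightarrow> alpha k n = 0"
    and alpha_ge_1: "n \<ge> 2 \<Longrightarrow> 1 \<le> alpha k n"
    and alpha_less: "n \<ge> 2 \<Longrightarrow> alpha k n < n"
    and alpha_mono: "m \<le> n \<Longrightarrow> alpha k m \<le> alpha k n"
    and alpha_le_alpha_0: "alpha k n \<le> alpha 0 n"
    and alpha_rec: "n \<ge> 2 \<Longrightarrow> alpha (Suc k) n = Suc (alpha (Suc k) (alpha k n))"
  using alpha_props[of k] by (auto simp: mono_def)

lemma eventually_polynomial_le_power2: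
  fixes M e :: nat
  shows "\<exists>a0. \<forall>a\<ge>a0. M * a ^ e \<le> 2 ^ a"
proof -
  have "((\<lambda>x::real. x ^ e / exp x) \<longlongrightarrow> 0) at_top" by (rule tendsto_power_div_exp_0)
  moreover have "filterlim (\<lambda>a::nat. real a * ln 2) at_top at_top"
    by (rule filterlim_at_top_mult_tendsto_pos[OF tendsto_const]) (auto simp: filterlim_real_sequentially mult.commute)
  ultimately have "((\<lambda>a::nat. (real a * ln 2) ^ e / exp (real a * ln 2)) \<longlongrightarrow> 0) at_top"
    by (rule filterlim_compose)
  then have "((\<lambda>a. real M / ln 2 ^ e * ((real a * ln 2) ^ e / exp (real a * ln 2))) \<longlongrightarrow> real M / ln 2 ^ e * 0) at_top"
    by (intro tendsto_mult tendsto_const)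
  then have "eventually (\<lambda>a. real M / ln 2 ^ e * ((real a * ln 2) ^ e / exp (real a * ln 2)) < 1) at_top"
    by (rule order_tendstoD) simp
  then obtain a0 where a0: "\<And>a. a \<ge> a0 \<Longrightarrow> real M / ln 2 ^ e * ((real a * ln 2) ^ e / exp (real a * ln 2)) < 1"
    by (auto simp: eventually_at_top_linorder)
  have "M * a ^ e \<le> 2 ^ a" if "a \<ge> a0" for a
  proof -
    have "exp (real a * ln 2) = 2 ^ a" by (simp add: exp_of_nat_mult)
    then have "real M * real a ^ e / 2 ^ a < 1" using a0[OF that] by (simp add: power_mult_distrib)
    then have "real (M * a ^ e) \<le> real (2 ^ a)" by (simp add: field_simps)
    then show ?thesis by (simp only: of_nat_le_iff)
  qed
  then show ?thesis by blast
qed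

text \<open>The logarithm of a polynomial in \<open>y\<close> is linear in \<open>log y\<close>, so
  a polynomial in it is eventually below \<open>y\<close>. This is why two rounds of recursion
  suffice to get down to \<open>alpha k n\<close>.\<close>

lemma polynomial_log_polynomial_le:
  fixes D e :: nat
  assumes "D \<ge> 1"
  shows "\<exists>y0. \<forall>y\<ge>y0. D * (alpha 0 (D * y ^ e)) ^ e \<le> y"
proof -
  \<comment> \<open>The additional factor 2 is there because only \<open>2 ^ (a - 1) < y\<close> is
    known for the rounded logarithm \<open>a\<close> of \<open>y\<close>.\<close>
  obtain a0 where a0: "\<And>a. a \<ge> a0 \<Longrightarrow> (2 * D * (D + e) ^ e) * a ^ e \<le> 2 ^ a"
    using eventually_polynomial_le_power2[of "2 * D * (D + e) ^ e" e] by blast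
  have "D * (alpha 0 (D * y ^ e)) ^ e \<le> y" if y: "y \<ge> 2 ^ a0 + 2" for y
  proof -
    define a where "a = alpha 0 y"
    have "a \<ge> 1" unfolding a_def by (rule alpha_ge_1) (use y in simp)
    then obtain b where b: "a = Suc b" by (cases a) auto
    have "a0 \<le> a"
    proof (rule ccontr)
      assume "\<not> a0 \<le> a"
      then have "(2::nat) ^ a \<le> 2 ^ a0" by (intro power_increasing) auto
      moreover have "y \<le> 2 ^ a" unfolding a_def by (rule le_power_alpha_0)
      ultimately show False using y by linarith
    qed
    have "D * y ^ e \<le> 2 ^ D * (2 ^ a) ^ e"
      using le_power_alpha_0[of y] by (intro mult_le_mono power_mono) (auto simp: a_def less_imp_le)
    also have "\<dots> = 2 ^ (D + a * e)" by (simp add: power_add power_mult)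
    finally have "alpha 0 (D * y ^ e) \<le> D + a * e" by (rule alpha_0_le)
    also have "\<dots> \<le> D * a + a * e" using \<open>a \<ge> 1\<close> by simp
    also have "\<dots> = (D + e) * a" by (simp add: algebra_simps)
    finally have "D * (alpha 0 (D * y ^ e)) ^ e \<le> D * ((D + e) * a) ^ e"
      by (intro mult_left_mono power_mono) auto
    also have "2 * \<dots> \<le> 2 ^ a" using a0[OF \<open>a0 \<le> a\<close>] by (simp add: power_mult_distrib mult.assoc)
    then have "D * ((D + e) * a) ^ e \<le> 2 ^ b" by (simp add: b)
    also have "\<dots> \<le> y" using power_less_alpha_0[of y b] b by (simp add: a_def)
    finally show ?thesis .
  qed
  then show ?thesis by blast
qed

section \<open>Recursion along the hierarchy\<close>

lemma has_spanner_trivial: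
  assumes "finite V" "card V \<le> 1" "s \<ge> 0"
  shows "has_spanner adj V t s"
proof (rule has_spannerI[of "{}"])
  fix u v assume "u \<in> V" "v \<in> V"
  then have "u = v" using assms card_le_Suc0_iff_eq[of V] by auto
  then show "hop_connected {} t u v" by (simp add: hop_connected_refl)
qed (use assms in auto)

fun hops :: "nat \<Rightarrow> nat" where
  "hops 0 = 3"
| "hops (Suc k) = 5 * hops k + 3"

text \<open>\<open>5 * t + 3\<close> has the fixed point \<open>- 3 / 4\<close>, so
  \<open>4 * hops k + 3\<close> is multiplied by 5 each time, and the division is exact. The
  exponent is \<open>Suc k\<close> because \<open>hops k\<close> goes with \<open>alpha k\<close>,
  level \<open>Suc k\<close> of the hierarchy.\<close>

lemma hops_eq: "hops k = 3 * (5 ^ Suc k - 1) div 4"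
proof -
  have "4 * hops k + 3 = 3 * 5 ^ Suc k" by (induction k) auto
  then have "3 * (5 ^ Suc k - 1) = 4 * hops k" by (simp add: right_diff_distrib')
  then show ?thesis by simp
qed

text \<open>\<open>d\<close> is the number of edges per vertex of the given spanner. Contraction
  divides the number of vertices by at least \<open>d\<close>, so the contracted graph needs at most
  \<open>card V\<close> edges; another \<open>card V\<close> attach vertices to clusters.\<close>

lemma hop_spanner_step:
  fixes C c :: nat and r :: real
  assumes C: "C \<ge> 1"
    and IH: "\<And>(V :: 'a set) adj. k33_graph V adj \<Longrightarrow> has_spanner adj V t (C * card V * alpha k (card V) ^ c)"
    and G: "k33_graph (V :: 'a set) adj" and n: "card V \<ge> 2" and r: "r \<ge> 0"
    and pieces: "\<And>U. U \<subseteq> V \<Longrightarrow> card U \<le> 2 ^ 147 * (C * alpha k (card V) ^ c) ^ 14 \<Longrightarrow>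
      has_spanner adj U (5 * t + 3) (r * card U)"
  shows "has_spanner adj V (5 * t + 3) ((r + 2) * card V)"
proof -
  define d where "d = C * alpha k (card V) ^ c"
  have "1 \<le> alpha k (card V)" using n by (rule alpha_ge_1)
  then have "1 \<le> alpha k (card V) ^ c" by (rule one_le_power)
  then have d: "d \<ge> 1" using C by (simp add: d_def)
  have fV: "finite V" using G by (rule k33_graph.finite_V)
  have "has_spanner adj V (5 * t + 3) (real (card V) + real (card V) + r * card V)"
  proof (rule contraction_step[OF G d r])
    fix X :: "'a set" and adj'
    assume X: "k33_graph X adj'" "X \<subseteq> V" "d * card X \<le> card V"
    have "C * card X * alpha k (card X) ^ c \<le> C * card X * alpha k (card V) ^ c"
      using X(2) fV by (intro mult_le_mono2 power_mono alpha_mono card_mono) auto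
    also have "\<dots> = d * card X" by (simp add: d_def)
    finally have "C * card X * alpha k (card X) ^ c \<le> card V" using X(3) by linarith
    then show "has_spanner adj' X t (card V)"
      using has_spanner_mono[OF IH[OF X(1)]] by (simp only: of_nat_le_iff)
  qed (use pieces in \<open>auto simp: d_def\<close>)
  then show ?thesis by (rule has_spanner_mono) (simp add: distrib_right)
qed

text \<open>For large \<open>y = alpha k n\<close>, two rounds leave pieces of at most
  \<open>y\<close> vertices and cost 4 edges per vertex; \<open>alpha (Suc k) n\<close> counts how
  often \<open>n\<close> can be replaced by \<open>alpha k n\<close>. The power \<open>c\<close>
  disappears because it affects only the piece size.\<close>

lemma hop_spanner_improve:
  fixes C c :: nat
  assumes C: "C \<ge> 1"
    and IH: "\<And>(V :: 'a set) adj. k33_graph V adj \<Longrightarrow> has_spanner adj V t (C * card V * alpha k (card V) ^ c)"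
  shows "\<exists>C'\<ge>1. \<forall>(V :: 'a set) adj. k33_graph V adj \<longrightarrow>
    has_spanner adj V (5 * t + 3) (C' * card V * alpha (Suc k) (card V) ^ 1)"
proof -
  define \<phi> where "\<phi> y = 2 ^ 147 * (C * y ^ c) ^ 14" for y :: nat
  have phi: "\<phi> y = (2 ^ 147 * C ^ 14) * y ^ (c * 14)" for y
    by (simp add: \<phi>_def power_mult_distrib power_mult)
  have phi_mono: "\<phi> x \<le> \<phi> y" if "x \<le> y" for x y
    unfolding phi by (intro mult_le_mono2 power_mono that) auto
  have "1 \<le> (2 ^ 147 * C ^ 14 :: nat)" using C by simp
  from polynomial_log_polynomial_le[OF this, of "c * 14"]
  obtain y0 where y0: "\<And>y. y \<ge> y0 \<Longrightarrow> \<phi> (alpha 0 (\<phi> y)) \<le> y" unfolding phi by blast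
  define C0 where "C0 = \<phi> y0 + 2"
  have step: "has_spanner adj V (5 * t + 3) ((r + 2) * card V)"
    if G: "k33_graph V adj" and r: "r \<ge> 0" and
      p: "\<And>U. U \<subseteq> V \<Longrightarrow> card U \<le> \<phi> (alpha k (card V)) \<Longrightarrow> has_spanner adj U (5 * t + 3) (r * card U)"
    for V :: "'a set" and adj and r :: real
  proof (cases "card V \<ge> 2")
    case True
    show ?thesis by (rule hop_spanner_step[OF C IH G True r p]) (simp_all add: \<phi>_def)
  next
    case False
    then show ?thesis using r by (intro has_spanner_trivial k33_graph.finite_V[OF G]) auto
  qed
  have main: "has_spanner adj V (5 * t + 3) (real (C0 + 4 * alpha (Suc k) (card V)) * card V)"
    if "k33_graph V adj" for V :: "'a set" and adj
    using that
  proof (induction "card V" arbitrary: V rule: less_induct)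
    case (less V)
    interpret k33_graph V adj by fact
    define y where "y = alpha k (card V)"
    \<comment> \<open>Below \<open>y0\<close> the comparison may fail, but then one round leaves
      pieces of at most \<open>\<phi> y0\<close> vertices, in which all edges are kept;
      \<open>C0\<close> pays for this.\<close>
    consider "card V \<le> 1" | "card V \<ge> 2" "y < y0" | "card V \<ge> 2" "y \<ge> y0" by linarith
    then show ?case
    proof cases
      case 1 then show ?thesis by (intro has_spanner_trivial finite_V) auto
    next
      case 2
      have "has_spanner adj V (5 * t + 3) ((real (\<phi> y0) + 2) * card V)"
      proof (rule step[OF less.prems])
        fix U assume U: "U \<subseteq> V" "card U \<le> \<phi> (alpha k (card V))"
        have "\<phi> (alpha k (card V)) \<le> \<phi> y0" using 2 by (intro phi_mono) (simp add: y_def)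
        then have "real (card U) \<le> real (\<phi> y0)" using U(2) by linarith
        then have "real (card U) * card U \<le> real (\<phi> y0) * card U" by (rule mult_right_mono) simp
        moreover have "has_spanner adj U (5 * t + 3) (real (card U) * card U)"
          using U(1) finite_V finite_subset by (intro has_spanner_complete) auto
        ultimately show "has_spanner adj U (5 * t + 3) (real (\<phi> y0) * card U)"
          using has_spanner_mono by blast
      qed simp
      then show ?thesis by (rule has_spanner_mono) (auto simp: C0_def intro!: mult_right_mono)
    next
      case 3
      define r where "r = real (C0 + 4 * alpha (Suc k) y)"
      have r0: "r \<ge> 0" by (simp add: r_def)
      have "has_spanner adj V (5 * t + 3) (((r + 2) + 2) * card V)"
      proof (rule step[OF less.prems])
        fix V1 assume V1: "V1 \<subseteq> V" "card V1 \<le> \<phi> (alpha k (card V))"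
        show "has_spanner adj V1 (5 * t + 3) ((r + 2) * card V1)"
        proof (rule step[OF k33_graph_subset[OF less.prems V1(1)] r0])
          fix V2 assume V2: "V2 \<subseteq> V1" "card V2 \<le> \<phi> (alpha k (card V1))"
          \<comment> \<open>In the second round logarithmic shrinking is enough, whatever
            \<open>k\<close> is.\<close>
          have "alpha k (card V1) \<le> alpha 0 (\<phi> y)"
            using alpha_mono[of "card V1" "\<phi> y" k] alpha_le_alpha_0[of k "\<phi> y"] V1(2) by (simp add: y_def)
          then have "\<phi> (alpha k (card V1)) \<le> \<phi> (alpha 0 (\<phi> y))" by (rule phi_mono)
          also have "\<dots> \<le> y" using y0 3 by blast
          finally have V2y: "card V2 \<le> y" using V2(2) by simp
          then have "card V2 < card V" using alpha_less[of "card V" k] 3 by (simp add: y_def)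
          moreover have "k33_graph V2 adj" using k33_graph_subset[OF less.prems] V1 V2 by blast
          ultimately have "has_spanner adj V2 (5 * t + 3) (real (C0 + 4 * alpha (Suc k) (card V2)) * card V2)"
            by (rule less.hyps)
          then show "has_spanner adj V2 (5 * t + 3) (r * card V2)"
          proof (rule has_spanner_mono)
            have "C0 + 4 * alpha (Suc k) (card V2) \<le> C0 + 4 * alpha (Suc k) y" using alpha_mono[OF V2y] by simp
            then show "real (C0 + 4 * alpha (Suc k) (card V2)) * card V2 \<le> r * card V2"
              unfolding r_def by (intro mult_right_mono) (simp_all only: of_nat_le_iff of_nat_0_le_iff)
          qed
        qed
      qed (use r0 in simp)
      moreover have "(r + 2) + 2 = real (C0 + 4 * alpha (Suc k) (card V))"
        using alpha_rec[OF 3(1), of k] by (simp add: r_def y_def)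
      ultimately show ?thesis by simp
    qed
  qed
  show ?thesis
  proof (intro exI[of _ "C0 + 4"] conjI allI impI)
    fix V :: "'a set" and adj assume G: "k33_graph V adj"
    show "has_spanner adj V (5 * t + 3) ((C0 + 4) * card V * alpha (Suc k) (card V) ^ 1)"
    proof (cases "card V \<ge> 2")
      case True
      have "1 \<le> alpha (Suc k) (card V)" using True by (rule alpha_ge_1)
      then have "C0 * 1 \<le> C0 * alpha (Suc k) (card V)" by (rule mult_le_mono2)
      then have "(C0 + 4 * alpha (Suc k) (card V)) * card V \<le> ((C0 + 4) * alpha (Suc k) (card V)) * card V"
        by (intro mult_le_mono1) (simp add: distrib_right)
      then have "real ((C0 + 4 * alpha (Suc k) (card V)) * card V) \<le> real ((C0 + 4) * card V * alpha (Suc k) (card V) ^ 1)"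
        unfolding of_nat_le_iff by (simp add: mult.assoc mult.commute)
      then show ?thesis using has_spanner_mono[OF main[OF G]] by simp
    next
      case False
      then show ?thesis by (intro has_spanner_trivial k33_graph.finite_V[OF G]) auto
    qed
  qed simp
qed

text \<open>The exponent is 7 only in the base case, where \<open>alpha 0\<close> is a logarithm;
  the last conjunct records that it is 1 from \<open>alpha 1\<close> on, which is level 2 of the
  hierarchy.\<close>

theorem k33_hop_spanner:
  "\<exists>C c. C \<ge> 1 \<and> (\<forall>(V :: 'a set) adj. k33_graph V adj \<longrightarrow>
    has_spanner adj V (hops k) (real (C * card V * alpha k (card V) ^ c))) \<and> (k \<ge> 1 \<longrightarrow> c = 1)"
proof (induction k)
  case 0
  have "has_spanner adj V 3 (real (128 * 10 ^ 18 * card V * alpha 0 (card V) ^ 7))"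
    if G: "k33_graph V adj" for V :: "'a set" and adj
  proof (cases "card V \<ge> 2")
    case True
    define a where "a = alpha 0 (card V)"
    have a: "a \<ge> 1" unfolding a_def using True by (rule alpha_ge_1)
    have "card V \<le> 2 ^ a" unfolding a_def by (rule le_power_alpha_0)
    also have "\<dots> < 2 ^ (a + 1)" by simp
    finally have "card V < 2 ^ (a + 1)" .
    from three_hop_spanner[OF G this] have "has_spanner adj V 3 (10 ^ 18 * real (card V) * real (a + 1) ^ 7)" by simp
    then show ?thesis
    proof (rule has_spanner_mono)
      have "real (a + 1) ^ 7 \<le> (2 * real a) ^ 7" using a by (intro power_mono) auto
      also have "\<dots> = 128 * real a ^ 7" by (simp add: power_mult_distrib)
      finally have "10 ^ 18 * real (card V) * real (a + 1) ^ 7 \<le> 10 ^ 18 * real (card V) * (128 * real a ^ 7)"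
        by (intro mult_left_mono) auto
      then show "10 ^ 18 * real (card V) * real (a + 1) ^ 7 \<le> real (128 * 10 ^ 18 * card V * alpha 0 (card V) ^ 7)"
        by (simp add: a_def)
    qed
  next
    case False
    then show ?thesis by (intro has_spanner_trivial k33_graph.finite_V[OF G]) auto
  qed
  then show ?case by (intro exI[of _ "128 * 10 ^ 18"] exI[of _ 7]) auto
next
  case (Suc k)
  then obtain C c where "C \<ge> 1" "\<And>(V :: 'a set) adj. k33_graph V adj \<Longrightarrow>
    has_spanner adj V (hops k) (real (C * card V * alpha k (card V) ^ c))" by blast
  from hop_spanner_improve[OF this] show ?case by (metis hops.simps(2))
qed

theorem theorem6:
  fixes k :: nat
  assumes "k \<ge> 2"
  shows "\<exists>C::real. \<forall>(V::nat set) (c :: nat \<Rightarrow> real \<Rightarrow> complex).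
           finite V \<and> (\<forall>v\<in>V. path (c v)) \<longrightarrow>
           (\<exists>H. is_hop_spanner (string_graph_edges V c) H (3 * (5 ^ k - 1) div 4) \<and>
                real (card H) \<le> C * real (card V) * inv_ack k (real (card V)))"
proof -
  obtain k' where k: "k = Suc k'" "k' \<ge> 1" using assms by (cases k) auto
  obtain C where C: "\<And>(V :: nat set) adj. k33_graph V adj \<Longrightarrow>
      has_spanner adj V (hops k') (real (C * card V * alpha k' (card V) ^ 1))"
    using k33_hop_spanner[of k'] k(2) by metis
  show ?thesis
  proof (intro exI[of _ "real C"] allI impI)
    fix V :: "nat set" and c :: "nat \<Rightarrow> real \<Rightarrow> complex"
    assume Vc: "finite V \<and> (\<forall>v\<in>V. path (c v))"
    let ?adj = "\<lambda>u v. path_image (c u) \<inter> path_image (c v) \<noteq> {}"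
    have E: "touch_edges ?adj V = string_graph_edges V c"
      unfolding touch_edges_def string_graph_edges_def ..
    have "k33_graph V ?adj" using Vc by (intro k33_graph_strings) auto
    from C[OF this] obtain H where H: "H \<subseteq> string_graph_edges V c"
      "real (card H) \<le> real (C * card V * alpha k' (card V) ^ 1)"
      "\<And>u v. u \<in> V \<Longrightarrow> v \<in> V \<Longrightarrow> ?adj u v \<Longrightarrow> hop_connected H (hops k') u v"
      unfolding has_spanner_def E by blast
    have "hop_connected H (hops k') u v" if "{u, v} \<in> string_graph_edges V c" for u v
    proof -
      have "u \<in> V \<and> v \<in> V \<and> ?adj u v" using that
        unfolding string_graph_edges_def by (auto simp: doubleton_eq_iff Int_commute)
      then show ?thesis using H(3) by blast
    qed
    then have "is_hop_spanner (string_graph_edges V c) H (3 * (5 ^ k - 1) div 4)"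
      using H(1) unfolding is_hop_spanner_def k hops_eq by blast
    moreover have "real (card H) \<le> real C * real (card V) * inv_ack k (real (card V))"
      using H(2) unfolding k inv_ack_Suc_alpha by simp
    ultimately show "\<exists>H. is_hop_spanner (string_graph_edges V c) H (3 * (5 ^ k - 1) div 4) \<and>
      real (card H) \<le> real C * real (card V) * inv_ack k (real (card V))" by blast
  qed
qed

end
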